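(* Let $\mathcal{V}(\cdot)=\mathbb{E}[v(\cdot)]$ with $v=\phi^*$, let $M_N\in L_{\psi^\#}$ and $\varepsilon\ge0$. Let $\{\theta_s\}_{s\ge1}$ be iid samples drawn from $\Pi$, and set $M_N^s:=M_N(\theta_s)$. Let $$\mathcal{R}^\varepsilon(M_N)=\sup_{p\in\mathfrak{D}}\{\mathbb{E}[pM_N]:\mathbb{E}[\phi(p)]\le\varepsilon\}=\min_{\mu\in\mathbb{R},\,\lambda\ge0}\{\mu+\lambda\varepsilon+\mathbb{E}[(\lambda\phi)^*(M_N-\mu)]\}$$ be the value of the coherent generalized variational inference (CGVI) problem and its two-dimensional reformulation, and let $$\widehat{\mathcal{R}}^\varepsilon_S(M_N)=\inf_{\mu\in\mathbb{R},\,\lambda\ge0}\Bigl\{\mu+\lambda\varepsilon+\frac1S\sum_{s=1}^S(\lambda\phi)^*(M_N^s-\mu)\Bigr\}$$ be its sample average approximation. Denote by $X^\star$ and $\widehat X^\star_S$ the sets of minimizers $(\mu,\lambda)$ of the first and second minimization problem, respectively. Then: (1) $\widehat{\mathcal{R}}^\varepsilon_S(M_N)\to\mathcal{R}^\varepsilon(M_N)$ a.s. as $S\to\infty$; (2) the deviation of $\widehat X^\star_S$ to $X^\star$ converges to zero a.s. as $S\to\infty$, that is, $$\mathbb{D}(\widehat X^\star_S,X^\star):=\sup_{(\mu,\lambda)\in\widehat X^\star_S}\ \inf_{(\mu',\lambda')\in X^\star}\|(\mu,\lambda)-(\mu',\lambda')\|\to0\quad\text{a.s.}$$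
   Context: $(\Theta,\mathcal{B},\Pi)$ is a complete probability space, $\mathbb{E}$ is expectation with respect to $\Pi$, and $\mathfrak{D}$ is the set of $\mathcal{B}$-measurable $p:\Theta\to[0,\infty]$ with $\mathbb{E}[p]=1$. $\phi:\mathbb{R}\to[0,+\infty]$ is proper, closed and convex with $\phi(1)=0$ and $\phi(t)=+\infty$ for $t<0$. Its Fenchel conjugate $v=\phi^*$ is a risk-averse disutility function: convex, increasing (in the weak sense), $v(x)\ge x$ for all $x\in\mathbb{R}$, $v(x)=x$ implies $x=0$, and $v(0)=0$; moreover $v(t)<+\infty$ for some $t>0$. Set $\psi(x)=\sup_{t\ge0}\{tx-v(t)\}$ and $\psi^\#(t)=\sup_{x\ge0}\{tx-\psi(x)\}$ (which equals $v(t)$ for $t\ge0$). For such a function $g$, the Orlicz space $L_g$ consists of the (a.s. equivalence classes of) $\mathcal{B}$-measurable $X$ with $\mathbb{E}[g(|X/a|)]<\infty$ for some $a>0$. $L_\psi$ (the space of densities) and $L_{\psi^\#}$ (the space of pay-off functions) are paired by $\langle p,X\rangle=\mathbb{E}[pX]$. For $\lambda\ge0$, $(\lambda\phi)^*(x)=\sup_{t\in\mathbb{R}}\{tx-\lambda\phi(t)\}$ is the Fenchel conjugate of $\lambda\phi$, where $0\cdot(+\infty)=+\infty$. $M_N(\theta)=\frac1N\sum_{n=1}^Nm(\theta,y_n)$ is the $\mathcal{B}$-measurable pay-off function for fixed data $y_1,\dots,y_N$ in a data space $\Upsilon$ and a function $m:\Theta\times\Upsilon\to\mathbb{R}$. $\|\cdot\|$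 is the norm on $\mathbb{R}^2$, and "a.s." is with respect to the sampling.
   Formalization: For ε = 0 the minimum over (μ, λ) need not be attained, and (2) can then fail; so the value is shown to equal the infimum for all ε ≥ 0, the minimum to be attained for ε > 0, and (2) is stated under the condition that X* is nonempty (automatic for ε > 0). *)

theory Defs
  imports "HOL-Probability.Probability"
begin

text \<open>
  Functions with values in \<open>[-\<infinity>, \<infinity>]\<close> have type \<open>ereal\<close>.  Properness, closedness and convexity
  are expressed through the epigraph, as usual in convex analysis.
\<close>

definition epi :: "(real \<Rightarrow> ereal) \<Rightarrow> (real \<times> real) set" where
  "epi f = {(t, r). f t \<le> ereal r}"

definition proper_fun :: "(real \<Rightarrow> ereal) \<Rightarrow> bool" where
  "proper_fun f \<longleftrightarrow> (\<forall>t. f t \<noteq> -\<infinity>) \<and> (\<exists>t. f t \<noteq> \<infinity>)"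

definition closed_fun :: "(real \<Rightarrow> ereal) \<Rightarrow> bool" where
  "closed_fun f \<longleftrightarrow> closed (epi f)"

definition convex_fun :: "(real \<Rightarrow> ereal) \<Rightarrow> bool" where
  "convex_fun f \<longleftrightarrow> convex (epi f)"

definition fenchel :: "(real \<Rightarrow> ereal) \<Rightarrow> real \<Rightarrow> ereal" where
  "fenchel f x = (SUP t. ereal (t * x) - f t)"

text \<open>
  The product \<open>\<lambda>\<phi>\<close> with the convention \<open>0 \<cdot> (+\<infinity>) = +\<infinity>\<close>; multiplication on \<open>ereal\<close> would
  give \<open>0 * \<infinity> = 0\<close>.  In particular \<open>0 \<phi>\<close> is the indicator of the effective domain of \<open>\<phi>\<close>.
\<close>

definition scale_fun :: "real \<Rightarrow> (real \<Rightarrow> ereal) \<Rightarrow> real \<Rightarrow> ereal" where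
  "scale_fun l f t = (if f t = \<infinity> then \<infinity> else ereal l * f t)"

definition divergence_fun :: "(real \<Rightarrow> ereal) \<Rightarrow> bool" where
  "divergence_fun \<phi> \<longleftrightarrow>
     (\<forall>t. 0 \<le> \<phi> t) \<and> proper_fun \<phi> \<and> closed_fun \<phi> \<and> convex_fun \<phi> \<and>
     \<phi> 1 = 0 \<and> (\<forall>t<0. \<phi> t = \<infinity>)"

definition risk_averse_disutility :: "(real \<Rightarrow> ereal) \<Rightarrow> bool" where
  "risk_averse_disutility v \<longleftrightarrow>
     convex_fun v \<and> mono v \<and> (\<forall>x. ereal x \<le> v x) \<and>
     (\<forall>x. v x = ereal x \<longrightarrow> x = 0) \<and> v 0 = 0"

text \<open>
  The conjugate over the nonnegative half-line.  For a disutility \<open>v\<close> the functions \<open>\<psi>\<close> and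
  \<open>\<psi>\<^sup>#\<close> are \<open>half_conj v\<close> and \<open>half_conj (half_conj v)\<close>.
\<close>

definition half_conj :: "(real \<Rightarrow> ereal) \<Rightarrow> real \<Rightarrow> ereal" where
  "half_conj f x = (SUP t\<in>{0..}. ereal (t * x) - f t)"

text \<open>
  Expectation of an extended real-valued random variable, as the difference of the integrals of
  its positive and negative parts (\<open>e2ennreal\<close> maps negative values to \<open>0\<close>).  On \<open>ereal\<close> one has
  \<open>\<infinity> - \<infinity> = \<infinity>\<close>, the customary convention for minimization; by the Fenchel--Young inequality
  this case does not arise for the expectations used below.
\<close>

definition expect :: "'a measure \<Rightarrow> ('a \<Rightarrow> ereal) \<Rightarrow> ereal" where
  "expect M X = enn2ereal (\<integral>\<^sup>+ w. e2ennreal (X w) \<partial>M) - enn2ereal (\<integral>\<^sup>+ w. e2ennreal (- X w) \<partial>M)"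

text \<open>Members of the Orlicz space are represented by functions rather than a.s. classes.\<close>

definition orlicz :: "'a measure \<Rightarrow> (real \<Rightarrow> ereal) \<Rightarrow> ('a \<Rightarrow> real) set" where
  "orlicz M g = {X \<in> borel_measurable M. \<exists>a>0. expect M (\<lambda>w. g \<bar>X w / a\<bar>) < \<infinity>}"

definition densities :: "'a measure \<Rightarrow> ('a \<Rightarrow> ereal) set" where
  "densities M = {p \<in> borel_measurable M. (\<forall>w\<in>space M. 0 \<le> p w) \<and> expect M p = 1}"

definition mean_payoff :: "('a \<Rightarrow> 'y \<Rightarrow> real) \<Rightarrow> (nat \<Rightarrow> 'y) \<Rightarrow> nat \<Rightarrow> 'a \<Rightarrow> real" where
  "mean_payoff m y N w = (1 / real N) * (\<Sum>n=1..N. m w (y n))"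

text \<open>
  A density is finite almost everywhere, so \<open>\<phi>(p)\<close> may be computed from the real value of \<open>p\<close>;
  the value assigned at \<open>p = \<infinity>\<close> has no influence on the expectation.
\<close>

definition cgvi_value ::
  "'a measure \<Rightarrow> (real \<Rightarrow> ereal) \<Rightarrow> real \<Rightarrow> ('a \<Rightarrow> real) \<Rightarrow> ereal" where
  "cgvi_value M \<phi> \<epsilon> X =
     (SUP p \<in> {p \<in> densities M. expect M (\<lambda>w. \<phi> (real_of_ereal (p w))) \<le> ereal \<epsilon>}.
        expect M (\<lambda>w. p w * ereal (X w)))"

definition multipliers :: "(real \<times> real) set" where
  "multipliers = {(\<mu>, l). 0 \<le> l}"

definition cgvi_objective ::
  "'a measure \<Rightarrow> (real \<Rightarrow> ereal) \<Rightarrow> real \<Rightarrow> ('a \<Rightarrow> real) \<Rightarrow> real \<times> real \<Rightarrow> ereal" where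
  "cgvi_objective M \<phi> \<epsilon> X = (\<lambda>(\<mu>, l).
     ereal (\<mu> + l * \<epsilon>) + expect M (\<lambda>w. fenchel (scale_fun l \<phi>) (X w - \<mu>)))"

definition saa_objective ::
  "(real \<Rightarrow> ereal) \<Rightarrow> real \<Rightarrow> (nat \<Rightarrow> real) \<Rightarrow> nat \<Rightarrow> real \<times> real \<Rightarrow> ereal" where
  "saa_objective \<phi> \<epsilon> x S = (\<lambda>(\<mu>, l).
     ereal (\<mu> + l * \<epsilon>) + ereal (1 / real S) * (\<Sum>s=1..S. fenchel (scale_fun l \<phi>) (x s - \<mu>)))"

definition saa_value ::
  "(real \<Rightarrow> ereal) \<Rightarrow> real \<Rightarrow> (nat \<Rightarrow> real) \<Rightarrow> nat \<Rightarrow> ereal" where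
  "saa_value \<phi> \<epsilon> x S = (INF z\<in>multipliers. saa_objective \<phi> \<epsilon> x S z)"

definition cgvi_minimizers ::
  "'a measure \<Rightarrow> (real \<Rightarrow> ereal) \<Rightarrow> real \<Rightarrow> ('a \<Rightarrow> real) \<Rightarrow> (real \<times> real) set" where
  "cgvi_minimizers M \<phi> \<epsilon> X =
     {z. is_arg_min (cgvi_objective M \<phi> \<epsilon> X) (\<lambda>z. z \<in> multipliers) z}"

definition saa_minimizers ::
  "(real \<Rightarrow> ereal) \<Rightarrow> real \<Rightarrow> (nat \<Rightarrow> real) \<Rightarrow> nat \<Rightarrow> (real \<times> real) set" where
  "saa_minimizers \<phi> \<epsilon> x S =
     {z. is_arg_min (saa_objective \<phi> \<epsilon> x S) (\<lambda>z. z \<in> multipliers) z}"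

text \<open>
  The deviation lives in \<open>[0, \<infinity>]\<close>, so that \<open>deviation {} B = 0\<close> and
  \<open>deviation A {} = \<infinity>\<close> for nonempty \<open>A\<close>.  The norm on \<open>real \<times> real\<close> is the Euclidean one.
\<close>

definition deviation :: "(real \<times> real) set \<Rightarrow> (real \<times> real) set \<Rightarrow> ennreal" where
  "deviation A B = (SUP z\<in>A. INF z'\<in>B. ennreal (norm (z - z')))"

end

theory Submission
  imports Defs "HOL-Real_Asymp.Real_Asymp"
begin

text \<open>
  Write \<open>\<phi>(1 + s) \<le> r\<close> as \<open>(s, r) \<in> A\<close>; then \<open>A\<close> is a closed convex set containing the origin, and
  since \<open>\<integral>p = 1\<close> the dual objective is \<open>E X + l\<epsilon> + E (SUP (s, r)\<in>A. s (X - \<mu>) - l r)\<close>, where the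
  supremum is nonnegative.  This form applies verbatim to the empirical measures, and it only uses
  affine functions of \<open>(\<mu>, l)\<close>: truncating the supremum to finitely many points of a countable
  dense subset of \<open>A\<close> gives Lipschitz approximations from below, for which the strong law of large
  numbers holds locally uniformly.  Hence the empirical objectives are eventually large wherever the
  true objective is, uniformly on compact sets.

  Risk aversion implies that \<open>A\<close> has points with \<open>s < 0\<close> and with \<open>s > 0\<close>, so for \<open>\<epsilon> > 0\<close> Slater's
  condition holds.  It gives strong duality with an attained minimum, by separation in \<open>\<real>\<^sup>3\<close>, and
  uniform coercivity of all objectives, which reduces everything to compact sets.

  For \<open>\<epsilon> = 0\<close> the objective is nonincreasing in \<open>l\<close> and tends to the objective of the flat part
  \<open>{a \<in> A. snd a = 0}\<close>.  If the flat part has both signs, it satisfies Slater's condition with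
  radius \<open>1\<close>, and the minimizers are the pairs whose location \<open>\<mu>\<close> is optimal for the flat problem
  and whose multiplier is large enough for the limit to be attained almost surely.  If the flat part
  is one-sided, the value is \<open>E X\<close> and a minimizer exists only if \<open>X\<close> is almost surely constant.
\<close>

text \<open>Uniformity is needed for lower bounds only. Upper bounds for empirical infima, and for
  the values at empirical minimizers, come from the strong law at single pairs fixed in advance;
  hence convergence at one minimizer suffices for the deviation. The obstacle is radius 0. There a
  set of minimizers contains a half-line in \<open>l\<close> with each of its points, and the
  multiplier required by one location need not be controlled by that of a nearby one, so compactness
  alone gives nothing. The way out is the cone of pairs \<open>(l, y)\<close> with \<open>y\<close>
  in \<open>exact A l\<close>. If \<open>exact A 1\<close> has numbers of both signs, a bounded
  change of location is paid for by a bounded increase of the multiplier. If it lies on one side of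
  0, a minimizer must be located at the essential supremum (or infimum) of the payoff; the empirical
  locations are then sample maxima (or minima), and these converge.\<close>

section \<open>A strong law of large numbers\<close>

text \<open>After centering, the cross terms of the expanded square vanish by pairwise independence,
  and a variance is at most the second moment. The bounds \<open>B k\<close> may grow with
  \<open>k\<close>, as the truncation levels in \<open>strong_law_nonneg\<close> do.\<close>

lemma (in prob_space) variance_sum_indep_vars:
  fixes Y :: "nat \<Rightarrow> 'a \<Rightarrow> real"
  assumes indep: "indep_vars (\<lambda>_. borel) Y UNIV"
    and bounded: "\<And>k w. \<bar>Y k w\<bar> \<le> B k"
  shows "variance (\<lambda>w. \<Sum>k<n. Y k w) \<le> (\<Sum>k<n. expectation (\<lambda>w. (Y k w)\<^sup>2))"
proof -
  have Y[measurable]: "Y k \<in> borel_measurable M" for k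
    using indep by (auto simp: indep_vars_def)
  have iY: "integrable M (Y k)" for k
    by (rule integrable_const_bound[of _ "B k"]) (use bounded in auto)
  define Z where "Z k w = Y k w - expectation (Y k)" for k w
  have Z[measurable]: "Z k \<in> borel_measurable M" for k
    by (simp add: Z_def[abs_def])
  have bZ: "\<bar>Z k w\<bar> \<le> B k + \<bar>expectation (Y k)\<bar>" for k w
    unfolding Z_def using bounded[of k w] by linarith
  have iZ: "integrable M (Z k)" for k
    by (rule integrable_const_bound[of _ "B k + \<bar>expectation (Y k)\<bar>"]) (use bZ in auto)
  have iZZ: "integrable M (\<lambda>w. Z i w * Z j w)" for i j
    by (rule integrable_const_bound[of _ "(B i + \<bar>expectation (Y i)\<bar>) * (B j + \<bar>expectation (Y j)\<bar>)"])
      (auto simp: abs_mult intro!: AE_I2 mult_mono bZ order_trans[OF abs_ge_zero bZ])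
  have EZ: "expectation (Z k) = 0" for k
    unfolding Z_def using iY[of k] by (simp add: prob_space)
  have ZZ0: "expectation (\<lambda>w. Z i w * Z j w) = 0" if "i \<noteq> j" for i j
  proof -
    have "indep_vars (\<lambda>_. borel) Z UNIV"
      unfolding Z_def by (rule indep_vars_compose2[OF indep]) auto
    then have "indep_vars (\<lambda>_. borel) Z {i, j}"
      by (rule indep_vars_subset) auto
    then have "(\<integral>w. (\<Prod>k\<in>{i, j}. Z k w) \<partial>M) = (\<Prod>k\<in>{i, j}. \<integral>w. Z k w \<partial>M)"
      by (intro indep_vars_lebesgue_integral) (auto simp: iZ)
    then show ?thesis using that EZ by simp
  qed
  have "variance (\<lambda>w. \<Sum>k<n. Y k w) = expectation (\<lambda>w. (\<Sum>k<n. Z k w)\<^sup>2)"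
    using iY by (simp add: Z_def sum_subtractf)
  also have "\<dots> = expectation (\<lambda>w. \<Sum>i<n. \<Sum>j<n. Z i w * Z j w)"
    by (simp add: power2_eq_square sum_product)
  also have "\<dots> = (\<Sum>i<n. \<Sum>j<n. expectation (\<lambda>w. Z i w * Z j w))"
    using iZZ by simp
  also have "\<dots> = (\<Sum>i<n. expectation (\<lambda>w. (Z i w)\<^sup>2))"
  proof (rule sum.cong)
    fix i assume "i \<in> {..<n}"
    then have "(\<Sum>j<n. expectation (\<lambda>w. Z i w * Z j w)) = (\<Sum>j\<in>{i}. expectation (\<lambda>w. Z i w * Z j w))"
      by (intro sum.mono_neutral_right) (auto simp: ZZ0)
    then show "(\<Sum>j<n. expectation (\<lambda>w. Z i w * Z j w)) = expectation (\<lambda>w. (Z i w)\<^sup>2)"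
      by (simp add: power2_eq_square)
  qed simp
  also have "\<dots> \<le> (\<Sum>i<n. expectation (\<lambda>w. (Y i w)\<^sup>2))"
  proof (rule sum_mono)
    fix i
    have "integrable M (\<lambda>w. (Y i w)\<^sup>2)"
      by (rule integrable_const_bound[of _ "(B i)\<^sup>2"])
        (use bounded in \<open>auto intro!: AE_I2 simp: abs_le_square_iff[symmetric] intro: order_trans[OF _ abs_ge_self]\<close>)
    then show "expectation (\<lambda>w. (Z i w)\<^sup>2) \<le> expectation (\<lambda>w. (Y i w)\<^sup>2)"
      unfolding Z_def by (subst variance_eq) (auto simp: iY)
  qed
  finally show ?thesis .
qed

text \<open>Borel-Cantelli in integrated form: a finite total expectation makes the series finite
  almost surely, and the terms of a convergent series tend to 0.\<close>

lemma AE_tendsto_0_of_suminf: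
  fixes f :: "nat \<Rightarrow> 'a \<Rightarrow> real"
  assumes [measurable]: "\<And>n. f n \<in> borel_measurable M"
    and "\<And>n w. 0 \<le> f n w"
    and "(\<Sum>n. \<integral>\<^sup>+ w. ennreal (f n w) \<partial>M) < \<infinity>"
  shows "AE w in M. (\<lambda>n. f n w) \<longlonglongrightarrow> 0"
proof -
  have "(\<integral>\<^sup>+ w. (\<Sum>n. ennreal (f n w)) \<partial>M) \<noteq> \<infinity>"
    using assms(3) by (subst nn_integral_suminf) auto
  then have "AE w in M. (\<Sum>n. ennreal (f n w)) \<noteq> \<infinity>"
    by (intro nn_integral_PInf_AE) auto
  then show ?thesis
  proof eventually_elim
    case (elim w)
    then have "summable (\<lambda>n. f n w)"
      using assms(2) by (intro summable_suminf_not_top) auto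
    then show ?case by (rule summable_LIMSEQ_zero)
  qed
qed

text \<open>Two geometric series are used. While \<open>\<alpha> ^ n\<close> is at most
  \<open>x\<close>, the summand is bounded by \<open>K n\<close>, and the increasing series is
  governed by its last term; afterwards it is bounded by \<open>x\<^sup>2 / \<alpha> ^ n\<close>,
  and the decreasing series is governed by its first term. The parts contribute 2 and 1 to the
  factor 3.\<close>

lemma suminf_truncated_square_le:
  fixes x \<alpha> :: real and K :: "nat \<Rightarrow> real"
  assumes "1 < \<alpha>" "0 \<le> x" and K: "\<And>n. \<alpha> ^ n \<le> K n" "\<And>n. K n \<le> 2 * \<alpha> ^ n"
  shows "(\<Sum>n. ennreal ((min x (K n))\<^sup>2 / K n)) \<le> ennreal (3 * \<alpha> / (\<alpha> - 1) * x)"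
proof (rule suminf_le_const)
  fix m
  have Kp: "0 < \<alpha> ^ n" "0 < K n" for n
    using assms(1) K(1)[of n] less_le_trans[of 0 "\<alpha> ^ n" "K n"] by auto
  obtain n0 where n0: "x < \<alpha> ^ n0" "\<And>n. n < n0 \<Longrightarrow> \<alpha> ^ n \<le> x"
  proof -
    have "\<exists>n. x < \<alpha> ^ n" using real_arch_pow[OF assms(1)] by simp
    then show ?thesis
      using that[of "LEAST n. x < \<alpha> ^ n"] by (metis (mono_tags, lifting) LeastI not_le not_less_Least)
  qed
  have t1: "(min x (K n))\<^sup>2 / K n \<le> 2 * \<alpha> ^ n" for n
  proof -
    have "(min x (K n))\<^sup>2 \<le> (K n)\<^sup>2"
      using Kp[of n] assms(2) by (intro power_mono) auto
    then have "(min x (K n))\<^sup>2 / K n \<le> K n"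
      using Kp(2)[of n] by (simp add: divide_le_eq power2_eq_square)
    then show ?thesis using K(2)[of n] by linarith
  qed
  have t2: "(min x (K n))\<^sup>2 / K n \<le> x\<^sup>2 / \<alpha> ^ n" for n
    using Kp[of n] assms(2) K(1)[of n] by (intro frac_le power_mono) auto
  have s1: "(\<Sum>n<n0. 2 * \<alpha> ^ n) \<le> 2 * \<alpha> * x / (\<alpha> - 1)"
  proof (cases n0)
    case 0
    then show ?thesis using assms by simp
  next
    case (Suc k)
    have "(\<Sum>n<n0. 2 * \<alpha> ^ n) = 2 * ((\<alpha> ^ n0 - 1) / (\<alpha> - 1))"
      using assms(1) by (subst sum_distrib_left[symmetric], subst geometric_sum) auto
    also have "\<dots> \<le> 2 * (\<alpha> * x / (\<alpha> - 1))"
      using n0(2)[of k] Suc assms(1)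
      by (intro mult_left_mono divide_right_mono) (auto intro: order_trans[of _ "\<alpha> * \<alpha> ^ k"])
    finally show ?thesis by simp
  qed
  have s2: "(\<Sum>n\<in>{n0..<n0 + m}. x\<^sup>2 / \<alpha> ^ n) \<le> \<alpha> * x / (\<alpha> - 1)"
  proof -
    have "(\<Sum>n\<in>{n0..<n0 + m}. x\<^sup>2 / \<alpha> ^ n) = (\<Sum>n<m. x\<^sup>2 / \<alpha> ^ (n + n0))"
      by (simp add: sum.shift_bounds_nat_ivl[of _ 0 n0 m, simplified] add.commute lessThan_atLeast0)
    also have "\<dots> = x\<^sup>2 / \<alpha> ^ n0 * (\<Sum>n<m. (1 / \<alpha>) ^ n)"
      by (simp add: sum_distrib_left sum_divide_distrib power_add power_divide mult.commute)
    also have "\<dots> \<le> x * (\<alpha> / (\<alpha> - 1))"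
    proof (rule mult_mono)
      show "x\<^sup>2 / \<alpha> ^ n0 \<le> x"
        using n0(1) assms Kp(1)[of n0] by (simp add: divide_le_eq power2_eq_square mult_left_mono)
      have "(\<Sum>n<m. (1 / \<alpha>) ^ n) \<le> (\<Sum>n. (1 / \<alpha>) ^ n)"
        using assms(1) by (intro sum_le_suminf summable_geometric) auto
      also have "\<dots> = 1 / (1 - 1 / \<alpha>)"
        using assms(1) by (intro suminf_geometric) auto
      also have "\<dots> = \<alpha> / (\<alpha> - 1)" using assms(1) by (simp add: field_simps)
      finally show "(\<Sum>n<m. (1 / \<alpha>) ^ n) \<le> \<alpha> / (\<alpha> - 1)" .
    qed (use assms in \<open>auto intro!: sum_nonneg\<close>)
    finally show ?thesis by (simp add: mult.commute)
  qed
  \<comment> \<open>Extending the range to \<open>n0 + m\<close> splits it at \<open>n0\<close>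
    whether or not \<open>m\<close> exceeds \<open>n0\<close>.\<close>
  have "(\<Sum>n<m. (min x (K n))\<^sup>2 / K n) \<le> (\<Sum>n\<in>{..<n0} \<union> {n0..<n0 + m}. (min x (K n))\<^sup>2 / K n)"
    using Kp by (intro sum_mono2) (auto intro!: divide_nonneg_pos)
  also have "\<dots> = (\<Sum>n<n0. (min x (K n))\<^sup>2 / K n) + (\<Sum>n\<in>{n0..<n0 + m}. (min x (K n))\<^sup>2 / K n)"
    by (intro sum.union_disjoint) auto
  also have "\<dots> \<le> (\<Sum>n<n0. 2 * \<alpha> ^ n) + (\<Sum>n\<in>{n0..<n0 + m}. x\<^sup>2 / \<alpha> ^ n)"
    by (intro add_mono sum_mono t1 t2)
  also have "\<dots> \<le> 2 * \<alpha> * x / (\<alpha> - 1) + \<alpha> * x / (\<alpha> - 1)"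
    by (intro add_mono s1 s2)
  also have "\<dots> = 3 * \<alpha> / (\<alpha> - 1) * x"
    by (simp add: add_divide_distrib[symmetric])
  finally show "(\<Sum>n<m. ennreal ((min x (K n))\<^sup>2 / K n)) \<le> ennreal (3 * \<alpha> / (\<alpha> - 1) * x)"
    using Kp by (subst sum_ennreal) (auto intro!: ennreal_leI divide_nonneg_pos)
qed auto

section \<open>Averages along geometric subsequences\<close>

lemma cesaro_tendsto:
  fixes f :: "nat \<Rightarrow> real"
  assumes "f \<longlonglongrightarrow> L"
  shows "(\<lambda>n. (\<Sum>k<n. f k) / real n) \<longlonglongrightarrow> L"
proof (rule LIMSEQ_I)
  fix e :: real assume "0 < e"
  obtain n0 where n0: "\<And>k. k \<ge> n0 \<Longrightarrow> \<bar>f k - L\<bar> < e / 2"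
    using LIMSEQ_D[OF assms, of "e / 2"] \<open>0 < e\<close> by auto
  define C where "C = (\<Sum>k<n0. \<bar>f k - L\<bar>)"
  have C0: "0 \<le> C" by (simp add: C_def sum_nonneg)
  obtain n1 where n1: "2 * C / e < real n1" using reals_Archimedean2 by blast
  have "\<bar>(\<Sum>k<n. f k) / real n - L\<bar> < e" if n: "n \<ge> max (Suc n0) (Suc n1)" for n
  proof -
    have np: "0 < real n" using n by simp
    have "\<bar>(\<Sum>k<n. f k) - real n * L\<bar> = \<bar>\<Sum>k<n. f k - L\<bar>"
      by (simp add: sum_subtractf)
    also have "\<dots> \<le> (\<Sum>k<n. \<bar>f k - L\<bar>)" by (rule sum_abs)
    also have "\<dots> = (\<Sum>k\<in>{..<n0} \<union> {n0..<n}. \<bar>f k - L\<bar>)"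
      by (rule sum.cong) (use n in auto)
    also have "\<dots> = C + (\<Sum>k\<in>{n0..<n}. \<bar>f k - L\<bar>)"
      unfolding C_def by (intro sum.union_disjoint) auto
    also have "\<dots> \<le> C + (\<Sum>k\<in>{n0..<n}. e / 2)"
      by (intro add_left_mono sum_mono less_imp_le[OF n0]) auto
    also have "\<dots> \<le> C + real n * (e / 2)"
      using \<open>0 < e\<close> by (auto intro!: mult_right_mono)
    also have "\<dots> < real n * e"
    proof -
      have "2 * C < real n1 * e" using n1 \<open>0 < e\<close> by (simp add: divide_less_eq)
      also have "\<dots> \<le> real n * e" using n \<open>0 < e\<close> by (intro mult_right_mono) auto
      finally show ?thesis by (simp add: field_simps)
    qed
    finally have "\<bar>(\<Sum>k<n. f k) - real n * L\<bar> / real n < e"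
      using np by (simp add: divide_less_eq mult.commute)
    moreover have "\<bar>(\<Sum>k<n. f k) / real n - L\<bar> = \<bar>(\<Sum>k<n. f k) - real n * L\<bar> / real n"
    proof -
      have "(\<Sum>k<n. f k) / real n - L = ((\<Sum>k<n. f k) - real n * L) / real n"
        using np by (simp add: diff_divide_distrib)
      then show ?thesis using np by (simp add: abs_divide)
    qed
    ultimately show ?thesis by simp
  qed
  then show "\<exists>no. \<forall>n\<ge>no. norm ((\<Sum>k<n. f k) / real n - L) < e" by auto
qed

lemma ceiling_power_bounds:
  fixes \<alpha> :: real
  assumes "1 < \<alpha>"
  shows "\<alpha> ^ n \<le> real (nat \<lceil>\<alpha> ^ n\<rceil>)" "real (nat \<lceil>\<alpha> ^ n\<rceil>) \<le> \<alpha> ^ n + 1" "real (nat \<lceil>\<alpha> ^ n\<rceil>) \<le> 2 * \<alpha> ^ n"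
proof -
  have "1 \<le> \<alpha> ^ n" using assms by simp
  then show "\<alpha> ^ n \<le> real (nat \<lceil>\<alpha> ^ n\<rceil>)" "real (nat \<lceil>\<alpha> ^ n\<rceil>) \<le> \<alpha> ^ n + 1" "real (nat \<lceil>\<alpha> ^ n\<rceil>) \<le> 2 * \<alpha> ^ n"
    by linarith+
qed

lemma ceiling_power_ratio:
  fixes \<alpha> :: real
  assumes "1 < \<alpha>"
  shows "(\<lambda>n. real (nat \<lceil>\<alpha> ^ Suc n\<rceil>) / real (nat \<lceil>\<alpha> ^ n\<rceil>)) \<longlonglongrightarrow> \<alpha>"
proof -
  have inv0: "(\<lambda>n. 1 / \<alpha> ^ n) \<longlonglongrightarrow> 0"
    using assms LIMSEQ_inverse_realpow_zero[OF assms] by (simp add: field_simps)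
  have one: "(\<lambda>n. real (nat \<lceil>\<alpha> ^ n\<rceil>) / \<alpha> ^ n) \<longlonglongrightarrow> 1"
  proof (rule real_tendsto_sandwich[of "\<lambda>_. 1" _ _ "\<lambda>n. 1 + 1 / \<alpha> ^ n"])
    show "(\<lambda>n. 1 + 1 / \<alpha> ^ n) \<longlonglongrightarrow> 1" using tendsto_add[OF tendsto_const inv0, of 1] by simp
    show "\<forall>\<^sub>F n in sequentially. 1 \<le> real (nat \<lceil>\<alpha> ^ n\<rceil>) / \<alpha> ^ n"
      using assms ceiling_power_bounds(1)[OF assms] by (auto simp: le_divide_eq)
    show "\<forall>\<^sub>F n in sequentially. real (nat \<lceil>\<alpha> ^ n\<rceil>) / \<alpha> ^ n \<le> 1 + 1 / \<alpha> ^ n"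
    proof (rule always_eventually, rule allI)
      fix n
      have "0 < \<alpha> ^ n" using assms by simp
      then show "real (nat \<lceil>\<alpha> ^ n\<rceil>) / \<alpha> ^ n \<le> 1 + 1 / \<alpha> ^ n"
        using ceiling_power_bounds(2)[OF assms, of n] by (simp add: field_simps)
    qed
  qed simp
  have "(\<lambda>n. \<alpha> * (real (nat \<lceil>\<alpha> ^ Suc n\<rceil>) / \<alpha> ^ Suc n) / (real (nat \<lceil>\<alpha> ^ n\<rceil>) / \<alpha> ^ n)) \<longlonglongrightarrow> \<alpha> * 1 / 1"
    by (intro tendsto_intros LIMSEQ_Suc[OF one] one) auto
  then show ?thesis using assms by (simp add: field_simps)
qed

text \<open>Partial sums of nonnegative terms are monotone, so their averages are controlled along the
  geometric subsequence up to the factor \<open>\<alpha>\<close>, which is arbitrarily close to 1.\<close>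

lemma average_tendsto_of_geometric_subsequences:
  fixes x :: "nat \<Rightarrow> real"
  assumes x: "\<And>k. 0 \<le> x k"
    and sub: "\<And>j. (\<lambda>n. (\<Sum>k<nat \<lceil>(1 + 1 / real (Suc j)) ^ n\<rceil>. x k) / real (nat \<lceil>(1 + 1 / real (Suc j)) ^ n\<rceil>)) \<longlonglongrightarrow> L"
  shows "(\<lambda>n. (\<Sum>k<n. x k) / real n) \<longlonglongrightarrow> L"
proof (rule LIMSEQ_I)
  fix e :: real assume "0 < e"
  define T where "T n = (\<Sum>k<n. x k)" for n
  have T_mono: "T n \<le> T m" if "n \<le> m" for n m
    unfolding T_def using that x by (intro sum_mono2) auto
  have T_nonneg: "0 \<le> T n" for n unfolding T_def using x by (simp add: sum_nonneg)
  have a: "(\<lambda>j. L * (1 + 1 / real (Suc j))) \<longlonglongrightarrow> L * (1 + 0)" "(\<lambda>j. L / (1 + 1 / real (Suc j))) \<longlonglongrightarrow> L / (1 + 0)"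
    by (intro tendsto_intros LIMSEQ_Suc[OF lim_1_over_n]; simp)+
  have "\<forall>\<^sub>F j in sequentially. L * (1 + 1 / real (Suc j)) < L + e \<and> L - e < L / (1 + 1 / real (Suc j))"
    using order_tendstoD(2)[OF a(1), of "L + e"] order_tendstoD(1)[OF a(2), of "L - e"] \<open>0 < e\<close>
    by (auto intro: eventually_conj)
  \<comment> \<open>This index makes the ratio so close to 1 that both limits,
    \<open>L * \<alpha>\<close> and \<open>L / \<alpha>\<close>, are on the right side of
    \<open>L + e\<close> and \<open>L - e\<close>.\<close>
  then obtain j where j: "L * (1 + 1 / real (Suc j)) < L + e" "L - e < L / (1 + 1 / real (Suc j))"
    by (auto simp: eventually_sequentially)
  define \<alpha> where "\<alpha> = 1 + 1 / real (Suc j)"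
  have \<alpha>: "1 < \<alpha>" by (simp add: \<alpha>_def)
  define K where "K n = nat \<lceil>\<alpha> ^ n\<rceil>" for n
  have K_ge: "\<alpha> ^ n \<le> real (K n)" for n unfolding K_def by (rule ceiling_power_bounds[OF \<alpha>])
  have K_pos: "0 < K n" for n using K_ge[of n] \<alpha> by (metis not_gr_zero of_nat_0 not_le zero_less_power less_trans zero_less_one)
  have K_mono: "K n \<le> K m" if "n \<le> m" for n m
    unfolding K_def using that \<alpha> by (intro nat_mono ceiling_mono power_increasing) auto
  have TK: "(\<lambda>n. T (K n) / real (K n)) \<longlonglongrightarrow> L"
    using sub[of j] by (simp add: T_def K_def \<alpha>_def)
  have ratio: "(\<lambda>n. real (K (Suc n)) / real (K n)) \<longlonglongrightarrow> \<alpha>"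
    unfolding K_def by (rule ceiling_power_ratio[OF \<alpha>])
  have "(\<lambda>n. T (K (Suc n)) / real (K (Suc n)) * (real (K (Suc n)) / real (K n))) \<longlonglongrightarrow> L * \<alpha>"
    by (intro tendsto_intros LIMSEQ_Suc[OF TK] ratio)
  then have up: "(\<lambda>n. T (K (Suc n)) / real (K n)) \<longlonglongrightarrow> L * \<alpha>"
    using K_pos by (simp add: less_imp_neq)
  have "(\<lambda>n. T (K n) / real (K n) / (real (K (Suc n)) / real (K n))) \<longlonglongrightarrow> L / \<alpha>"
    using \<alpha> by (intro tendsto_intros TK ratio) auto
  then have low: "(\<lambda>n. T (K n) / real (K (Suc n))) \<longlonglongrightarrow> L / \<alpha>"
    using K_pos by (simp add: less_imp_neq)
  have "\<forall>\<^sub>F n in sequentially. T (K (Suc n)) / real (K n) < L + e \<and> L - e < T (K n) / real (K (Suc n))"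
    using order_tendstoD(2)[OF up, of "L + e"] order_tendstoD(1)[OF low, of "L - e"] j
    by (auto simp: \<alpha>_def intro: eventually_conj)
  then obtain n0 where n0: "\<And>n. n \<ge> n0 \<Longrightarrow> T (K (Suc n)) / real (K n) < L + e \<and> L - e < T (K n) / real (K (Suc n))"
    by (auto simp: eventually_sequentially)
  have "\<bar>T m / real m - L\<bar> < e" if m: "m \<ge> K n0" for m
  proof -
    obtain q where q: "real m < \<alpha> ^ q" using real_arch_pow[OF \<alpha>] by blast
    have ex: "\<exists>n. m < K n" using q K_ge[of q] by (intro exI[of _ q]) linarith
    \<comment> \<open>The first index whose size exceeds \<open>m\<close>; its predecessor
      \<open>i\<close> satisfies \<open>K i \<le> m < K (Suc i)\<close>, which brackets the average
      at \<open>m\<close>.\<close>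
    define n where "n = (LEAST n. m < K n)"
    have n: "m < K n" "\<And>i. m < K i \<Longrightarrow> n \<le> i"
      unfolding n_def using LeastI_ex[OF ex] by (auto intro: Least_le)
    have "n0 < n" using n(1) m K_mono[of n n0] by (meson not_le order_trans leD)
    then obtain i where i: "n = Suc i" "i \<ge> n0" by (cases n) auto
    have Ki: "K i \<le> m" using n(2)[of i] i by (auto simp: not_less[symmetric])
    have mp: "0 < real m" using Ki K_pos[of i] by simp
    have "T m / real m \<le> T (K (Suc i)) / real (K i)"
      using Ki n(1) i K_pos[of i] T_nonneg by (intro frac_le T_mono) auto
    moreover have "T (K i) / real (K (Suc i)) \<le> T m / real m"
      using Ki n(1) i mp T_nonneg by (intro frac_le T_mono) auto
    ultimately show ?thesis using n0[OF i(2)] by linarith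
  qed
  then show "\<exists>no. \<forall>n\<ge>no. norm ((\<Sum>k<n. x k) / real n - L) < e" by (auto simp: T_def)
qed


text \<open>At most \<open>x\<close> positive integers lie below \<open>x\<close>. Applied to
  \<open>X 0\<close> and integrated, this bounds the expected number of truncated terms by the mean.
  The induction carries \<open>min (real m) x\<close>, since \<open>x\<close> alone cannot absorb a
  new term.\<close>

lemma sum_of_bool_truncation_le:
  fixes x :: real
  assumes "0 \<le> x"
  shows "(\<Sum>k<m. of_bool (real k + 1 < x)) \<le> x"
proof -
  have "(\<Sum>k<m. of_bool (real k + 1 < x)) \<le> min (real m) x"
    using assms by (induction m) (auto simp: min_def of_bool_def split: if_splits)
  then show ?thesis by simp
qed

text \<open>Etemadi's argument: nonnegativity reduces the claim to geometric subsequences, and along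
  these the normalized variances of the truncated sums are summable.\<close>

lemma (in prob_space) strong_law_nonneg:
  fixes X :: "nat \<Rightarrow> 'a \<Rightarrow> real"
  assumes indep: "indep_vars (\<lambda>_. borel) X UNIV"
    and distr: "\<And>n. distr M borel (X n) = distr M borel (X 0)"
    and int: "integrable M (X 0)"
    and nonneg: "\<And>n w. 0 \<le> X n w"
  shows "AE w in M. (\<lambda>n. (\<Sum>k<n. X k w) / real n) \<longlonglongrightarrow> expectation (X 0)"
proof -
  have X[measurable]: "X k \<in> borel_measurable M" for k
    using indep by (auto simp: indep_vars_def)
  have transfer: "expectation (\<lambda>w. f (X k w)) = expectation (\<lambda>w. f (X 0 w))"
    if [measurable]: "f \<in> borel_measurable borel" for f :: "real \<Rightarrow> real" and k
    using integral_distr[of "X k" M borel f] integral_distr[of "X 0" M borel f] distr[of k] by simp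
  have transfer_nn: "(\<integral>\<^sup>+ w. f (X k w) \<partial>M) = (\<integral>\<^sup>+ w. f (X 0 w) \<partial>M)"
    if [measurable]: "f \<in> borel_measurable borel" for f :: "real \<Rightarrow> ennreal" and k
    using nn_integral_distr[of "X k" M borel f] nn_integral_distr[of "X 0" M borel f] distr[of k] by simp
  \<comment> \<open>The level grows with the index, so that almost surely only finitely many terms
    are cut, while the first \<open>K n\<close> terms are all at most \<open>K n\<close>.\<close>
  define Y where "Y k w = min (X k w) (real k + 1)" for k w
  have [measurable]: "Y k \<in> borel_measurable M" for k
    by (simp add: Y_def[abs_def])
  have Y_bound: "0 \<le> Y k w" "Y k w \<le> real k + 1" for k w
    using nonneg[of k w] by (auto simp: Y_def)
  have iY: "integrable M (Y k)" for k
    by (rule integrable_const_bound[of _ "real k + 1"]) (use Y_bound in auto)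
  have indepY: "indep_vars (\<lambda>_. borel) Y UNIV"
    unfolding Y_def by (rule indep_vars_compose2[OF indep]) auto
  define L where "L = expectation (X 0)"
  have EY: "(\<lambda>k. expectation (Y k)) \<longlonglongrightarrow> L"
  proof -
    have "(\<lambda>k. expectation (\<lambda>w. min (X 0 w) (real k + 1))) \<longlonglongrightarrow> expectation (X 0)"
    proof (rule integral_dominated_convergence[where w = "X 0"])
      show "AE w in M. (\<lambda>k. min (X 0 w) (real k + 1)) \<longlonglongrightarrow> X 0 w"
      proof (rule AE_I2)
        fix w
        obtain n where "X 0 w < real n" using reals_Archimedean2 by blast
        then have "\<forall>\<^sub>F k in sequentially. min (X 0 w) (real k + 1) = X 0 w"
          by (intro eventually_sequentiallyI[of n]) (auto simp: min_def)
        then show "(\<lambda>k. min (X 0 w) (real k + 1)) \<longlonglongrightarrow> X 0 w"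
          by (rule tendsto_eventually)
      qed
      show "AE w in M. norm (min (X 0 w) (real k + 1)) \<le> X 0 w" for k
        using nonneg by (auto intro!: AE_I2)
    qed (auto simp: int)
    moreover have "expectation (Y k) = expectation (\<lambda>w. min (X 0 w) (real k + 1))" for k
      unfolding Y_def by (rule transfer) auto
    ultimately show ?thesis by (simp add: L_def)
  qed
  define S where "S n w = (\<Sum>k<n. Y k w)" for n w
  have [measurable]: "S n \<in> borel_measurable M" for n
    by (simp add: S_def[abs_def])
  have ES: "(\<lambda>n. expectation (S n) / real n) \<longlonglongrightarrow> L"
    using cesaro_tendsto[OF EY] iY by (simp add: S_def[abs_def])
  have intX: "(\<integral>\<^sup>+ w. ennreal (c * X 0 w) \<partial>M) < \<infinity>" if "0 \<le> c" for c
  proof -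
    have "(\<integral>\<^sup>+ w. ennreal (c * X 0 w) \<partial>M) = ennreal (expectation (\<lambda>w. c * X 0 w))"
      using int nonneg that by (intro nn_integral_eq_integral) auto
    then show ?thesis by simp
  qed
  have trunc: "AE w in M. (\<lambda>k. of_bool (real k + 1 < X k w) :: real) \<longlonglongrightarrow> 0"
  proof (rule AE_tendsto_0_of_suminf)
    have "(\<Sum>k. \<integral>\<^sup>+ w. ennreal (of_bool (real k + 1 < X k w)) \<partial>M)
      = (\<Sum>k. \<integral>\<^sup>+ w. ennreal (of_bool (real k + 1 < X 0 w)) \<partial>M)"
      by (intro suminf_cong transfer_nn) measurable
    also have "\<dots> = (\<integral>\<^sup>+ w. (\<Sum>k. ennreal (of_bool (real k + 1 < X 0 w))) \<partial>M)"
      by (intro nn_integral_suminf[symmetric]) measurable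
    also have "\<dots> \<le> (\<integral>\<^sup>+ w. ennreal (1 * X 0 w) \<partial>M)"
    proof (intro nn_integral_mono suminf_le_const)
      fix w n
      show "(\<Sum>k<n. ennreal (of_bool (real k + 1 < X 0 w))) \<le> ennreal (1 * X 0 w)"
        using sum_of_bool_truncation_le[OF nonneg[of 0 w], of n]
        by (subst sum_ennreal) (auto intro: ennreal_leI)
    qed auto
    also have "\<dots> < \<infinity>" by (rule intX) simp
    finally show "(\<Sum>k. \<integral>\<^sup>+ w. ennreal (of_bool (real k + 1 < X k w)) \<partial>M) < \<infinity>" .
  qed auto
  have geometric: "AE w in M. (\<lambda>n. (S (nat \<lceil>\<alpha> ^ n\<rceil>) w - expectation (S (nat \<lceil>\<alpha> ^ n\<rceil>))) / real (nat \<lceil>\<alpha> ^ n\<rceil>)) \<longlonglongrightarrow> 0"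
    if \<alpha>: "1 < \<alpha>" for \<alpha> :: real
  proof -
    define K where "K n = nat \<lceil>\<alpha> ^ n\<rceil>" for n
    have K: "\<alpha> ^ n \<le> real (K n)" "real (K n) \<le> 2 * \<alpha> ^ n" for n
      unfolding K_def by (rule ceiling_power_bounds[OF \<alpha>])+
    have K_pos: "0 < real (K n)" for n
      using K(1)[of n] \<alpha> less_le_trans[of 0 "\<alpha> ^ n" "real (K n)"] by auto
    have "AE w in M. (\<lambda>n. ((S (K n) w - expectation (S (K n))) / real (K n))\<^sup>2) \<longlonglongrightarrow> 0"
    proof (rule AE_tendsto_0_of_suminf)
      have var: "(\<integral>\<^sup>+ w. ennreal (((S (K n) w - expectation (S (K n))) / real (K n))\<^sup>2) \<partial>M)
        \<le> (\<integral>\<^sup>+ w. ennreal ((min (X 0 w) (real (K n)))\<^sup>2 / real (K n)) \<partial>M)" for n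
      proof -
        have Sb: "0 \<le> S (K n) w" "S (K n) w \<le> real (K n) * real (K n)" for w
        proof -
          show "0 \<le> S (K n) w" unfolding S_def using Y_bound by (simp add: sum_nonneg)
          have "S (K n) w \<le> (\<Sum>k<K n. real (K n))"
            unfolding S_def by (intro sum_mono order_trans[OF Y_bound(2)]) auto
          then show "S (K n) w \<le> real (K n) * real (K n)" by simp
        qed
        have i1: "integrable M (\<lambda>w. ((S (K n) w - expectation (S (K n))) / real (K n))\<^sup>2)"
        proof (rule integrable_const_bound[of _ "((real (K n) * real (K n) + \<bar>expectation (S (K n))\<bar>) / real (K n))\<^sup>2"])
          show "AE w in M. norm (((S (K n) w - expectation (S (K n))) / real (K n))\<^sup>2)
            \<le> ((real (K n) * real (K n) + \<bar>expectation (S (K n))\<bar>) / real (K n))\<^sup>2"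
          proof (rule AE_I2)
            fix w
            have "\<bar>S (K n) w - expectation (S (K n))\<bar> \<le> real (K n) * real (K n) + \<bar>expectation (S (K n))\<bar>"
              using Sb[of w] by linarith
            then have "\<bar>(S (K n) w - expectation (S (K n))) / real (K n)\<bar> \<le> \<bar>(real (K n) * real (K n) + \<bar>expectation (S (K n))\<bar>) / real (K n)\<bar>"
              using K_pos[of n] by (simp add: abs_divide divide_right_mono)
            then show "norm (((S (K n) w - expectation (S (K n))) / real (K n))\<^sup>2)
              \<le> ((real (K n) * real (K n) + \<bar>expectation (S (K n))\<bar>) / real (K n))\<^sup>2"
              by (simp only: real_norm_def abs_power2 abs_le_square_iff)
          qed
        qed measurable
        have i2: "integrable M (\<lambda>w. (min (X 0 w) (real (K n)))\<^sup>2)"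
          by (rule integrable_const_bound[of _ "(real (K n))\<^sup>2"])
            (use nonneg in \<open>auto intro!: AE_I2 power_mono\<close>)
        have "expectation (\<lambda>w. ((S (K n) w - expectation (S (K n))) / real (K n))\<^sup>2)
          = variance (S (K n)) / (real (K n))\<^sup>2"
          by (simp add: power_divide)
        \<comment> \<open>Each level \<open>k + 1\<close> with \<open>k < K n\<close> is raised to
          the common level \<open>K n\<close>; after division by the square of \<open>K n\<close>
          this is the summand of \<open>suminf_truncated_square_le\<close>.\<close>
        also have "\<dots> \<le> (real (K n) * expectation (\<lambda>w. (min (X 0 w) (real (K n)))\<^sup>2)) / (real (K n))\<^sup>2"
        proof (rule divide_right_mono)
          have "variance (S (K n)) \<le> (\<Sum>k<K n. expectation (\<lambda>w. (Y k w)\<^sup>2))"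
            unfolding S_def[abs_def] by (rule variance_sum_indep_vars[OF indepY, of "\<lambda>k. real k + 1"]) (use Y_bound in auto)
          also have "\<dots> = (\<Sum>k<K n. expectation (\<lambda>w. (min (X 0 w) (real k + 1))\<^sup>2))"
            unfolding Y_def by (intro sum.cong transfer) auto
          also have "\<dots> \<le> (\<Sum>k<K n. expectation (\<lambda>w. (min (X 0 w) (real (K n)))\<^sup>2))"
          proof (intro sum_mono integral_mono_AE)
            fix k assume k: "k \<in> {..<K n}"
            show "integrable M (\<lambda>w. (min (X 0 w) (real k + 1))\<^sup>2)"
              by (rule integrable_const_bound[of _ "(real k + 1)\<^sup>2"])
                (use nonneg in \<open>auto intro!: AE_I2 power_mono\<close>)
            show "AE w in M. (min (X 0 w) (real k + 1))\<^sup>2 \<le> (min (X 0 w) (real (K n)))\<^sup>2"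
              using k nonneg by (intro AE_I2 power_mono min.mono) auto
          qed (rule i2)
          finally show "variance (S (K n)) \<le> real (K n) * expectation (\<lambda>w. (min (X 0 w) (real (K n)))\<^sup>2)"
            by simp
        qed simp
        also have "\<dots> = expectation (\<lambda>w. (min (X 0 w) (real (K n)))\<^sup>2 / real (K n))"
          using K_pos[of n] by (simp add: power2_eq_square)
        finally have "ennreal (expectation (\<lambda>w. ((S (K n) w - expectation (S (K n))) / real (K n))\<^sup>2))
          \<le> ennreal (expectation (\<lambda>w. (min (X 0 w) (real (K n)))\<^sup>2 / real (K n)))"
          by (rule ennreal_leI)
        then show ?thesis
          using i1 i2 by (subst (1 2) nn_integral_eq_integral) (auto intro!: AE_I2)
      qed
      have "(\<Sum>n. \<integral>\<^sup>+ w. ennreal (((S (K n) w - expectation (S (K n))) / real (K n))\<^sup>2) \<partial>M)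
        \<le> (\<Sum>n. \<integral>\<^sup>+ w. ennreal ((min (X 0 w) (real (K n)))\<^sup>2 / real (K n)) \<partial>M)"
        by (intro suminf_le var) auto
      also have "\<dots> = (\<integral>\<^sup>+ w. (\<Sum>n. ennreal ((min (X 0 w) (real (K n)))\<^sup>2 / real (K n))) \<partial>M)"
        by (intro nn_integral_suminf[symmetric]) measurable
      also have "\<dots> \<le> (\<integral>\<^sup>+ w. ennreal (3 * \<alpha> / (\<alpha> - 1) * X 0 w) \<partial>M)"
        by (intro nn_integral_mono suminf_truncated_square_le \<alpha> nonneg K)
      also have "\<dots> < \<infinity>" using \<alpha> by (intro intX) auto
      finally show "(\<Sum>n. \<integral>\<^sup>+ w. ennreal (((S (K n) w - expectation (S (K n))) / real (K n))\<^sup>2) \<partial>M) < \<infinity>" .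
    qed auto
    then show ?thesis by (simp add: K_def)
  qed
  \<comment> \<open>Countably many ratios tending to 1 keep the exceptional set null.\<close>
  have "AE w in M. \<forall>j. (\<lambda>n. (S (nat \<lceil>(1 + 1 / real (Suc j)) ^ n\<rceil>) w - expectation (S (nat \<lceil>(1 + 1 / real (Suc j)) ^ n\<rceil>)))
      / real (nat \<lceil>(1 + 1 / real (Suc j)) ^ n\<rceil>)) \<longlonglongrightarrow> 0"
    unfolding AE_all_countable by (intro allI geometric) simp
  with trunc show ?thesis
  proof eventually_elim
    case (elim w)
    have "\<forall>\<^sub>F k in sequentially. (of_bool (real k + 1 < X k w) :: real) < 1"
      using order_tendstoD(2)[OF elim(1), of 1] by simp
    then obtain k0 where k0: "\<And>k. k \<ge> k0 \<Longrightarrow> Y k w = X k w"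
      by (auto simp: eventually_sequentially Y_def min_def of_bool_def split: if_splits) (metis not_le)
    \<comment> \<open>From \<open>k0\<close> on no term is truncated, so the two partial sums differ
      by a constant, which averages out.\<close>
    define D where "D = (\<Sum>k<k0. X k w - Y k w)"
    have D: "(\<Sum>k<n. X k w) - S n w = D" if "n \<ge> k0" for n
    proof -
      have "(\<Sum>k<n. X k w) - S n w = (\<Sum>k<n. X k w - Y k w)"
        by (simp add: S_def sum_subtractf)
      also have "\<dots> = D"
        unfolding D_def using that k0 by (intro sum.mono_neutral_right) auto
      finally show ?thesis .
    qed
    have Dn: "(\<lambda>n. ((\<Sum>k<n. X k w) - S n w) / real n) \<longlonglongrightarrow> 0"
    proof (rule Lim_transform_eventually)
      show "(\<lambda>n. D / real n) \<longlonglongrightarrow> 0" by (rule lim_const_over_n)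
      show "\<forall>\<^sub>F n in sequentially. D / real n = ((\<Sum>k<n. X k w) - S n w) / real n"
        by (rule eventually_sequentiallyI[of k0]) (simp add: D)
    qed
    show ?case unfolding L_def[symmetric]
    proof (rule average_tendsto_of_geometric_subsequences)
      show "0 \<le> X k w" for k by (rule nonneg)
      fix j
      define \<alpha> where "\<alpha> = 1 + 1 / real (Suc j)"
      have \<alpha>: "1 < \<alpha>" by (simp add: \<alpha>_def)
      define K where "K n = nat \<lceil>\<alpha> ^ n\<rceil>" for n
      have "filterlim (\<lambda>n. real (K n)) at_top sequentially"
      proof (rule filterlim_at_top_mono)
        show "filterlim (\<lambda>n. \<alpha> ^ n) at_top sequentially"
          using \<alpha> by real_asymp
      qed (use ceiling_power_bounds(1)[OF \<alpha>] in \<open>auto simp: K_def\<close>)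
      then have K: "filterlim K at_top sequentially"
        by (simp add: filterlim_sequentially_iff_filterlim_real)
      have "(\<lambda>n. (S (K n) w - expectation (S (K n))) / real (K n) + expectation (S (K n)) / real (K n)
          + ((\<Sum>k<K n. X k w) - S (K n) w) / real (K n)) \<longlonglongrightarrow> 0 + L + 0"
        using elim(2)[rule_format, of j]
        by (intro tendsto_add filterlim_compose[OF ES K] filterlim_compose[OF Dn K])
          (simp add: K_def \<alpha>_def)
      then have "(\<lambda>n. (\<Sum>k<K n. X k w) / real (K n)) \<longlonglongrightarrow> L"
        by (simp add: add_divide_distrib[symmetric])
      then show "(\<lambda>n. (\<Sum>k<nat \<lceil>(1 + 1 / real (Suc j)) ^ n\<rceil>. X k w) / real (nat \<lceil>(1 + 1 / real (Suc j)) ^ n\<rceil>)) \<longlonglongrightarrow> L"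
        by (simp add: K_def \<alpha>_def)
    qed
  qed
qed

theorem (in prob_space) strong_law_of_large_numbers:
  fixes X :: "nat \<Rightarrow> 'a \<Rightarrow> real"
  assumes indep: "indep_vars (\<lambda>_. borel) X UNIV"
    and distr: "\<And>n. distr M borel (X n) = distr M borel (X 0)"
    and int: "integrable M (X 0)"
  shows "AE w in M. (\<lambda>n. (\<Sum>k<n. X k w) / real n) \<longlonglongrightarrow> expectation (X 0)"
proof -
  have X[measurable]: "X k \<in> borel_measurable M" for k
    using indep by (auto simp: indep_vars_def)
  have part: "AE w in M. (\<lambda>n. (\<Sum>k<n. f (X k w)) / real n) \<longlonglongrightarrow> expectation (\<lambda>w. f (X 0 w))"
    if [measurable]: "f \<in> borel_measurable borel" and f: "\<And>x. 0 \<le> f x" "\<And>x. f x \<le> \<bar>x\<bar>" for f :: "real \<Rightarrow> real"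
  proof (rule strong_law_nonneg)
    show "indep_vars (\<lambda>_. borel) (\<lambda>k w. f (X k w)) UNIV"
      by (rule indep_vars_compose2[OF indep]) auto
    show "distr M borel (\<lambda>w. f (X n w)) = distr M borel (\<lambda>w. f (X 0 w))" for n
      using distr_distr[of f borel borel "X n" M] distr_distr[of f borel borel "X 0" M] distr[of n]
      by (simp add: comp_def)
    show "integrable M (\<lambda>w. f (X 0 w))"
      by (rule Bochner_Integration.integrable_bound[OF int]) (use f in auto)
  qed (use f in auto)
  have "AE w in M. (\<lambda>n. (\<Sum>k<n. max 0 (X k w)) / real n) \<longlonglongrightarrow> expectation (\<lambda>w. max 0 (X 0 w))"
    "AE w in M. (\<lambda>n. (\<Sum>k<n. max 0 (- X k w)) / real n) \<longlonglongrightarrow> expectation (\<lambda>w. max 0 (- X 0 w))"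
    using part[of "\<lambda>x. max 0 x"] part[of "\<lambda>x. max 0 (- x)"] by auto
  then show ?thesis
  proof eventually_elim
    case (elim w)
    have "(\<lambda>n. (\<Sum>k<n. max 0 (X k w)) / real n - (\<Sum>k<n. max 0 (- X k w)) / real n)
        \<longlonglongrightarrow> expectation (\<lambda>w. max 0 (X 0 w)) - expectation (\<lambda>w. max 0 (- X 0 w))"
      by (rule tendsto_diff[OF elim])
    moreover have "max 0 x - max 0 (- x) = x" for x :: real by (simp add: max_def)
    moreover have "expectation (\<lambda>w. max 0 (X 0 w)) - expectation (\<lambda>w. max 0 (- X 0 w))
        = expectation (\<lambda>w. max 0 (X 0 w) - max 0 (- X 0 w))"
      using int by (intro Bochner_Integration.integral_diff[symmetric] integrable_max) auto
    ultimately show ?case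
      by (simp add: diff_divide_distrib[symmetric] sum_subtractf[symmetric])
  qed
qed

section \<open>The dual objective\<close>

text \<open>The support function of \<open>A\<close> in the direction \<open>(y, - l)\<close>; the
  cut at 0 made by \<open>ennreal\<close> loses nothing when \<open>A\<close> contains the origin.
  For \<open>perturbations \<phi>\<close> and nonnegative \<open>l\<close> it is the conjugate of
  \<open>l\<close> times \<open>\<phi>\<close> at \<open>y\<close>, minus \<open>y\<close>.\<close>

definition excess :: "(real \<times> real) set \<Rightarrow> real \<Rightarrow> real \<Rightarrow> ennreal" where
  "excess A l y = (SUP a\<in>A. ennreal (fst a * y - l * snd a))"

text \<open>The location has left the affine part, because \<open>\<mu> + E (X - \<mu>)\<close> is
  the mean of the payoff.\<close>

definition dual_objective ::
  "'a measure \<Rightarrow> ('a \<Rightarrow> real) \<Rightarrow> (real \<times> real) set \<Rightarrow> real \<Rightarrow> real \<times> real \<Rightarrow> ereal" where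
  "dual_objective M X A \<epsilon> z = ereal ((\<integral>w. X w \<partial>M) + snd z * \<epsilon>)
     + enn2ereal (\<integral>\<^sup>+ w. excess A (snd z) (X w - fst z) \<partial>M)"

definition dual_minimizers ::
  "'a measure \<Rightarrow> ('a \<Rightarrow> real) \<Rightarrow> (real \<times> real) set \<Rightarrow> real \<Rightarrow> (real \<times> real) set" where
  "dual_minimizers M X A \<epsilon> = {z. is_arg_min (dual_objective M X A \<epsilon>) (\<lambda>z. z \<in> multipliers) z}"

lemma dual_minimizers_iff:
  "z \<in> dual_minimizers M X A \<epsilon> \<longleftrightarrow>
     z \<in> multipliers \<and> (\<forall>z'\<in>multipliers. dual_objective M X A \<epsilon> z \<le> dual_objective M X A \<epsilon> z')"
  by (auto simp: dual_minimizers_def is_arg_min_def not_less)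

lemma multipliers_iff: "z \<in> multipliers \<longleftrightarrow> 0 \<le> snd z"
  by (cases z) (auto simp: multipliers_def)

lemma closed_multipliers: "closed multipliers"
proof -
  have "multipliers = {z. 0 \<le> snd z}" by (auto simp: multipliers_iff)
  moreover have "closed {z :: real \<times> real. 0 \<le> snd z}"
    by (intro closed_Collect_le continuous_intros)
  ultimately show ?thesis by simp
qed

lemma excess_upper: "a \<in> A \<Longrightarrow> ennreal (fst a * y - l * snd a) \<le> excess A l y"
  unfolding excess_def by (rule SUP_upper)

lemma excess_least:
  "(\<And>a. a \<in> A \<Longrightarrow> ennreal (fst a * y - l * snd a) \<le> B) \<Longrightarrow> excess A l y \<le> B"
  unfolding excess_def by (rule SUP_least)

lemma excess_mono_set: "A \<subseteq> B \<Longrightarrow> excess A l y \<le> excess B l y"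
  unfolding excess_def by (rule SUP_subset_mono) auto

lemma ennreal_add_le: "ennreal (a + b) \<le> ennreal a + ennreal b"
  by (cases "0 \<le> a"; cases "0 \<le> b")
    (auto simp: ennreal_plus[symmetric] ennreal_neg simp del: ennreal_plus intro!: ennreal_leI)

text \<open>Every point of \<open>A\<close> contributes the positive part of a function that is
  linear in \<open>(l, y)\<close>, so the excess is sublinear in the pair. Arguments can thus be
  split if the multiplier is split along.\<close>

lemma excess_subadditive: "excess A (l1 + l2) (y1 + y2) \<le> excess A l1 y1 + excess A l2 y2"
proof (rule excess_least)
  fix a assume a: "a \<in> A"
  have "ennreal (fst a * (y1 + y2) - (l1 + l2) * snd a)
      = ennreal ((fst a * y1 - l1 * snd a) + (fst a * y2 - l2 * snd a))"
    by (simp add: algebra_simps)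
  also have "\<dots> \<le> ennreal (fst a * y1 - l1 * snd a) + ennreal (fst a * y2 - l2 * snd a)"
    by (rule ennreal_add_le)
  also have "\<dots> \<le> excess A l1 y1 + excess A l2 y2"
    by (intro add_mono excess_upper a)
  finally show "ennreal (fst a * (y1 + y2) - (l1 + l2) * snd a) \<le> excess A l1 y1 + excess A l2 y2" .
qed

lemma excess_scale:
  assumes "0 \<le> c"
  shows "excess A (c * l) (c * y) = ennreal c * excess A l y"
proof -
  have "excess A (c * l) (c * y) = (SUP a\<in>A. ennreal c * ennreal (fst a * y - l * snd a))"
    unfolding excess_def using assms
    by (intro SUP_cong) (auto simp: ennreal_mult'[symmetric] algebra_simps)
  then show ?thesis by (simp add: excess_def SUP_mult_left_ennreal)
qed

text \<open>Besides the shifted epigraph of the divergence, this covers flat parts and mirror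
  images, to which the same lemmas are applied.\<close>

locale perturbation_set =
  fixes A :: "(real \<times> real) set"
  assumes convex: "convex A" and closed: "closed A" and zero: "(0, 0) \<in> A"
    and nonneg: "a \<in> A \<Longrightarrow> 0 \<le> snd a"
begin

lemma excess_antimono:
  assumes "l \<le> l'"
  shows "excess A l' y \<le> excess A l y"
proof (rule excess_least)
  fix a assume a: "a \<in> A"
  then have "fst a * y - l' * snd a \<le> fst a * y - l * snd a"
    using assms nonneg by (simp add: mult_right_mono)
  then show "ennreal (fst a * y - l' * snd a) \<le> excess A l y"
    using a by (blast intro: order_trans[OF ennreal_leI excess_upper])
qed

section \<open>Finite truncations of the excess\<close>

definition enum :: "nat \<Rightarrow> real \<times> real" where
  "enum = (SOME e. range e \<subseteq> A \<and> e 0 = (0, 0) \<and> A \<subseteq> closure (range e))"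

lemma enum: "range enum \<subseteq> A" "enum 0 = (0, 0)" "A \<subseteq> closure (range enum)"
proof -
  obtain T where T: "countable T" "T \<subseteq> A" "A \<subseteq> closure T" by (rule separable)
  have "T \<noteq> {}" using T zero by auto
  define e where "e = case_nat (0, 0) (from_nat_into T)"
  have "range (from_nat_into T) = T"
    using T(1) \<open>T \<noteq> {}\<close> by (simp add: range_from_nat_into)
  then have "T \<subseteq> range e" unfolding e_def
    by (metis nat.case(2) rangeI image_subsetI)
  then have "A \<subseteq> closure (range e)" using T(3) closure_mono by blast
  moreover have "range e \<subseteq> A"
  proof clarify
    fix a b n assume "(a, b) = e n"
    then show "(a, b) \<in> A"
      using T(2) zero from_nat_into[OF \<open>T \<noteq> {}\<close>] by (cases n) (auto simp: e_def)
  qed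
  moreover have "e 0 = (0, 0)" by (simp add: e_def)
  ultimately have "range e \<subseteq> A \<and> e 0 = (0, 0) \<and> A \<subseteq> closure (range e)" by simp
  then have "range enum \<subseteq> A \<and> enum 0 = (0, 0) \<and> A \<subseteq> closure (range enum)"
    unfolding enum_def by (rule someI[where P = "\<lambda>e. range e \<subseteq> A \<and> e 0 = (0, 0) \<and> A \<subseteq> closure (range e)"])
  then show "range enum \<subseteq> A" "enum 0 = (0, 0)" "A \<subseteq> closure (range enum)" by auto
qed

lemma enum_in: "enum i \<in> A" using enum(1) by auto

text \<open>The enumeration starts at the origin, so this maximum is a nonnegative real without any
  cut at 0.\<close>

definition excess_max :: "nat \<Rightarrow> real \<Rightarrow> real \<Rightarrow> real" where
  "excess_max n l y = Max ((\<lambda>i. fst (enum i) * y - l * snd (enum i)) ` {..n})"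

lemma excess_max_nonneg: "0 \<le> excess_max n l y"
  unfolding excess_max_def
  by (rule Max_ge_iff[THEN iffD2]) (auto intro!: bexI[of _ 0] simp: enum(2))

lemma excess_max_Suc:
  "excess_max (Suc n) l y = max (fst (enum (Suc n)) * y - l * snd (enum (Suc n))) (excess_max n l y)"
  unfolding excess_max_def by (simp add: atMost_Suc)

lemma excess_max_0: "excess_max 0 l y = 0"
  unfolding excess_max_def by (simp add: enum(2))

lemma excess_max_mono: "n \<le> m \<Longrightarrow> excess_max n l y \<le> excess_max m l y"
  unfolding excess_max_def by (intro Max_mono) auto

lemma excess_max_le_excess: "ennreal (excess_max n l y) \<le> excess A l y"
proof -
  have "excess_max n l y \<in> (\<lambda>i. fst (enum i) * y - l * snd (enum i)) ` {..n}"
    unfolding excess_max_def by (intro Max_in) auto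
  then obtain i where "excess_max n l y = fst (enum i) * y - l * snd (enum i)" by auto
  then show ?thesis using excess_upper[OF enum_in] by metis
qed

text \<open>For fixed \<open>l\<close> and \<open>y\<close> the contribution is continuous in the
  point of \<open>A\<close>, so a dense sequence suffices. Countability brings measurability and
  monotone convergence.\<close>

lemma excess_eq_SUP: "excess A l y = (SUP n. ennreal (excess_max n l y))"
proof (rule antisym)
  show "(SUP n. ennreal (excess_max n l y)) \<le> excess A l y"
    by (intro SUP_least excess_max_le_excess)
  let ?B = "SUP n. ennreal (excess_max n l y)"
  show "excess A l y \<le> ?B"
  proof (rule excess_least)
    fix a assume "a \<in> A"
    have "closed {a. ennreal (fst a * y - l * snd a) \<le> ?B}"
      by (intro closed_Collect_le continuous_on_ennreal continuous_intros)
    moreover have "range enum \<subseteq> {a. ennreal (fst a * y - l * snd a) \<le> ?B}"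
    proof (intro image_subsetI CollectI)
      fix i
      have "fst (enum i) * y - l * snd (enum i) \<le> excess_max i l y"
        unfolding excess_max_def by (intro Max_ge) auto
      then show "ennreal (fst (enum i) * y - l * snd (enum i)) \<le> ?B"
        by (intro order_trans[OF ennreal_leI SUP_upper[of i]]) auto
    qed
    ultimately have "closure (range enum) \<subseteq> {a. ennreal (fst a * y - l * snd a) \<le> ?B}"
      by (rule closure_minimal[rotated])
    with enum(3) \<open>a \<in> A\<close> show "ennreal (fst a * y - l * snd a) \<le> ?B" by auto
  qed
qed

lemma excess_max_measurable[measurable]: "(\<lambda>y. excess_max n l y) \<in> borel_measurable borel"
proof (induction n)
  case 0
  then show ?case by (simp add: excess_max_0)
next
  case (Suc n)
  then have [measurable]: "(\<lambda>y. excess_max n l y) \<in> borel_measurable borel" .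
  show ?case unfolding excess_max_Suc by measurable
qed

lemma excess_measurable[measurable]: "(\<lambda>y. excess A l y) \<in> borel_measurable borel"
  unfolding excess_eq_SUP by measurable

lemma excess_max_lipschitz:
  "\<exists>L\<ge>0. \<forall>l y l' y'. excess_max n l y \<le> excess_max n l' y' + L * (\<bar>y - y'\<bar> + \<bar>l - l'\<bar>)"
proof (induction n)
  case 0
  then show ?case by (auto simp: excess_max_0 intro: exI[of _ 0])
next
  case (Suc n)
  then obtain L where L: "0 \<le> L"
    "\<And>l y l' y'. excess_max n l y \<le> excess_max n l' y' + L * (\<bar>y - y'\<bar> + \<bar>l - l'\<bar>)" by blast
  define s r where "s = fst (enum (Suc n))" and "r = snd (enum (Suc n))"
  \<comment> \<open>Adding the slopes, instead of taking their maximum, serves both branches of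
    \<open>max\<close> at once.\<close>
  define L' where "L' = L + \<bar>s\<bar> + \<bar>r\<bar>"
  have "excess_max (Suc n) l y \<le> excess_max (Suc n) l' y' + L' * (\<bar>y - y'\<bar> + \<bar>l - l'\<bar>)" for l y l' y'
  proof -
    let ?d = "\<bar>y - y'\<bar> + \<bar>l - l'\<bar>"
    have "s * y - l * r = s * y' - l' * r + (s * (y - y') - (l - l') * r)" by (simp add: algebra_simps)
    moreover have "s * (y - y') - (l - l') * r \<le> \<bar>s\<bar> * \<bar>y - y'\<bar> + \<bar>l - l'\<bar> * \<bar>r\<bar>"
      using abs_ge_self[of "s * (y - y')"] abs_ge_minus_self[of "(l - l') * r"] by (simp add: abs_mult)
    moreover have "\<bar>s\<bar> * \<bar>y - y'\<bar> + \<bar>l - l'\<bar> * \<bar>r\<bar> \<le> L' * ?d"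
    proof -
      have "\<bar>s\<bar> * \<bar>y - y'\<bar> + \<bar>l - l'\<bar> * \<bar>r\<bar> \<le> L' * \<bar>y - y'\<bar> + \<bar>l - l'\<bar> * L'"
        using L(1) by (intro add_mono mult_right_mono mult_left_mono) (auto simp: L'_def)
      then show ?thesis by (simp add: algebra_simps)
    qed
    moreover have "L * ?d \<le> L' * ?d" by (intro mult_right_mono) (auto simp: L'_def)
    ultimately show ?thesis
      using L(2)[of l y l' y'] unfolding excess_max_Suc s_def[symmetric] r_def[symmetric] by linarith
  qed
  moreover have "0 \<le> L'" using L(1) by (simp add: L'_def)
  ultimately show ?case by blast
qed

end

locale payoff = prob_space +
  fixes X :: "'a \<Rightarrow> real"
  assumes integrable_payoff: "integrable M X"
begin

lemma payoff_measurable[measurable]: "X \<in> borel_measurable M"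
  using integrable_payoff by auto

lemma dual_objective_ge_mean: "ereal (expectation X + snd z * \<epsilon>) \<le> dual_objective M X A \<epsilon> z"
  unfolding dual_objective_def
  using add_left_mono[of 0 "enn2ereal (\<integral>\<^sup>+ w. excess A (snd z) (X w - fst z) \<partial>M)" "ereal (expectation X + snd z * \<epsilon>)"]
  by (simp add: enn2ereal_nonneg)

text \<open>One point of \<open>A\<close> minorizes the excess by an affine function, whose integral
  sees the payoff only through its mean. Bounds of this kind therefore hold for all empirical
  measures as soon as their means are controlled.\<close>

lemma dual_objective_ge:
  assumes "a \<in> A"
  shows "ereal (expectation X + snd z * \<epsilon> + (fst a * (expectation X - fst z) - snd z * snd a))
    \<le> dual_objective M X A \<epsilon> z"
proof -
  let ?f = "\<lambda>w. fst a * (X w - fst z) - snd z * snd a"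
  have i: "integrable M ?f" using integrable_payoff by simp
  have "fst a * (expectation X - fst z) - snd z * snd a = expectation ?f"
    using integrable_payoff by (simp add: prob_space)
  also have "ereal (expectation ?f) \<le> enn2ereal (\<integral>\<^sup>+ w. ennreal (?f w) \<partial>M)"
  proof -
    have "expectation ?f \<le> expectation (\<lambda>w. max 0 (?f w))"
      using i by (intro integral_mono integrable_max) auto
    also have "ereal \<dots> = enn2ereal (ennreal (expectation (\<lambda>w. max 0 (?f w))))"
      by (simp add: enn2ereal_ennreal)
    also have "ennreal (expectation (\<lambda>w. max 0 (?f w))) = (\<integral>\<^sup>+ w. ennreal (max 0 (?f w)) \<partial>M)"
      using i by (intro nn_integral_eq_integral[symmetric] integrable_max) auto
    also have "\<dots> = (\<integral>\<^sup>+ w. ennreal (?f w) \<partial>M)"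
      by (intro nn_integral_cong) (simp add: max_def ennreal_neg)
    finally show ?thesis by simp
  qed
  also have "\<dots> \<le> enn2ereal (\<integral>\<^sup>+ w. excess A (snd z) (X w - fst z) \<partial>M)"
    unfolding less_eq_ennreal.rep_eq[symmetric] by (intro nn_integral_mono excess_upper assms)
  finally show ?thesis
    unfolding dual_objective_def plus_ereal.simps(1)[symmetric] by (intro add_left_mono)
qed

end

section \<open>Sample average approximation under Slater's condition\<close>

context perturbation_set
begin

definition approx_objective :: "'a measure \<Rightarrow> ('a \<Rightarrow> real) \<Rightarrow> real \<Rightarrow> nat \<Rightarrow> real \<times> real \<Rightarrow> real" where
  "approx_objective M X \<epsilon> n z = (\<integral>w. X w \<partial>M) + snd z * \<epsilon> + (\<integral>w. excess_max n (snd z) (X w - fst z) \<partial>M)"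

lemma integrable_excess_max:
  assumes "payoff M X"
  shows "integrable M (\<lambda>w. excess_max n l (X w - \<mu>))"
proof -
  interpret payoff M X by fact
  obtain L where L: "0 \<le> L"
    "\<And>l y l' y'. excess_max n l y \<le> excess_max n l' y' + L * (\<bar>y - y'\<bar> + \<bar>l - l'\<bar>)"
    using excess_max_lipschitz by blast
  show ?thesis
  proof (rule Bochner_Integration.integrable_bound)
    show "integrable M (\<lambda>w. excess_max n l 0 + L * \<bar>X w - \<mu>\<bar>)"
      using integrable_payoff by simp
    show "AE w in M. norm (excess_max n l (X w - \<mu>)) \<le> norm (excess_max n l 0 + L * \<bar>X w - \<mu>\<bar>)"
      using L(2)[of l _ l 0] L(1) excess_max_nonneg by (auto intro!: AE_I2)
  qed measurable
qed

lemma nn_integral_excess_max: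
  assumes "payoff M X"
  shows "(\<integral>\<^sup>+ w. ennreal (excess_max n l (X w - \<mu>)) \<partial>M) = ennreal (\<integral>w. excess_max n l (X w - \<mu>) \<partial>M)"
  by (intro nn_integral_eq_integral integrable_excess_max[OF assms] AE_I2 excess_max_nonneg)

lemma approx_objective_le:
  assumes "payoff M X"
  shows "ereal (approx_objective M X \<epsilon> n z) \<le> dual_objective M X A \<epsilon> z"
proof -
  have "ereal (\<integral>w. excess_max n (snd z) (X w - fst z) \<partial>M)
      = enn2ereal (\<integral>\<^sup>+ w. ennreal (excess_max n (snd z) (X w - fst z)) \<partial>M)"
    by (simp add: nn_integral_excess_max[OF assms] enn2ereal_ennreal integral_nonneg_AE excess_max_nonneg)
  also have "\<dots> \<le> enn2ereal (\<integral>\<^sup>+ w. excess A (snd z) (X w - fst z) \<partial>M)"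
    unfolding less_eq_ennreal.rep_eq[symmetric] by (intro nn_integral_mono excess_max_le_excess)
  finally show ?thesis
    unfolding dual_objective_def approx_objective_def plus_ereal.simps(1)[symmetric] by (intro add_left_mono)
qed

text \<open>Monotone convergence in \<open>n\<close>; it also covers an infinite objective.\<close>

lemma less_approx_objective:
  assumes "payoff M X" and less: "R < dual_objective M X A \<epsilon> z"
  obtains n where "R < ereal (approx_objective M X \<epsilon> n z)"
proof -
  interpret payoff M X by fact
  let ?I = "\<lambda>n. \<integral>\<^sup>+ w. ennreal (excess_max n (snd z) (X w - fst z)) \<partial>M"
  have "(\<integral>\<^sup>+ w. excess A (snd z) (X w - fst z) \<partial>M) = (SUP n. ?I n)"
    unfolding excess_eq_SUP
    by (intro nn_integral_monotone_convergence_SUP incseq_SucI le_funI ennreal_leI excess_max_mono) auto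
  moreover have "incseq ?I"
    by (intro incseq_SucI nn_integral_mono ennreal_leI excess_max_mono) auto
  ultimately have "?I \<longlonglongrightarrow> (\<integral>\<^sup>+ w. excess A (snd z) (X w - fst z) \<partial>M)"
    using LIMSEQ_SUP by metis
  then have "(\<lambda>n. ereal (expectation X + snd z * \<epsilon>) + enn2ereal (?I n)) \<longlonglongrightarrow> dual_objective M X A \<epsilon> z"
    unfolding dual_objective_def by (intro tendsto_add_ereal_general2 tendsto_enn2erealI tendsto_const) auto
  then have "\<forall>\<^sub>F n in sequentially. R < ereal (expectation X + snd z * \<epsilon>) + enn2ereal (?I n)"
    using less by (rule order_tendstoD)
  then obtain n where "R < ereal (expectation X + snd z * \<epsilon>) + enn2ereal (?I n)"
    by (auto simp: eventually_sequentially)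
  then have "R < ereal (approx_objective M X \<epsilon> n z)"
    by (simp add: approx_objective_def nn_integral_excess_max[OF assms(1)] enn2ereal_ennreal
        integral_nonneg_AE excess_max_nonneg)
  then show ?thesis by (rule that)
qed

text \<open>The Lipschitz constant is the same for all distributions of the payoff; in particular it is
  shared by the true and all empirical objectives.\<close>

lemma approx_objective_lipschitz:
  assumes "0 \<le> L" and L: "\<And>l y l' y'. excess_max n l y \<le> excess_max n l' y' + L * (\<bar>y - y'\<bar> + \<bar>l - l'\<bar>)"
    and "payoff M X"
  shows "approx_objective M X \<epsilon> n z
    \<le> approx_objective M X \<epsilon> n z' + (L + \<bar>\<epsilon>\<bar>) * (\<bar>fst z - fst z'\<bar> + \<bar>snd z - snd z'\<bar>)"
proof -
  interpret payoff M X by fact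
  let ?d = "\<bar>fst z - fst z'\<bar> + \<bar>snd z - snd z'\<bar>"
  have "(\<integral>w. excess_max n (snd z) (X w - fst z) \<partial>M) \<le> (\<integral>w. excess_max n (snd z') (X w - fst z') + L * ?d \<partial>M)"
  proof (rule integral_mono)
    fix w
    have "\<bar>(X w - fst z) - (X w - fst z')\<bar> = \<bar>fst z - fst z'\<bar>" by linarith
    then show "excess_max n (snd z) (X w - fst z) \<le> excess_max n (snd z') (X w - fst z') + L * ?d"
      using L[of "snd z" "X w - fst z" "snd z'" "X w - fst z'"] by simp
  qed (auto intro!: integrable_excess_max assms Bochner_Integration.integrable_add)
  also have "\<dots> = (\<integral>w. excess_max n (snd z') (X w - fst z') \<partial>M) + L * ?d"
    using integrable_excess_max[OF assms(3)] by (simp add: prob_space)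
  finally have 1: "(\<integral>w. excess_max n (snd z) (X w - fst z) \<partial>M) \<le> (\<integral>w. excess_max n (snd z') (X w - fst z') \<partial>M) + L * ?d" .
  have "snd z * \<epsilon> - snd z' * \<epsilon> = \<epsilon> * (snd z - snd z')" by (simp add: algebra_simps)
  also have "\<dots> \<le> \<bar>\<epsilon>\<bar> * \<bar>snd z - snd z'\<bar>"
    using abs_ge_self[of "\<epsilon> * (snd z - snd z')"] by (simp only: abs_mult)
  also have "\<dots> \<le> \<bar>\<epsilon>\<bar> * ?d" by (intro mult_left_mono) auto
  finally show ?thesis
    using 1 unfolding approx_objective_def distrib_right by linarith
qed

text \<open>For a location above the mean the affine minorant of the point with negative first
  coordinate grows with slope at least \<open>\<kappa>\<close>, below the mean that of the other
  point; the slack \<open>\<epsilon> - c1\<close> or \<open>\<epsilon> - c2\<close> provides the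
  growth in the multiplier.\<close>

lemma dual_objective_coercive:
  assumes "payoff M X" and "z \<in> multipliers"
    and "(s1, c1) \<in> A" "(s2, c2) \<in> A"
    and "\<kappa> \<le> - s1" "\<kappa> \<le> s2" "\<kappa> \<le> \<epsilon> - c1" "\<kappa> \<le> \<epsilon> - c2"
  shows "ereal ((\<integral>w. X w \<partial>M) + \<kappa> * (\<bar>fst z - (\<integral>w. X w \<partial>M)\<bar> + snd z)) \<le> dual_objective M X A \<epsilon> z"
proof -
  interpret payoff M X by fact
  let ?e = "expectation X"
  have l: "0 \<le> snd z" using assms(2) by (simp add: multipliers_iff)
  have "\<exists>(s, c)\<in>A. ?e + \<kappa> * (\<bar>fst z - ?e\<bar> + snd z) \<le> ?e + snd z * \<epsilon> + (s * (?e - fst z) - snd z * c)"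
  proof (cases "?e \<le> fst z")
    case True
    have "\<kappa> * (fst z - ?e) \<le> (- s1) * (fst z - ?e)" "\<kappa> * snd z \<le> (\<epsilon> - c1) * snd z"
      using True l assms by (intro mult_right_mono; simp)+
    then have "?e + \<kappa> * (\<bar>fst z - ?e\<bar> + snd z) \<le> ?e + snd z * \<epsilon> + (s1 * (?e - fst z) - snd z * c1)"
      using True by (simp add: algebra_simps)
    then show ?thesis using assms(3) by blast
  next
    case False
    have "\<kappa> * (?e - fst z) \<le> s2 * (?e - fst z)" "\<kappa> * snd z \<le> (\<epsilon> - c2) * snd z"
      using False l assms by (intro mult_right_mono; simp)+
    then have "?e + \<kappa> * (\<bar>fst z - ?e\<bar> + snd z) \<le> ?e + snd z * \<epsilon> + (s2 * (?e - fst z) - snd z * c2)"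
      using False by (simp add: algebra_simps)
    then show ?thesis using assms(4) by blast
  qed
  then obtain a where a: "a \<in> A"
    "?e + \<kappa> * (\<bar>fst z - ?e\<bar> + snd z) \<le> ?e + snd z * \<epsilon> + (fst a * (?e - fst z) - snd z * snd a)"
    by (auto elim!: bexE)
  show ?thesis
    by (rule order_trans[OF _ dual_objective_ge[OF a(1)]]) (use a(2) in simp)
qed

end

text \<open>Constraint qualification for \<open>E s = 0\<close> and
  \<open>E r \<le> \<epsilon>\<close>: points on both sides of \<open>s = 0\<close> make 0 interior
  to the attainable values of \<open>E s\<close>, with slack in the inequality.\<close>

definition slater :: "(real \<times> real) set \<Rightarrow> real \<Rightarrow> bool" where
  "slater A \<epsilon> \<longleftrightarrow> (\<exists>s1 c1 s2 c2. (s1, c1) \<in> A \<and> (s2, c2) \<in> A \<and> s1 < 0 \<and> 0 < s2 \<and> c1 < \<epsilon> \<and> c2 < \<epsilon>)"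

text \<open>One sample path: \<open>Y\<close> is the sequence of sampled payoffs and
  \<open>Q k\<close> weights an initial segment of it. Convergence is demanded for countably many
  functions only, so that almost every path satisfies it.\<close>

locale approximated_payoff = payoff M X + perturbation_set A
  for M :: "'a measure" and X and A +
  fixes Q :: "nat \<Rightarrow> 'b measure" and Y :: "'b \<Rightarrow> real"
  assumes payoff_Q: "payoff (Q k) Y"
    and mean_Q: "(\<lambda>k. \<integral>w. Y w \<partial>Q k) \<longlonglongrightarrow> expectation X"
    and excess_Q: "\<And>n p q. p \<in> \<rat> \<Longrightarrow> q \<in> \<rat> \<Longrightarrow>
      (\<lambda>k. \<integral>w. excess_max n q (Y w - p) \<partial>Q k) \<longlonglongrightarrow> expectation (\<lambda>w. excess_max n q (X w - p))"
begin

text \<open>A truncation that already exceeds \<open>R\<close> at \<open>z0\<close> is compared with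
  its empirical version at a nearby rational pair and carried back to a whole ball; both moves use
  the common Lipschitz constant.\<close>

lemma eventually_greater_local:
  fixes R :: real
  assumes "ereal R < dual_objective M X A \<epsilon> z0"
  shows "\<exists>\<alpha>>R. \<exists>\<delta>>0. \<forall>\<^sub>F k in sequentially. \<forall>z\<in>ball z0 \<delta>. ereal \<alpha> < dual_objective (Q k) Y A \<epsilon> z"
proof -
  have pay: "payoff M X" ..
  obtain n where n: "ereal R < ereal (approx_objective M X \<epsilon> n z0)"
    by (rule less_approx_objective[OF pay assms])
  define \<alpha> where "\<alpha> = (R + approx_objective M X \<epsilon> n z0) / 2"
  define g where "g = approx_objective M X \<epsilon> n z0 - \<alpha>"
  have \<alpha>_eq: "\<alpha> = approx_objective M X \<epsilon> n z0 - g" by (simp add: g_def)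
  have \<alpha>: "R < \<alpha>" and g: "0 < g" using n by (auto simp: \<alpha>_def g_def)
  obtain L where L: "0 \<le> L"
    "\<And>l y l' y'. excess_max n l y \<le> excess_max n l' y' + L * (\<bar>y - y'\<bar> + \<bar>l - l'\<bar>)"
    using excess_max_lipschitz by blast
  define C where "C = L + \<bar>\<epsilon>\<bar> + 1"
  have C: "1 \<le> C" using L(1) by (simp add: C_def)
  have LC: "(L + \<bar>\<epsilon>\<bar>) * d \<le> C * d" if "0 \<le> d" for d
    using that by (intro mult_right_mono) (auto simp: C_def)
  have lip: "approx_objective M X \<epsilon> n z \<le> approx_objective M X \<epsilon> n z' + C * (\<bar>fst z - fst z'\<bar> + \<bar>snd z - snd z'\<bar>)" for z z'
    by (rule order_trans[OF approx_objective_lipschitz[OF L pay] add_left_mono[OF LC]]) simp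
  have lipQ: "approx_objective (Q k) Y \<epsilon> n z \<le> approx_objective (Q k) Y \<epsilon> n z' + C * (\<bar>fst z - fst z'\<bar> + \<bar>snd z - snd z'\<bar>)" for k z z'
    by (rule order_trans[OF approx_objective_lipschitz[OF L payoff_Q] add_left_mono[OF LC]]) simp
  \<comment> \<open>The gap \<open>g\<close> has to cover a move from \<open>z0\<close> to the
    rational pair (\<open>g / 8\<close>), the sampling error (\<open>g / 4\<close>) and a move to
    any point of the ball (\<open>g / 4\<close>).\<close>
  define \<delta> where "\<delta> = g / (16 * C)"
  have \<delta>: "0 < \<delta>" "C * \<delta> = g / 16" using g C by (auto simp: \<delta>_def)
  have C\<delta>: "C * (\<delta> + \<delta>) = g / 8" "C * (2 * \<delta> + 2 * \<delta>) = g / 4"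
    using \<delta>(2) by (simp_all add: algebra_simps)
  obtain p where p: "p \<in> \<rat>" "fst z0 < p" "p < fst z0 + \<delta>"
    using Rats_dense_in_real[of "fst z0" "fst z0 + \<delta>"] \<delta> by auto
  obtain q where q: "q \<in> \<rat>" "snd z0 < q" "q < snd z0 + \<delta>"
    using Rats_dense_in_real[of "snd z0" "snd z0 + \<delta>"] \<delta> by auto
  have "(\<lambda>k. approx_objective (Q k) Y \<epsilon> n (p, q)) \<longlonglongrightarrow> approx_objective M X \<epsilon> n (p, q)"
    unfolding approx_objective_def using excess_Q[OF p(1) q(1)]
    by (intro tendsto_add mean_Q tendsto_const) auto
  then have "\<forall>\<^sub>F k in sequentially. approx_objective M X \<epsilon> n (p, q) - g / 4 < approx_objective (Q k) Y \<epsilon> n (p, q)"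
    by (rule order_tendstoD) (use g in auto)
  then have "\<forall>\<^sub>F k in sequentially. \<forall>z\<in>ball z0 \<delta>. ereal \<alpha> < dual_objective (Q k) Y A \<epsilon> z"
  proof eventually_elim
    case (elim k)
    show ?case
    proof
      fix z assume z: "z \<in> ball z0 \<delta>"
      have d: "\<bar>fst z0 - fst z\<bar> < \<delta>" "\<bar>snd z0 - snd z\<bar> < \<delta>"
        using z dist_fst_le[of z0 z] dist_snd_le[of z0 z] by (auto simp: dist_real_def)
      have "approx_objective M X \<epsilon> n z0 \<le> approx_objective M X \<epsilon> n (p, q) + C * (\<delta> + \<delta>)"
        by (rule order_trans[OF lip[of z0 "(p, q)"]])
          (use p q C in \<open>auto intro!: mult_left_mono\<close>)
      moreover have "approx_objective (Q k) Y \<epsilon> n (p, q) \<le> approx_objective (Q k) Y \<epsilon> n z + C * (2 * \<delta> + 2 * \<delta>)"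
        by (rule order_trans[OF lipQ[of k "(p, q)" z]])
          (use p q C d in \<open>auto intro!: mult_left_mono\<close>)
      ultimately have "\<alpha> < approx_objective (Q k) Y \<epsilon> n z"
        using elim g \<alpha>_eq unfolding C\<delta> by linarith
      then show "ereal \<alpha> < dual_objective (Q k) Y A \<epsilon> z"
        using approx_objective_le[OF payoff_Q, of k \<epsilon> n z] by (meson less_ereal.simps(1) less_le_trans)
    qed
  qed
  then show ?thesis using \<alpha> \<delta>(1) by blast
qed

lemma eventually_greater_compact:
  fixes R :: real
  assumes "compact K" and "\<And>z. z \<in> K \<Longrightarrow> ereal R < dual_objective M X A \<epsilon> z"
  shows "\<exists>\<alpha>>R. \<forall>\<^sub>F k in sequentially. \<forall>z\<in>K. ereal \<alpha> < dual_objective (Q k) Y A \<epsilon> z"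
proof -
  have "\<forall>z0\<in>K. \<exists>p. R < fst p \<and> 0 < snd p \<and>
      (\<forall>\<^sub>F k in sequentially. \<forall>z\<in>ball z0 (snd p). ereal (fst p) < dual_objective (Q k) Y A \<epsilon> z)"
    using eventually_greater_local[OF assms(2)] by simp
  from bchoice[OF this] obtain p where p: "\<forall>z0\<in>K. R < fst (p z0) \<and> 0 < snd (p z0) \<and>
      (\<forall>\<^sub>F k in sequentially. \<forall>z\<in>ball z0 (snd (p z0)). ereal (fst (p z0)) < dual_objective (Q k) Y A \<epsilon> z)" ..
  define \<alpha> \<delta> where "\<alpha> z0 = fst (p z0)" and "\<delta> z0 = snd (p z0)" for z0
  have *: "\<And>z0. z0 \<in> K \<Longrightarrow> R < \<alpha> z0" "\<And>z0. z0 \<in> K \<Longrightarrow> 0 < \<delta> z0"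
    "\<And>z0. z0 \<in> K \<Longrightarrow> \<forall>\<^sub>F k in sequentially. \<forall>z\<in>ball z0 (\<delta> z0). ereal (\<alpha> z0) < dual_objective (Q k) Y A \<epsilon> z"
    using p by (auto simp: \<alpha>_def \<delta>_def)
  obtain D where D: "D \<subseteq> K" "finite D" "K \<subseteq> (\<Union>z\<in>D. ball z (\<delta> z))"
    by (rule compactE_image[OF assms(1), of K "\<lambda>z. ball z (\<delta> z)"]) (use *(2) in auto)
  \<comment> \<open>Inserting \<open>R + 1\<close> keeps the minimum defined when the compact set is
    empty.\<close>
  define \<beta> where "\<beta> = Min (insert (R + 1) (\<alpha> ` D))"
  have "R < \<beta>" unfolding \<beta>_def using D *(1) by (subst Min_gr_iff) auto
  moreover have "\<forall>\<^sub>F k in sequentially. \<forall>z0\<in>D. \<forall>z\<in>ball z0 (\<delta> z0). ereal (\<alpha> z0) < dual_objective (Q k) Y A \<epsilon> z"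
    using D *(3) by (intro eventually_ball_finite) auto
  then have "\<forall>\<^sub>F k in sequentially. \<forall>z\<in>K. ereal \<beta> < dual_objective (Q k) Y A \<epsilon> z"
  proof eventually_elim
    case (elim k)
    show ?case
    proof
      fix z assume "z \<in> K"
      then obtain z0 where z0: "z0 \<in> D" "z \<in> ball z0 (\<delta> z0)" using D(3) by blast
      have "\<beta> \<le> \<alpha> z0" unfolding \<beta>_def using D(2) z0(1) by (intro Min_le) auto
      then show "ereal \<beta> < dual_objective (Q k) Y A \<epsilon> z"
        using elim z0 le_less_trans[of "ereal \<beta>" "ereal (\<alpha> z0)"] by simp
    qed
  qed
  ultimately show ?thesis by blast
qed

section \<open>Uniform coercivity and convergence of minimizers\<close>

lemma eventually_coercive:
  fixes C :: real
  assumes "slater A \<epsilon>"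
  obtains \<rho> where "\<forall>\<^sub>F k in sequentially. \<forall>z\<in>multipliers. \<rho> < norm z \<longrightarrow> ereal C < dual_objective (Q k) Y A \<epsilon> z"
proof -
  obtain s1 c1 s2 c2 where sl: "(s1, c1) \<in> A" "(s2, c2) \<in> A" "s1 < 0" "0 < s2" "c1 < \<epsilon>" "c2 < \<epsilon>"
    using assms by (auto simp: slater_def)
  define \<kappa> where "\<kappa> = Min {- s1, s2, \<epsilon> - c1, \<epsilon> - c2}"
  have \<kappa>: "0 < \<kappa>" "\<kappa> \<le> - s1" "\<kappa> \<le> s2" "\<kappa> \<le> \<epsilon> - c1" "\<kappa> \<le> \<epsilon> - c2"
    using sl by (auto simp: \<kappa>_def)
  define m where "m = expectation X"
  \<comment> \<open>The summand \<open>\<bar>m\<bar> + 1\<close> bounds the empirical mean, and the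
    extra 1 in the numerator allows for that mean being as low as \<open>m - 1\<close>.\<close>
  define \<rho> where "\<rho> = (C - m + 1) / \<kappa> + \<bar>m\<bar> + 1"
  have "\<forall>\<^sub>F k in sequentially. \<bar>(\<integral>w. Y w \<partial>Q k) - m\<bar> < 1"
    using tendstoD[OF mean_Q, of 1] by (simp add: dist_real_def m_def)
  then have "\<forall>\<^sub>F k in sequentially. \<forall>z\<in>multipliers. \<rho> < norm z \<longrightarrow> ereal C < dual_objective (Q k) Y A \<epsilon> z"
  proof eventually_elim
    case (elim k)
    define e where "e = (\<integral>w. Y w \<partial>Q k)"
    show ?case
    proof (intro ballI impI)
      fix z :: "real \<times> real" assume z: "z \<in> multipliers" "\<rho> < norm z"
      have "norm z \<le> \<bar>fst z\<bar> + \<bar>snd z\<bar>" using norm_Pair_le[of "fst z" "snd z"] by simp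
      then have "\<rho> < \<bar>fst z\<bar> + snd z" using z by (simp add: multipliers_iff)
      then have "(C - m + 1) / \<kappa> < \<bar>fst z - e\<bar> + snd z"
        using elim unfolding \<rho>_def e_def[symmetric] by linarith
      then have "C - m + 1 < \<kappa> * (\<bar>fst z - e\<bar> + snd z)"
        using \<kappa>(1) by (simp add: pos_divide_less_eq mult.commute)
      then have "C < e + \<kappa> * (\<bar>fst z - e\<bar> + snd z)"
        using elim unfolding e_def[symmetric] by linarith
      then show "ereal C < dual_objective (Q k) Y A \<epsilon> z"
        using dual_objective_coercive[OF payoff_Q z(1) sl(1,2) \<kappa>(2-), of k]
        unfolding e_def by (meson less_ereal.simps(1) less_le_trans)
    qed
  qed
  then show ?thesis by (rule that)
qed

lemma eventually_greater_slater:
  fixes R :: real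
  assumes "slater A \<epsilon>" and "\<And>z. z \<in> multipliers \<Longrightarrow> ereal R < dual_objective M X A \<epsilon> z"
  shows "\<forall>\<^sub>F k in sequentially. \<forall>z\<in>multipliers. ereal R < dual_objective (Q k) Y A \<epsilon> z"
proof -
  obtain \<rho> where \<rho>: "\<forall>\<^sub>F k in sequentially. \<forall>z\<in>multipliers. \<rho> < norm z \<longrightarrow> ereal R < dual_objective (Q k) Y A \<epsilon> z"
    by (rule eventually_coercive[OF assms(1)])
  have "compact (cball 0 \<rho> \<inter> multipliers)"
    by (intro compact_Int_closed compact_cball closed_multipliers)
  then obtain \<alpha> where "R < \<alpha>"
    "\<forall>\<^sub>F k in sequentially. \<forall>z\<in>cball 0 \<rho> \<inter> multipliers. ereal \<alpha> < dual_objective (Q k) Y A \<epsilon> z"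
    using eventually_greater_compact[of "cball 0 \<rho> \<inter> multipliers" R \<epsilon>] assms(2) by auto
  from this(2) \<rho> show ?thesis
  proof eventually_elim
    case (elim k)
    show ?case
    proof
      fix z :: "real \<times> real" assume z: "z \<in> multipliers"
      show "ereal R < dual_objective (Q k) Y A \<epsilon> z"
      proof (cases "\<rho> < norm z")
        case True
        with elim(2) z show ?thesis by blast
      next
        case False
        then have "z \<in> cball 0 \<rho> \<inter> multipliers" using z by simp
        with elim(1) have "ereal \<alpha> < dual_objective (Q k) Y A \<epsilon> z" by blast
        with \<open>R < \<alpha>\<close> show ?thesis by (meson less_ereal.simps(1) less_trans)
      qed
    qed
  qed
qed

text \<open>On the compact set of points of \<open>B\<close> at distance at least
  \<open>\<eta>\<close> from the minimizers, the optimal value is strictly exceeded. The empirical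
  objectives eventually exceed a level \<open>\<alpha>\<close> there, while at \<open>zs\<close>
  they fall below it; no empirical minimizer is left in that set.\<close>

lemma eventually_minimizers_near_bounded:
  assumes zs: "zs \<in> dual_minimizers M X A \<epsilon>" and fin: "\<bar>dual_objective M X A \<epsilon> zs\<bar> \<noteq> \<infinity>"
    and lim: "(\<lambda>k. dual_objective (Q k) Y A \<epsilon> zs) \<longlonglongrightarrow> dual_objective M X A \<epsilon> zs"
    and "bounded B" and "0 < \<eta>"
  shows "\<forall>\<^sub>F k in sequentially. \<forall>z\<in>dual_minimizers (Q k) Y A \<epsilon> \<inter> B.
    \<exists>z'\<in>dual_minimizers M X A \<epsilon>. dist z z' < \<eta>"
proof -
  let ?X = "dual_minimizers M X A \<epsilon>"
  obtain R where R: "dual_objective M X A \<epsilon> zs = ereal R" using fin by auto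
  define K where "K = (closure B \<inter> multipliers) \<inter> {z. \<eta> \<le> infdist z ?X}"
  have "compact K" unfolding K_def
    using \<open>bounded B\<close> closed_multipliers
    by (intro compact_Int_closed closed_Collect_le continuous_intros) (auto simp: compact_closure)
  moreover have "ereal R < dual_objective M X A \<epsilon> z" if "z \<in> K" for z
  proof (rule ccontr)
    assume "\<not> ereal R < dual_objective M X A \<epsilon> z"
    then have "dual_objective M X A \<epsilon> z \<le> dual_objective M X A \<epsilon> zs" using R by simp
    moreover have "\<forall>z'\<in>multipliers. dual_objective M X A \<epsilon> zs \<le> dual_objective M X A \<epsilon> z'" "z \<in> multipliers"
      using zs that by (auto simp: dual_minimizers_iff K_def)
    ultimately have "z \<in> ?X" unfolding dual_minimizers_iff by (meson order_trans)
    then show False using that \<open>0 < \<eta>\<close> by (simp add: K_def)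
  qed
  ultimately have "\<exists>\<alpha>>R. \<forall>\<^sub>F k in sequentially. \<forall>z\<in>K. ereal \<alpha> < dual_objective (Q k) Y A \<epsilon> z"
    by (rule eventually_greater_compact)
  then obtain \<alpha> where \<alpha>: "R < \<alpha>"
    "\<forall>\<^sub>F k in sequentially. \<forall>z\<in>K. ereal \<alpha> < dual_objective (Q k) Y A \<epsilon> z"
    by (elim exE conjE)
  have "\<forall>\<^sub>F k in sequentially. dual_objective (Q k) Y A \<epsilon> zs < ereal \<alpha>"
    using lim by (rule order_tendstoD) (use \<alpha>(1) R in simp)
  with \<alpha>(2) show ?thesis
  proof eventually_elim
    case (elim k)
    show ?case
    proof
      fix z assume z: "z \<in> dual_minimizers (Q k) Y A \<epsilon> \<inter> B"
      have "dual_objective (Q k) Y A \<epsilon> z \<le> dual_objective (Q k) Y A \<epsilon> zs"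
        using z zs by (auto simp: dual_minimizers_iff)
      then have "\<not> ereal \<alpha> < dual_objective (Q k) Y A \<epsilon> z" using elim(2) by (meson le_less_trans less_asym)
      then have "z \<notin> K" using elim(1) by blast
      moreover have "z \<in> closure B \<inter> multipliers"
        using z closure_subset[of B] by (auto simp: dual_minimizers_iff)
      ultimately have "infdist z ?X < \<eta>" by (auto simp: K_def)
      moreover have "?X \<noteq> {}" using zs by auto
      ultimately show "\<exists>z'\<in>?X. dist z z' < \<eta>"
        by (simp add: infdist_def cINF_less_iff)
    qed
  qed
qed

text \<open>Coercivity confines the empirical minimizers to one ball, because their values
  eventually stay below \<open>R + 1\<close>.\<close>

lemma eventually_minimizers_near_slater:
  assumes "slater A \<epsilon>"
    and zs: "zs \<in> dual_minimizers M X A \<epsilon>" and fin: "\<bar>dual_objective M X A \<epsilon> zs\<bar> \<noteq> \<infinity>"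
    and lim: "(\<lambda>k. dual_objective (Q k) Y A \<epsilon> zs) \<longlonglongrightarrow> dual_objective M X A \<epsilon> zs"
    and "0 < \<eta>"
  shows "\<forall>\<^sub>F k in sequentially. \<forall>z\<in>dual_minimizers (Q k) Y A \<epsilon>.
    \<exists>z'\<in>dual_minimizers M X A \<epsilon>. dist z z' < \<eta>"
proof -
  obtain R where R: "dual_objective M X A \<epsilon> zs = ereal R" using fin by auto
  obtain \<rho> where \<rho>: "\<forall>\<^sub>F k in sequentially. \<forall>z\<in>multipliers. \<rho> < norm z \<longrightarrow> ereal (R + 1) < dual_objective (Q k) Y A \<epsilon> z"
    by (rule eventually_coercive[OF assms(1)])
  have "\<forall>\<^sub>F k in sequentially. dual_objective (Q k) Y A \<epsilon> zs < ereal (R + 1)"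
    using lim by (rule order_tendstoD) (use R in simp)
  with \<rho> eventually_minimizers_near_bounded[OF zs fin lim bounded_cball[of 0 \<rho>] \<open>0 < \<eta>\<close>]
  show ?thesis
  proof eventually_elim
    case (elim k)
    show ?case
    proof
      fix z assume z: "z \<in> dual_minimizers (Q k) Y A \<epsilon>"
      have "dual_objective (Q k) Y A \<epsilon> z \<le> dual_objective (Q k) Y A \<epsilon> zs"
        using z zs by (auto simp: dual_minimizers_iff)
      then have "\<not> ereal (R + 1) < dual_objective (Q k) Y A \<epsilon> z"
        using elim(3) by (meson le_less_trans less_asym)
      then have "norm z \<le> \<rho>" using elim(1) z unfolding dual_minimizers_iff by (meson not_le)
      then show "\<exists>z'\<in>dual_minimizers M X A \<epsilon>. dist z z' < \<eta>" using elim(2) z by auto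
    qed
  qed
qed

end

section \<open>Duality\<close>

lemma e2ennreal_ereal: "e2ennreal (ereal x) = ennreal x" "e2ennreal (- ereal x) = ennreal (- x)"
  by (simp_all add: ennreal.abs_eq)

lemma integrable_parts_finite:
  assumes "integrable M f"
  obtains a b where "0 \<le> a" "(\<integral>\<^sup>+ w. ennreal (f w) \<partial>M) = ennreal a"
    "0 \<le> b" "(\<integral>\<^sup>+ w. ennreal (- f w) \<partial>M) = ennreal b" "(\<integral>w. f w \<partial>M) = a - b"
proof (cases "\<integral>\<^sup>+ w. ennreal (f w) \<partial>M"; cases "\<integral>\<^sup>+ w. ennreal (- f w) \<partial>M")
  fix a b assume "0 \<le> a" "(\<integral>\<^sup>+ w. ennreal (f w) \<partial>M) = ennreal a"
    "0 \<le> b" "(\<integral>\<^sup>+ w. ennreal (- f w) \<partial>M) = ennreal b"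
  then show ?thesis using real_lebesgue_integral_def[OF assms] that by simp
qed (use assms in \<open>auto simp: real_integrable_def\<close>)

text \<open>Since \<open>k\<close> may be infinite, the difference of the two integrals cannot be
  split directly. The pointwise identity \<open>pt\<close> moves every negative part to the other
  side and is integrated in \<open>ennreal\<close>; subtraction happens only at the end, where
  \<open>N\<close> and \<open>Hm\<close> are known to be finite.\<close>

lemma expect_ereal_plus_ennreal:
  fixes k :: "'a \<Rightarrow> ennreal"
  assumes h: "integrable M h" and [measurable]: "k \<in> borel_measurable M"
  shows "expect M (\<lambda>w. ereal (h w) + enn2ereal (k w)) = ereal (\<integral>w. h w \<partial>M) + enn2ereal (\<integral>\<^sup>+ w. k w \<partial>M)"
proof -
  have [measurable]: "h \<in> borel_measurable M" using h by auto
  let ?g = "\<lambda>w. ereal (h w) + enn2ereal (k w)"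
  have pt: "e2ennreal (?g w) + ennreal (- h w) = e2ennreal (- ?g w) + ennreal (h w) + k w"
    "e2ennreal (- ?g w) \<le> ennreal (- h w)" for w
  proof -
    have "e2ennreal (?g w) + ennreal (- h w) = e2ennreal (- ?g w) + ennreal (h w) + k w
      \<and> e2ennreal (- ?g w) \<le> ennreal (- h w)"
    proof (cases "k w")
      case (real c)
      then have "?g w = ereal (h w + c)" by (simp add: enn2ereal_ennreal)
      moreover have "ennreal (h w + c) + ennreal (- h w) = ennreal (- (h w + c)) + ennreal (h w) + ennreal c"
        using real(1) by (cases "0 \<le> h w"; cases "0 \<le> h w + c")
          (auto simp: ennreal_plus[symmetric] ennreal_neg simp del: ennreal_plus)
      ultimately show ?thesis using real by (auto simp: e2ennreal_ereal intro!: ennreal_leI)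
    next
      case top
      then have "?g w = \<infinity>" by (simp add: top_ennreal.rep_eq top_ereal_def)
      then show ?thesis using top by (simp add: e2ennreal_neg e2ennreal_infty)
    qed
    then show "e2ennreal (?g w) + ennreal (- h w) = e2ennreal (- ?g w) + ennreal (h w) + k w"
      "e2ennreal (- ?g w) \<le> ennreal (- h w)" by auto
  qed
  define P N Hp Hm K where "P = (\<integral>\<^sup>+ w. e2ennreal (?g w) \<partial>M)" and "N = (\<integral>\<^sup>+ w. e2ennreal (- ?g w) \<partial>M)"
    and "Hp = (\<integral>\<^sup>+ w. ennreal (h w) \<partial>M)" and "Hm = (\<integral>\<^sup>+ w. ennreal (- h w) \<partial>M)" and "K = (\<integral>\<^sup>+ w. k w \<partial>M)"
  have fin: "Hm < \<infinity>"
    using h by (auto simp: real_integrable_def less_top Hm_def)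
  have "N \<le> Hm" unfolding N_def Hm_def by (intro nn_integral_mono pt)
  then have "N < \<infinity>" using fin by auto
  have "P + Hm = (\<integral>\<^sup>+ w. e2ennreal (?g w) + ennreal (- h w) \<partial>M)"
    unfolding P_def Hm_def by (intro nn_integral_add[symmetric]) measurable
  also have "\<dots> = N + Hp + K"
    unfolding pt N_def Hp_def K_def by (simp add: nn_integral_add)
  finally have eq: "P + Hm = N + Hp + K" .
  obtain hp hm where hph: "0 \<le> hp" "Hp = ennreal hp" "0 \<le> hm" "Hm = ennreal hm" and int: "(\<integral>w. h w \<partial>M) = hp - hm"
    using integrable_parts_finite[OF h, folded Hp_def Hm_def] .
  moreover obtain n where "0 \<le> n" "N = ennreal n"
    using \<open>N < \<infinity>\<close> by (cases N) auto
  ultimately have r: "0 \<le> n" "N = ennreal n" "0 \<le> hp" "Hp = ennreal hp" "0 \<le> hm" "Hm = ennreal hm"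
    by auto
  have "enn2ereal P - enn2ereal N = ereal (\<integral>w. h w \<partial>M) + enn2ereal K"
  proof (cases K)
    case (real c)
    then have "P + ennreal hm = ennreal (n + hp + c)" using eq r by (simp add: ennreal_plus)
    moreover from this have "P \<noteq> top" by auto
    ultimately obtain p where p: "0 \<le> p" "P = ennreal p" "p + hm = n + hp + c"
      using r real by (cases P) (auto simp: ennreal_plus[symmetric] simp del: ennreal_plus)
    then show ?thesis using r real int by (simp add: enn2ereal_ennreal)
  next
    case top
    then have "P = top" using eq r by (cases P) (auto simp: ennreal_plus[symmetric] simp del: ennreal_plus)
    then show ?thesis using top r by (simp add: top_ennreal.rep_eq top_ereal_def enn2ereal_ennreal)
  qed
  then show ?thesis by (simp add: expect_def P_def N_def K_def)
qed

lemma expect_ereal: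
  assumes "integrable M f"
  shows "expect M (\<lambda>w. ereal (f w)) = ereal (\<integral>w. f w \<partial>M)"
  using expect_ereal_plus_ennreal[OF assms, of "\<lambda>_. 0"] by (simp add: zero_ennreal.rep_eq)

text \<open>The bound keeps the positive part of \<open>f\<close> integrable, so if \<open>f\<close>
  itself is not integrable, its expectation is minus infinity.\<close>

lemma expect_le_integral:
  assumes [measurable]: "f \<in> borel_measurable M" and H: "integrable M H"
    and le: "AE w in M. f w \<le> H w"
  shows "expect M (\<lambda>w. ereal (f w)) \<le> ereal (\<integral>w. H w \<partial>M)"
proof (cases "integrable M f")
  case True
  then show ?thesis
    using integral_mono_AE[OF True H le] by (simp add: expect_ereal)
next
  case False
  have "(\<integral>\<^sup>+ w. ennreal (f w) \<partial>M) \<le> (\<integral>\<^sup>+ w. ennreal (H w) \<partial>M)"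
    using le by (intro nn_integral_mono_AE) (auto elim!: eventually_mono intro: ennreal_leI)
  also have "\<dots> < \<infinity>" using H by (auto simp: real_integrable_def less_top)
  finally have fin: "(\<integral>\<^sup>+ w. ennreal (f w) \<partial>M) < \<infinity>" .
  with False have "(\<integral>\<^sup>+ w. ennreal (- f w) \<partial>M) = \<infinity>"
    by (auto simp: real_integrable_def)
  with fin show ?thesis
    by (cases "\<integral>\<^sup>+ w. ennreal (f w) \<partial>M") (auto simp: expect_def e2ennreal_ereal enn2ereal_ennreal top_ennreal.rep_eq top_ereal_def)
qed

context payoff
begin

lemma simple_function_integrable:
  fixes s :: "'a \<Rightarrow> real"
  assumes "simple_function M s"
  shows "integrable M s" "integrable M (\<lambda>w. s w * X w)"
proof -
  show "integrable M s"
    by (rule integrable_simple_function[OF assms]) (simp add: emeasure_eq_measure)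
  obtain K where K: "\<And>w. w \<in> space M \<Longrightarrow> \<bar>s w\<bar> \<le> K"
    using finite_imp_bounded[OF simple_functionD(1)[OF assms]] by (auto simp: bounded_iff)
  have [measurable]: "s \<in> borel_measurable M" using assms by (rule borel_measurable_simple_function)
  show "integrable M (\<lambda>w. s w * X w)"
  proof (rule Bochner_Integration.integrable_bound)
    show "integrable M (\<lambda>w. K * X w)" using integrable_payoff by simp
    show "AE w in M. norm (s w * X w) \<le> norm (K * X w)"
      using K by (intro AE_I2) (auto simp: abs_mult intro!: mult_right_mono intro: order_trans[OF _ abs_ge_self])
  qed measurable
qed

end

section \<open>Strong and weak duality\<close>

locale dual_problem = payoff M X + perturbation_set A
  for M :: "'a measure" and X and A
begin

text \<open>Choosing a maximizer among finitely many points is measurable. Thus the truncated excess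
  is attained by a simple function with values in \<open>A\<close>, which is what lets finitely
  valued densities carry the duality proof.\<close>

lemma excess_max_simple_selection:
  "\<exists>f. simple_function M f \<and> (\<forall>w. f w \<in> A) \<and>
     (\<forall>w. excess_max n l (X w - \<mu>) = fst (f w) * (X w - \<mu>) - l * snd (f w))"
proof (induction n)
  case 0
  show ?case by (rule exI[of _ "\<lambda>_. (0, 0)"]) (auto simp: excess_max_0 zero)
next
  case (Suc n)
  then obtain f where f: "simple_function M f" "\<And>w. f w \<in> A"
    "\<And>w. excess_max n l (X w - \<mu>) = fst (f w) * (X w - \<mu>) - l * snd (f w)" by blast
  let ?v = "\<lambda>w. fst (enum (Suc n)) * (X w - \<mu>) - l * snd (enum (Suc n))"
  have "simple_function M (\<lambda>w. if excess_max n l (X w - \<mu>) < ?v w then enum (Suc n) else f w)"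
    by (intro simple_function_If f) auto
  then show ?case
    by (intro exI[of _ "\<lambda>w. if excess_max n l (X w - \<mu>) < ?v w then enum (Suc n) else f w"])
      (auto simp: excess_max_Suc f enum_in max_def)
qed

text \<open>The primal problem restricted to densities with finitely many values is a convex program with
  the two constraints \<open>E s = 0\<close> and \<open>E r \<le> \<epsilon>\<close>, so its image in \<open>\<real>\<^sup>3\<close> can be separated from the
  points that would beat the bound \<open>B\<close>; Slater's condition makes the separating plane nonvertical.\<close>

lemma strong_duality:
  assumes sl: "slater A \<epsilon>"
    and B: "\<And>f. \<lbrakk>simple_function M f; \<And>w. w \<in> space M \<Longrightarrow> f w \<in> A; expectation (\<lambda>w. fst (f w)) = 0;
      expectation (\<lambda>w. snd (f w)) \<le> \<epsilon>\<rbrakk> \<Longrightarrow> expectation (\<lambda>w. X w + fst (f w) * X w) \<le> B"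
  shows "\<exists>z\<in>multipliers. dual_objective M X A \<epsilon> z \<le> ereal B"
proof -
  \<comment> \<open>\<open>T\<close> records \<open>E (s X)\<close> only, so the constant
    \<open>E X\<close> is taken out of the bound.\<close>
  define B' where "B' = B - expectation X"
  define F where "F = {f :: 'a \<Rightarrow> real \<times> real. simple_function M f \<and> (\<forall>w\<in>space M. f w \<in> A)}"
  define T where "T f = (expectation (\<lambda>w. fst (f w)), expectation (\<lambda>w. snd (f w)), expectation (\<lambda>w. fst (f w) * X w))" for f :: "'a \<Rightarrow> real \<times> real"
  have int: "integrable M (\<lambda>w. fst (f w))" "integrable M (\<lambda>w. snd (f w))" "integrable M (\<lambda>w. fst (f w) * X w)"
    if "f \<in> F" for f
  proof -
    have "simple_function M (\<lambda>w. fst (f w))" "simple_function M (\<lambda>w. snd (f w))"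
      using that by (auto simp: F_def intro: simple_function_compose1)
    then show "integrable M (\<lambda>w. fst (f w))" "integrable M (\<lambda>w. snd (f w))" "integrable M (\<lambda>w. fst (f w) * X w)"
      by (auto intro: simple_function_integrable)
  qed
  have "convex (T ` F)"
  proof (rule convexI)
    fix x y :: "real \<times> real \<times> real" and u v :: real
    assume "x \<in> T ` F" "y \<in> T ` F" and uv: "0 \<le> u" "0 \<le> v" "u + v = 1"
    then obtain f g where fg: "f \<in> F" "g \<in> F" "x = T f" "y = T g" by auto
    let ?h = "\<lambda>w. u *\<^sub>R f w + v *\<^sub>R g w"
    have "?h \<in> F"
      using fg(1,2) convexD[OF convex _ _ uv]
        simple_function_compose2[of M f g "\<lambda>x y. u *\<^sub>R x + v *\<^sub>R y"] by (simp add: F_def)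
    moreover have "T ?h = u *\<^sub>R x + v *\<^sub>R y"
    proof -
      have lin: "expectation (\<lambda>w. u * p w + v * q w) = u * expectation p + v * expectation q"
        if "integrable M p" "integrable M q" for p q :: "'a \<Rightarrow> real"
        using that by simp
      have "expectation (\<lambda>w. fst (?h w)) = u * expectation (\<lambda>w. fst (f w)) + v * expectation (\<lambda>w. fst (g w))"
        "expectation (\<lambda>w. snd (?h w)) = u * expectation (\<lambda>w. snd (f w)) + v * expectation (\<lambda>w. snd (g w))"
        using lin[OF int(1)[OF fg(1)] int(1)[OF fg(2)]] lin[OF int(2)[OF fg(1)] int(2)[OF fg(2)]] by simp_all
      moreover have "expectation (\<lambda>w. fst (?h w) * X w)
          = expectation (\<lambda>w. u * (fst (f w) * X w) + v * (fst (g w) * X w))"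
        by (intro Bochner_Integration.integral_cong) (simp_all add: algebra_simps)
      ultimately show ?thesis
        using lin[OF int(3)[OF fg(1)] int(3)[OF fg(2)]] unfolding T_def fg(3,4)
        by (simp only: scaleR_Pair add_Pair real_scaleR_def)
    qed
    ultimately show "u *\<^sub>R x + v *\<^sub>R y \<in> T ` F"
      by (intro image_eqI[where f = T and x = ?h]) simp_all
  qed
  moreover define D where "D = {x :: real \<times> real \<times> real. fst x = 0 \<and> fst (snd x) \<le> \<epsilon> \<and> B' < snd (snd x)}"
  have "convex D"
  proof (rule convexI)
    fix x y :: "real \<times> real \<times> real" and u v :: real
    assume xy: "x \<in> D" "y \<in> D" and uv: "0 \<le> u" "0 \<le> v" "u + v = 1"
    have "u * fst (snd x) + v * fst (snd y) \<le> \<epsilon>"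
      using xy uv by (intro convex_bound_le) (auto simp: D_def)
    moreover have "u * (- snd (snd x)) + v * (- snd (snd y)) < - B'"
      using xy uv by (intro convex_bound_lt) (auto simp: D_def)
    ultimately show "u *\<^sub>R x + v *\<^sub>R y \<in> D" using xy by (simp add: D_def)
  qed
  moreover have const: "(\<lambda>_. a) \<in> F" if "a \<in> A" for a using that by (simp add: F_def)
  have "T ` F \<noteq> {}" using const[OF zero] by auto
  moreover have inD: "(0, b, q) \<in> D \<longleftrightarrow> b \<le> \<epsilon> \<and> B' < q" for b q by (simp add: D_def)
  have "D \<noteq> {}" using inD[of \<epsilon> "B' + 1"] by auto
  moreover have "T ` F \<inter> D = {}"
  proof (rule ccontr)
    assume "T ` F \<inter> D \<noteq> {}"
    then obtain f where f: "f \<in> F" "T f \<in> D" by blast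
    have "expectation (\<lambda>w. X w + fst (f w) * X w) \<le> B"
      by (rule B) (use f in \<open>auto simp: F_def T_def D_def\<close>)
    then show False using f int[OF f(1)] integrable_payoff by (simp add: T_def D_def B'_def)
  qed
  ultimately obtain a :: "real \<times> real \<times> real" and b0 where a: "a \<noteq> 0"
    "\<forall>x\<in>T ` F. inner a x \<le> b0" "\<forall>x\<in>D. b0 \<le> inner a x"
    using separating_hyperplane_sets[of "T ` F" D] by auto
  obtain \<alpha> \<beta> \<gamma> where abc: "a = (\<alpha>, \<beta>, \<gamma>)" by (cases a)
  have lower: "b0 \<le> \<beta> * b + \<gamma> * q" if "b \<le> \<epsilon>" "B' < q" for b q
    using a(3) inD[of b q] that by (force simp: abc)
  have \<gamma>: "0 \<le> \<gamma>"
  proof (rule ccontr)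
    assume "\<not> 0 \<le> \<gamma>"
    \<comment> \<open>\<open>D\<close> is unbounded upwards in the third coordinate; with a negative
      coefficient this \<open>q\<close> would violate \<open>lower\<close>.\<close>
    define q where "q = max (B' + 1) ((\<beta> * \<epsilon> - b0 + 1) / (- \<gamma>))"
    have "(\<beta> * \<epsilon> - b0 + 1) / (- \<gamma>) \<le> q" by (simp add: q_def)
    then have "\<beta> * \<epsilon> - b0 + 1 \<le> q * (- \<gamma>)" using \<open>\<not> 0 \<le> \<gamma>\<close> by (subst (asm) pos_divide_le_eq) auto
    moreover have "B' < q" by (simp add: q_def)
    ultimately show False using lower[of \<epsilon> q] by (simp add: algebra_simps)
  qed
  have \<beta>: "\<beta> \<le> 0"
  proof (rule ccontr)
    assume "\<not> \<beta> \<le> 0"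
    \<comment> \<open>Likewise \<open>D\<close> is unbounded downwards in the second
      coordinate.\<close>
    define b where "b = min \<epsilon> ((b0 - 1 - \<gamma> * (B' + 1)) / \<beta>)"
    have "b \<le> (b0 - 1 - \<gamma> * (B' + 1)) / \<beta>" by (simp add: b_def)
    then have "b * \<beta> \<le> b0 - 1 - \<gamma> * (B' + 1)" using \<open>\<not> \<beta> \<le> 0\<close> by (subst (asm) pos_le_divide_eq) auto
    moreover have "b \<le> \<epsilon>" by (simp add: b_def)
    ultimately show False using lower[of b "B' + 1"] by (simp add: algebra_simps)
  qed
  have b0: "b0 \<le> \<beta> * \<epsilon> + \<gamma> * B'"
  proof (rule field_le_epsilon)
    \<comment> \<open>Approaches the excluded boundary \<open>q = B'\<close>; the denominator
      \<open>\<gamma> + 1\<close> remains positive if \<open>\<gamma> = 0\<close>.\<close>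
    fix e :: real assume "0 < e"
    then have "b0 \<le> \<beta> * \<epsilon> + \<gamma> * (B' + e / (\<gamma> + 1))" using \<gamma> by (intro lower) auto
    also have "\<gamma> * (B' + e / (\<gamma> + 1)) \<le> \<gamma> * B' + e"
      using \<gamma> \<open>0 < e\<close> by (simp add: field_simps)
    finally show "b0 \<le> \<beta> * \<epsilon> + \<gamma> * B' + e" by simp
  qed
  have upper: "\<alpha> * expectation (\<lambda>w. fst (f w)) + \<beta> * expectation (\<lambda>w. snd (f w)) + \<gamma> * expectation (\<lambda>w. fst (f w) * X w)
    \<le> \<beta> * \<epsilon> + \<gamma> * B'" if "f \<in> F" for f
  proof -
    have "inner a (T f) \<le> b0" using a(2) that by auto
    then show ?thesis using b0 by (simp add: abc T_def)
  qed
  have "\<gamma> \<noteq> 0"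
  proof
    \<comment> \<open>A vertical plane would give
      \<open>\<alpha> * s \<le> \<beta> * (\<epsilon> - c) \<le> 0\<close> at both Slater points.
      Their opposite signs force \<open>\<alpha> = 0\<close>, and then the strict slack forces
      \<open>\<beta> = 0\<close>.\<close>
    assume "\<gamma> = 0"
    obtain s1 c1 s2 c2 where s: "(s1, c1) \<in> A" "(s2, c2) \<in> A" "s1 < 0" "0 < s2" "c1 < \<epsilon>" "c2 < \<epsilon>"
      using sl by (auto simp: slater_def)
    have 1: "\<alpha> * s1 \<le> \<beta> * (\<epsilon> - c1)" "\<alpha> * s2 \<le> \<beta> * (\<epsilon> - c2)"
      using upper[OF const[OF s(1)]] upper[OF const[OF s(2)]] \<open>\<gamma> = 0\<close> by (auto simp: prob_space algebra_simps)
    have 2: "\<beta> * (\<epsilon> - c1) \<le> 0" "\<beta> * (\<epsilon> - c2) \<le> 0"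
      using \<beta> s by (auto intro!: mult_nonpos_nonneg)
    have "0 \<le> \<alpha>" using order_trans[OF 1(1) 2(1)] s by (simp add: mult_le_0_iff)
    moreover have "\<alpha> \<le> 0" using order_trans[OF 1(2) 2(2)] s by (simp add: mult_le_0_iff)
    ultimately have "\<alpha> = 0" by simp
    with 1(1) s \<beta> have "\<beta> = 0" by (auto simp: zero_le_mult_iff)
    with \<open>\<alpha> = 0\<close> \<open>\<gamma> = 0\<close> show False using a(1) abc by (simp add: zero_prod_def)
  qed
  with \<gamma> have \<gamma>: "0 < \<gamma>" by simp
  \<comment> \<open>Divided by \<open>\<gamma>\<close>, \<open>upper\<close> bounds the expectation
    of \<open>s * (X - \<mu>) - l * r\<close>, which for the selection \<open>f\<close> is the
    truncated excess.\<close>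
  define \<mu> l where "\<mu> = - \<alpha> / \<gamma>" and "l = - \<beta> / \<gamma>"
  have "dual_objective M X A \<epsilon> (\<mu>, l) \<le> ereal B"
  proof (rule ccontr)
    assume "\<not> dual_objective M X A \<epsilon> (\<mu>, l) \<le> ereal B"
    then have less: "ereal B < dual_objective M X A \<epsilon> (\<mu>, l)" by simp
    have "payoff M X" ..
    then obtain n where n: "ereal B < ereal (approx_objective M X \<epsilon> n (\<mu>, l))"
      by (rule less_approx_objective[OF _ less])
    obtain f where f: "simple_function M f" "\<And>w. f w \<in> A"
      "\<And>w. excess_max n l (X w - \<mu>) = fst (f w) * (X w - \<mu>) - l * snd (f w)"
      using excess_max_simple_selection by blast
    have fF: "f \<in> F" using f by (simp add: F_def)
    have "expectation (\<lambda>w. excess_max n l (X w - \<mu>))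
        = expectation (\<lambda>w. fst (f w) * X w - \<mu> * fst (f w) - l * snd (f w))"
      unfolding f(3) by (intro Bochner_Integration.integral_cong) (auto simp: algebra_simps)
    also have "\<dots> = expectation (\<lambda>w. fst (f w) * X w) - \<mu> * expectation (\<lambda>w. fst (f w)) - l * expectation (\<lambda>w. snd (f w))"
      using int[OF fF] by simp
    also have "\<dots> = (\<alpha> * expectation (\<lambda>w. fst (f w)) + \<beta> * expectation (\<lambda>w. snd (f w)) + \<gamma> * expectation (\<lambda>w. fst (f w) * X w)) / \<gamma>"
      using \<gamma> by (simp add: \<mu>_def l_def field_simps)
    also have "\<dots> \<le> (\<beta> * \<epsilon> + \<gamma> * B') / \<gamma>"
      using upper[OF fF] \<gamma> by (intro divide_right_mono) auto
    also have "\<dots> = B' - l * \<epsilon>"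
      using \<gamma> by (simp add: l_def field_simps)
    finally show False using n by (simp add: approx_objective_def B'_def)
  qed
  moreover have "(\<mu>, l) \<in> multipliers" using \<beta> \<gamma> by (simp add: multipliers_def l_def divide_nonpos_pos)
  ultimately show ?thesis by blast
qed

text \<open>The Fenchel-Young inequality holds pointwise, but \<open>(1 + s) * X\<close> need not be
  integrable. It is therefore used as an integrable upper bound through
  \<open>expect_le_integral\<close>; an infinite excess integral makes the claim trivial.\<close>

lemma weak_duality:
  assumes s: "integrable M s" "expectation s = 0" and r: "integrable M r" "expectation r \<le> \<epsilon>"
    and A: "AE w in M. (s w, r w) \<in> A" and z: "z \<in> multipliers"
  shows "expect M (\<lambda>w. ereal ((1 + s w) * X w)) \<le> dual_objective M X A \<epsilon> z"
proof (cases "\<integral>\<^sup>+ w. excess A (snd z) (X w - fst z) \<partial>M")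
  case top
  then have "dual_objective M X A \<epsilon> z = \<infinity>"
    by (simp add: dual_objective_def top_ennreal.rep_eq top_ereal_def)
  then show ?thesis by simp
next
  case (real c)
  have [measurable]: "s \<in> borel_measurable M" using s by auto
  let ?k = "\<lambda>w. enn2real (excess A (snd z) (X w - fst z))"
  have fin: "AE w in M. excess A (snd z) (X w - fst z) \<noteq> \<infinity>"
    using real by (intro nn_integral_PInf_AE) auto
  have ek: "(\<integral>\<^sup>+ w. ennreal (?k w) \<partial>M) = ennreal c"
    unfolding real(2)[symmetric] using fin by (intro nn_integral_cong_AE) (auto elim!: eventually_mono simp: less_top)
  have ik: "integrable M ?k"
    by (rule integrableI_nn_integral_finite[OF _ _ ek]) auto
  have "expectation ?k = c"
    using ek real(1) by (intro integral_eq_nn_integral[THEN trans]) auto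
  then have H: "expectation (\<lambda>w. X w + ?k w + fst z * s w + snd z * r w) = expectation X + c + snd z * expectation r"
    using integrable_payoff ik s r by simp
  have "expect M (\<lambda>w. ereal ((1 + s w) * X w)) \<le> ereal (expectation (\<lambda>w. X w + ?k w + fst z * s w + snd z * r w))"
  proof (rule expect_le_integral)
    show "AE w in M. (1 + s w) * X w \<le> X w + ?k w + fst z * s w + snd z * r w"
      using A fin
    proof eventually_elim
      case (elim w)
      have "ennreal (s w * (X w - fst z) - snd z * r w) \<le> excess A (snd z) (X w - fst z)"
        using excess_upper[OF elim(1)] by simp
      also have "\<dots> = ennreal (?k w)" using elim(2) by (simp add: less_top)
      finally have "s w * (X w - fst z) - snd z * r w \<le> ?k w"
        by (simp add: ennreal_le_iff)
      then show ?case by (simp add: algebra_simps)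
    qed
    show "integrable M (\<lambda>w. X w + ?k w + fst z * s w + snd z * r w)"
      using integrable_payoff ik s r by simp
  qed measurable
  also have "\<dots> \<le> ereal (expectation X + snd z * \<epsilon> + c)"
    using z r(2) unfolding H by (simp add: multipliers_iff mult_left_mono)
  also have "\<dots> = dual_objective M X A \<epsilon> z"
    using real by (simp add: dual_objective_def enn2ereal_ennreal)
  finally show ?thesis .
qed

end

section \<open>Radius zero\<close>

text \<open>The perturbations of zero cost. Radius 0 admits no others, as \<open>r \<ge> 0\<close>
  with \<open>E r \<le> 0\<close> vanishes almost surely.\<close>

definition flat :: "(real \<times> real) set \<Rightarrow> (real \<times> real) set" where
  "flat A = {a \<in> A. snd a = 0}"

text \<open>Corresponds to changing the sign of payoff and location, so that a statement about one
  side of 0 yields the statement about the other.\<close>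

definition mirror :: "(real \<times> real) set \<Rightarrow> (real \<times> real) set" where
  "mirror A = {a. (- fst a, snd a) \<in> A}"

lemma flat_mirror: "flat (mirror A) = mirror (flat A)"
  by (auto simp: flat_def mirror_def)

lemma excess_mirror: "excess (mirror A) l y = excess A l (- y)"
proof (rule antisym)
  show "excess (mirror A) l y \<le> excess A l (- y)"
  proof (rule excess_least)
    fix a assume "a \<in> mirror A"
    then show "ennreal (fst a * y - l * snd a) \<le> excess A l (- y)"
      using excess_upper[of "(- fst a, snd a)" A "- y" l] by (simp add: mirror_def)
  qed
  show "excess A l (- y) \<le> excess (mirror A) l y"
  proof (rule excess_least)
    fix a assume "a \<in> A"
    then show "ennreal (fst a * (- y) - l * snd a) \<le> excess (mirror A) l y"
      using excess_upper[of "(- fst a, snd a)" "mirror A" y l] by (simp add: mirror_def)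
  qed
qed

lemma excess_flat: "excess (flat A) l y = excess (flat A) 0 y"
  unfolding excess_def by (intro SUP_cong) (auto simp: flat_def)

lemma excess_flat_scale: "0 \<le> c \<Longrightarrow> excess (flat A) 0 (c * y) = ennreal c * excess (flat A) 0 y"
  using excess_scale[of c "flat A" 0 y] by simp

lemma excess_flat_le: "excess (flat A) 0 y \<le> excess A l y"
  using excess_mono_set[of "flat A" A l y] unfolding excess_flat[of A l] by (auto simp: flat_def)

text \<open>The flat excess is positively homogeneous in its argument alone, hence linear on each
  half-line; \<open>c\<close> is the share of \<open>y1\<close> in the sum.\<close>

lemma excess_flat_add:
  assumes "0 \<le> y1 * y2"
  shows "excess (flat A) 0 (y1 + y2) = excess (flat A) 0 y1 + excess (flat A) 0 y2"
proof (cases "y1 + y2 = 0")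
  case True
  then have "y1 = 0" "y2 = 0"
    using assms by (auto simp: add_eq_0_iff2 mult_le_0_iff)
  then show ?thesis using excess_flat_scale[of 0 A 0] by simp
next
  case False
  define c where "c = y1 / (y1 + y2)"
  have c: "0 \<le> c" "c \<le> 1" "y1 = c * (y1 + y2)" "y2 = (1 - c) * (y1 + y2)"
    using assms False by (auto simp: c_def field_simps zero_le_mult_iff divide_le_eq zero_le_divide_iff)
  have "excess (flat A) 0 y1 = ennreal c * excess (flat A) 0 (y1 + y2)"
    "excess (flat A) 0 y2 = ennreal (1 - c) * excess (flat A) 0 (y1 + y2)"
    using excess_flat_scale[of c A "y1 + y2"] excess_flat_scale[of "1 - c" A "y1 + y2"] c by auto
  then have "excess (flat A) 0 y1 + excess (flat A) 0 y2
      = (ennreal c + ennreal (1 - c)) * excess (flat A) 0 (y1 + y2)"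
    by (simp add: distrib_right)
  also have "ennreal c + ennreal (1 - c) = 1"
    using c by (simp add: ennreal_plus[symmetric] del: ennreal_plus)
  finally show ?thesis by simp
qed

lemma perturbation_set_mirror:
  assumes "perturbation_set A"
  shows "perturbation_set (mirror A)"
proof -
  interpret perturbation_set A by fact
  have "closed ((\<lambda>a. (- fst a, snd a)) -` A)"
    by (intro closed_vimage closed continuous_intros)
  moreover have "(\<lambda>a. (- fst a, snd a)) -` A = mirror A" by (auto simp: mirror_def)
  moreover have "convex (mirror A)"
  proof (rule convexI)
    fix x y :: "real \<times> real" and u v :: real
    assume xy: "x \<in> mirror A" "y \<in> mirror A" and uv: "0 \<le> u" "0 \<le> v" "u + v = 1"
    have "u *\<^sub>R (- fst x, snd x) + v *\<^sub>R (- fst y, snd y) \<in> A"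
      using xy by (intro convexD[OF convex _ _ uv]) (auto simp: mirror_def)
    then show "u *\<^sub>R x + v *\<^sub>R y \<in> mirror A" by (simp add: mirror_def algebra_simps)
  qed
  ultimately show ?thesis
    using zero nonneg by unfold_locales (auto simp: mirror_def zero_prod_def)
qed

lemma perturbation_set_flat:
  assumes "perturbation_set A"
  shows "perturbation_set (flat A)"
proof -
  interpret perturbation_set A by fact
  have "closed (A \<inter> {a. snd a = 0})"
    by (intro closed_Int closed closed_Collect_eq continuous_intros)
  moreover have "A \<inter> {a. snd a = 0} = flat A" by (auto simp: flat_def)
  moreover have "convex (flat A)"
  proof (rule convexI)
    fix x y :: "real \<times> real" and u v :: real
    assume "x \<in> flat A" "y \<in> flat A" and uv: "0 \<le> u" "0 \<le> v" "u + v = 1"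
    then show "u *\<^sub>R x + v *\<^sub>R y \<in> flat A"
      using convexD[OF convex _ _ uv] by (simp add: flat_def)
  qed
  ultimately show ?thesis
    using zero nonneg by unfold_locales (auto simp: flat_def)
qed

section \<open>Large multipliers reduce the excess to its flat part\<close>

context perturbation_set
begin

text \<open>Let \<open>B\<close> be the right end of the flat part. As \<open>A\<close> is closed,
  leaving it by \<open>\<eta>\<close> costs at least some \<open>\<delta> > 0\<close>, and by
  convexity the cost farther out is at least \<open>\<delta> / \<eta>\<close> per unit of distance
  from \<open>B\<close>. With \<open>l = y * \<eta> / \<delta>\<close> the penalty
  \<open>l * r\<close> then outweighs the gain \<open>(s - B) * y\<close>.\<close>

lemma excess_le_flat_nonneg_arg:
  assumes b: "\<And>a. a \<in> flat A \<Longrightarrow> fst a \<le> b" and "0 \<le> y" and "0 < \<eta>"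
  shows "\<exists>l\<ge>0. excess A l y \<le> excess (flat A) 0 y + ennreal (\<eta> * y)"
proof -
  define Z where "Z = {s. (s, 0) \<in> A}"
  have "closed ((\<lambda>s. (s, 0)) -` A)"
    by (intro closed_vimage closed continuous_intros)
  moreover have "(\<lambda>s. (s, 0)) -` A = Z" by (auto simp: Z_def)
  ultimately have "closed Z" by simp
  have Z0: "0 \<in> Z" using zero by (simp add: Z_def)
  have bdd: "bdd_above Z" using b by (auto simp: Z_def flat_def intro!: bdd_aboveI[of _ b])
  define B where "B = Sup Z"
  have "B \<in> Z" unfolding B_def using Z0 bdd \<open>closed Z\<close> by (intro closed_contains_Sup) auto
  then have BA: "(B, 0) \<in> A" by (simp add: Z_def)
  define t where "t = B + \<eta>"
  have "t \<notin> Z" using cSup_upper[of t Z] bdd \<open>0 < \<eta>\<close> by (auto simp: t_def B_def)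
  then have "(t, 0) \<in> - A" by (simp add: Z_def)
  then obtain \<delta> where \<delta>: "0 < \<delta>" "ball (t, 0) \<delta> \<subseteq> - A"
    using closed by (meson open_Compl open_contains_ball)
  have r_ge: "\<delta> \<le> r" if "(t, r) \<in> A" for r
  proof (rule ccontr)
    assume "\<not> \<delta> \<le> r"
    then have "(t, r) \<in> ball (t, 0) \<delta>" using nonneg[OF that] by (simp add: dist_Pair_Pair dist_real_def)
    with \<delta>(2) that show False by auto
  qed
  define l where "l = y * \<eta> / \<delta>"
  have l: "0 \<le> l" using assms \<delta> by (simp add: l_def)
  have flatB: "ennreal (B * y) \<le> excess (flat A) 0 y"
    using excess_upper[of "(B, 0)" "flat A" y 0] BA by (simp add: flat_def)
  have "excess A l y \<le> excess (flat A) 0 y + ennreal (\<eta> * y)"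
  proof (rule excess_least)
    fix a assume "a \<in> A"
    then obtain s r where a: "a = (s, r)" "(s, r) \<in> A" by (cases a) auto
    have "s * y - l * r \<le> B * y + \<eta> * y"
    proof (cases "s \<le> t")
      case True
      have "s * y \<le> t * y" using True \<open>0 \<le> y\<close> by (rule mult_right_mono)
      moreover have "0 \<le> l * r" using l nonneg[OF a(2)] by simp
      ultimately show ?thesis by (simp add: t_def algebra_simps)
    next
      case False
      then have sB: "\<eta> < s - B" by (simp add: t_def)
      \<comment> \<open>The segment from \<open>(B, 0)\<close> to \<open>(s, r)\<close> passes over
        abscissa \<open>t\<close> at this parameter.\<close>
      define c where "c = \<eta> / (s - B)"
      have c: "0 < c" "c \<le> 1" "c * (s - B) = \<eta>" using sB \<open>0 < \<eta>\<close> by (auto simp: c_def)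
      have "(1 - c) *\<^sub>R (B, 0) + c *\<^sub>R (s, r) \<in> A"
        using c by (intro convexD[OF convex BA a(2)]) auto
      moreover have "(1 - c) *\<^sub>R (B, 0) + c *\<^sub>R (s, r) = (t, c * r)"
        using c(3) by (simp add: t_def algebra_simps)
      ultimately have "\<delta> \<le> c * r" using r_ge by simp
      then have "\<delta> * (s - B) \<le> (c * r) * (s - B)" using sB \<open>0 < \<eta>\<close> by (intro mult_right_mono) auto
      also have "\<dots> = \<eta> * r" using c(3) by (simp add: mult.commute mult.left_commute)
      finally have "\<delta> * (s - B) / \<delta> * y \<le> \<eta> * r / \<delta> * y"
        using \<delta>(1) \<open>0 \<le> y\<close> by (intro mult_right_mono divide_right_mono) auto
      then have "(s - B) * y \<le> l * r" using \<delta>(1) by (simp add: l_def mult_ac)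
      moreover have "0 \<le> \<eta> * y" using assms by simp
      ultimately show ?thesis by (simp add: algebra_simps)
    qed
    then have "ennreal (s * y - l * r) \<le> ennreal (B * y) + ennreal (\<eta> * y)"
      by (intro order_trans[OF ennreal_leI ennreal_add_le])
    also have "\<dots> \<le> excess (flat A) 0 y + ennreal (\<eta> * y)"
      by (intro add_right_mono flatB)
    finally show "ennreal (fst a * y - l * snd a) \<le> excess (flat A) 0 y + ennreal (\<eta> * y)"
      by (simp add: a(1))
  qed
  with l show ?thesis by blast
qed

end

lemma excess_le_flat:
  assumes "perturbation_set A" and b: "\<And>a. a \<in> flat A \<Longrightarrow> \<bar>fst a\<bar> \<le> b" and "0 < \<eta>"
  shows "\<exists>l\<ge>0. excess A l y \<le> excess (flat A) 0 y + ennreal (\<eta> * \<bar>y\<bar>)"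
proof (cases "0 \<le> y")
  case True
  interpret perturbation_set A by fact
  have "fst a \<le> b" if "a \<in> flat A" for a using b[OF that] by linarith
  from excess_le_flat_nonneg_arg[OF this True \<open>0 < \<eta>\<close>] show ?thesis using True by simp
next
  case False
  interpret perturbation_set "mirror A" by (rule perturbation_set_mirror) fact
  have "fst a \<le> b" if "a \<in> flat (mirror A)" for a
    using b[of "(- fst a, snd a)"] that by (auto simp: flat_def mirror_def)
  from excess_le_flat_nonneg_arg[OF this _ \<open>0 < \<eta>\<close>, of "- y"] False show ?thesis
    by (simp add: flat_mirror excess_mirror)
qed

lemma excess_flat_finite:
  assumes b: "\<And>a. a \<in> flat A \<Longrightarrow> \<bar>fst a\<bar> \<le> b"
  shows "excess (flat A) 0 y \<le> ennreal (b * \<bar>y\<bar>)"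
proof (rule excess_least)
  fix a assume "a \<in> flat A"
  from mult_right_mono[OF b[OF this], of "\<bar>y\<bar>"] have "\<bar>fst a * y\<bar> \<le> b * \<bar>y\<bar>" by (simp add: abs_mult)
  then show "ennreal (fst a * y - 0 * snd a) \<le> ennreal (b * \<bar>y\<bar>)"
    by (intro ennreal_leI) linarith
qed

text \<open>The excess is antitone in the multiplier, so natural multipliers suffice; a sequence is
  what monotone convergence for integrals requires.\<close>

lemma INF_excess:
  assumes "perturbation_set A" and b: "\<And>a. a \<in> flat A \<Longrightarrow> \<bar>fst a\<bar> \<le> b"
  shows "(INF n. excess A (real n) y) = excess (flat A) 0 y"
proof (rule antisym)
  interpret perturbation_set A by fact
  show "excess (flat A) 0 y \<le> (INF n. excess A (real n) y)"
    by (intro INF_greatest excess_flat_le)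
  show "(INF n. excess A (real n) y) \<le> excess (flat A) 0 y"
  proof (rule ennreal_le_epsilon)
    fix e :: real assume "0 < e"
    then obtain l where l: "excess A l y \<le> excess (flat A) 0 y + ennreal (e / (\<bar>y\<bar> + 1) * \<bar>y\<bar>)"
      using excess_le_flat[OF assms, of "e / (\<bar>y\<bar> + 1)" y] by auto
    obtain n where "l \<le> real n" using real_arch_simple by blast
    then have "(INF n. excess A (real n) y) \<le> excess A l y"
      by (intro INF_lower2[of n] excess_antimono) auto
    also note l
    also have "e / (\<bar>y\<bar> + 1) * \<bar>y\<bar> \<le> e"
      using \<open>0 < e\<close> by (simp add: field_simps)
    finally show "(INF n. excess A (real n) y) \<le> excess (flat A) 0 y + ennreal e"
      by (simp add: add_left_mono ennreal_leI)
  qed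
qed

text \<open>The arguments at which the perturbed excess with multiplier \<open>l\<close> already attains its limit
  for \<open>l \<rightarrow> \<infinity>\<close>.\<close>

definition exact :: "(real \<times> real) set \<Rightarrow> real \<Rightarrow> real set" where
  "exact A l = {y. excess A l y = excess (flat A) 0 y}"

section \<open>The cone of exact arguments\<close>

context perturbation_set
begin

lemma exact_mono: "l \<le> l' \<Longrightarrow> exact A l \<subseteq> exact A l'"
  unfolding exact_def using excess_antimono[of l l'] excess_flat_le[of A _ l'] by (metis (mono_tags, lifting) Collect_mono antisym)

lemma exact_scale:
  assumes "0 \<le> c" "y \<in> exact A l"
  shows "c * y \<in> exact A (c * l)"
  using assms excess_scale[of c A l y] excess_flat_scale[of c A y] by (simp add: exact_def)

lemma exact_shrink:
  assumes "0 \<le> l" "0 \<le> c" "c \<le> 1" "y \<in> exact A l"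
  shows "c * y \<in> exact A l"
  using exact_scale[OF assms(2,4)] exact_mono[of "c * l" l] assms mult_right_mono[of c 1 l] by auto

lemma exact_add:
  assumes "y1 \<in> exact A l1" "y2 \<in> exact A l2" "0 \<le> y1 * y2"
  shows "y1 + y2 \<in> exact A (l1 + l2)"
proof -
  have "excess A (l1 + l2) (y1 + y2) \<le> excess (flat A) 0 (y1 + y2)"
    using excess_subadditive[of A l1 l2 y1 y2] assms by (simp add: exact_def excess_flat_add)
  then show ?thesis
    using excess_flat_le[of A "y1 + y2" "l1 + l2"] by (auto simp: exact_def)
qed

lemma exact_between:
  assumes "0 \<le> l" "y \<in> exact A l" "0 \<le> x * y" "\<bar>x\<bar> \<le> \<bar>y\<bar>"
  shows "x \<in> exact A l"
proof (cases "y = 0")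
  case True
  then show ?thesis using assms by simp
next
  case False
  have "x / y * y \<in> exact A l"
    using assms False by (intro exact_shrink) (auto simp: zero_le_divide_iff zero_le_mult_iff divide_le_eq)
  then show ?thesis using False by simp
qed

text \<open>A shift by at most \<open>l' * d\<close> costs at most \<open>l'\<close> more
  multiplier. Moving towards 0 costs nothing; moving away from 0 on the same side is covered by
  additivity; and if 0 is crossed, then \<open>\<bar>x\<bar> \<le> \<bar>x - y\<bar>\<close>, so
  \<open>l'\<close> alone suffices.\<close>

lemma exact_shift:
  assumes "0 < d" "d \<in> exact A 1" "- d \<in> exact A 1"
    and l: "0 \<le> l" "0 \<le> l'" and y: "y \<in> exact A l" and x: "\<bar>x - y\<bar> \<le> l' * d"
  shows "x \<in> exact A (l + l')"
proof -
  have dl: "v \<in> exact A l'" if "\<bar>v\<bar> \<le> l' * d" for v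
  proof -
    have "l' * d \<in> exact A l'" "l' * (- d) \<in> exact A l'"
      using exact_scale[OF l(2) assms(2)] exact_scale[OF l(2) assms(3)] by auto
    then show ?thesis
      using exact_between[OF l(2), of "l' * d" v] exact_between[OF l(2), of "l' * (- d)" v] that l assms(1)
      by (cases "0 \<le> v") (auto simp: zero_le_mult_iff mult_le_0_iff abs_mult)
  qed
  have mono: "exact A l \<subseteq> exact A (l + l')" "exact A l' \<subseteq> exact A (l + l')"
    using l by (auto intro!: exact_mono)
  consider "0 \<le> x * y" "\<bar>x\<bar> \<le> \<bar>y\<bar>" | "0 \<le> x * y" "\<bar>y\<bar> \<le> \<bar>x\<bar>" | "x * y < 0" by linarith
  then show ?thesis
  proof cases
    case 1
    with exact_between[OF l(1) y] mono show ?thesis by auto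
  next
    case 2
    then have "0 \<le> y * (x - y)"
      by (cases "0 \<le> y"; cases "0 \<le> x") (auto simp: zero_le_mult_iff mult_le_0_iff)
    from exact_add[OF y dl[OF x] this] show ?thesis by simp
  next
    case 3
    then have "\<bar>x\<bar> \<le> \<bar>x - y\<bar>" by (auto simp: mult_less_0_iff)
    with dl[of x] x mono show ?thesis by auto
  qed
qed

end

section \<open>The flat problem and the minimizers at radius 0\<close>

lemma AE_eq_of_nn_integral_eq:
  fixes f g :: "'a \<Rightarrow> ennreal"
  assumes [measurable]: "f \<in> borel_measurable M" "g \<in> borel_measurable M"
    and le: "\<And>w. f w \<le> g w" and eq: "(\<integral>\<^sup>+ w. g w \<partial>M) = (\<integral>\<^sup>+ w. f w \<partial>M)" and fin: "(\<integral>\<^sup>+ w. f w \<partial>M) < \<infinity>"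
  shows "AE w in M. g w = f w"
proof -
  have "(\<integral>\<^sup>+ w. g w - f w \<partial>M) = (\<integral>\<^sup>+ w. g w \<partial>M) - (\<integral>\<^sup>+ w. f w \<partial>M)"
    using fin le by (intro nn_integral_diff) auto
  also have "\<dots> = 0" using eq fin by (simp add: ennreal_diff_self)
  finally have "AE w in M. g w - f w = 0"
    by (subst (asm) nn_integral_0_iff_AE) auto
  then show ?thesis
  proof eventually_elim
    case (elim w)
    then have "g w \<le> f w" by (simp add: diff_eq_0_iff_ennreal)
    with le[of w] show ?case by (rule antisym[rotated])
  qed
qed

text \<open>The flat excess ignores the multiplier, so \<open>l\<close> enters only through its
  price. Radius 1 in place of 0 gives the flat points, whose cost is 0, slack in Slater's condition
  and puts the optimal multiplier at 0.\<close>

lemma flat_radius_one: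
  "dual_objective M X (flat A) 1 z = dual_objective M X (flat A) 1 (fst z, 0) + ereal (snd z)"
  unfolding dual_objective_def excess_flat[of A "snd z"] snd_conv fst_conv
  by (cases "\<integral>\<^sup>+ w. excess (flat A) 0 (X w - fst z) \<partial>M")
    (auto simp: enn2ereal_ennreal top_ennreal.rep_eq top_ereal_def)

lemma flat_le_dual_objective:
  "dual_objective M X (flat A) 1 (fst z, 0) \<le> dual_objective M X A 0 z"
proof -
  have "(\<integral>\<^sup>+ w. excess (flat A) 0 (X w - fst z) \<partial>M) \<le> (\<integral>\<^sup>+ w. excess A (snd z) (X w - fst z) \<partial>M)"
    by (intro nn_integral_mono excess_flat_le)
  then show ?thesis
    unfolding dual_objective_def by (simp add: less_eq_ennreal.rep_eq add_left_mono)
qed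

lemma dual_objective_finite_iff:
  "\<bar>dual_objective M X A \<epsilon> z\<bar> \<noteq> \<infinity> \<longleftrightarrow> (\<integral>\<^sup>+ w. excess A (snd z) (X w - fst z) \<partial>M) < \<infinity>"
  by (cases "\<integral>\<^sup>+ w. excess A (snd z) (X w - fst z) \<partial>M")
    (auto simp: dual_objective_def enn2ereal_ennreal top_ennreal.rep_eq top_ereal_def less_top[symmetric])

lemma dual_objective_le_iff:
  "dual_objective M X A 0 z \<le> dual_objective M X B 0 z' \<longleftrightarrow>
    (\<integral>\<^sup>+ w. excess A (snd z) (X w - fst z) \<partial>M) \<le> (\<integral>\<^sup>+ w. excess B (snd z') (X w - fst z') \<partial>M)"
  unfolding dual_objective_def less_eq_ennreal.rep_eq by (simp add: ereal_add_le_add_iff)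

lemma dual_objective_eq_iff:
  "dual_objective M X A 0 z = dual_objective M X B 0 z' \<longleftrightarrow>
    (\<integral>\<^sup>+ w. excess A (snd z) (X w - fst z) \<partial>M) = (\<integral>\<^sup>+ w. excess B (snd z') (X w - fst z') \<partial>M)"
  by (metis antisym dual_objective_le_iff order_refl)

lemma flat_radius_zero: "dual_objective M X (flat A) 1 (\<mu>, 0) = dual_objective M X (flat A) 0 (\<mu>, 0)"
  by (simp add: dual_objective_def)

lemma flat_minimizer_iff:
  "(\<mu>, 0) \<in> dual_minimizers M X (flat A) 1 \<longleftrightarrow>
    (\<forall>\<mu>'. dual_objective M X (flat A) 1 (\<mu>, 0) \<le> dual_objective M X (flat A) 1 (\<mu>', 0))"
proof -
  have "dual_objective M X (flat A) 1 (fst z, 0) \<le> dual_objective M X (flat A) 1 z" if "z \<in> multipliers" for z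
    using that add_left_mono[of 0 "ereal (snd z)" "dual_objective M X (flat A) 1 (fst z, 0)"]
    unfolding flat_radius_one[of M X A z] by (simp add: multipliers_iff)
  note * = this
  show ?thesis
  proof
    assume min: "\<forall>\<mu>'. dual_objective M X (flat A) 1 (\<mu>, 0) \<le> dual_objective M X (flat A) 1 (\<mu>', 0)"
    show "(\<mu>, 0) \<in> dual_minimizers M X (flat A) 1"
      unfolding dual_minimizers_iff
    proof (intro conjI ballI)
      fix z :: "real \<times> real" assume "z \<in> multipliers"
      from min[rule_format, of "fst z"] *[OF this]
      show "dual_objective M X (flat A) 1 (\<mu>, 0) \<le> dual_objective M X (flat A) 1 z" by (rule order_trans)
    qed (simp add: multipliers_iff)
  qed (simp add: dual_minimizers_iff multipliers_iff)
qed

lemma flat_minimizer_fst: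
  assumes "z \<in> dual_minimizers M X (flat A) 1"
  shows "(fst z, 0) \<in> dual_minimizers M X (flat A) 1"
proof -
  have "dual_objective M X (flat A) 1 (fst z, 0) \<le> dual_objective M X (flat A) 1 z"
    using assms add_left_mono[of 0 "ereal (snd z)" "dual_objective M X (flat A) 1 (fst z, 0)"]
    unfolding flat_radius_one[of M X A z] by (simp add: dual_minimizers_iff multipliers_iff)
  then show ?thesis
    using assms by (auto simp: dual_minimizers_iff multipliers_iff intro: order_trans)
qed

text \<open>The first condition will come from finiteness of the disutility at a positive argument,
  the second from membership in the Orlicz space. Both are inherited by almost all empirical
  measures, unlike the Orlicz condition itself no conjugate occurs in them.\<close>

locale tame_problem = dual_problem +
  assumes flat_bounded: "\<exists>b. \<forall>a\<in>flat A. \<bar>fst a\<bar> \<le> b"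
    and finite_excess: "\<exists>z. (\<integral>\<^sup>+ w. excess A (snd z) (X w - fst z) \<partial>M) < \<infinity>"
begin

lemma flat_pert: "perturbation_set (flat A)"
  by (rule perturbation_set_flat) unfold_locales

lemma flat_measurable[measurable]: "(\<lambda>y. excess (flat A) 0 y) \<in> borel_measurable borel"
  by (rule perturbation_set.excess_measurable[OF flat_pert])

text \<open>Subadditivity splits \<open>X - \<mu>\<close> into \<open>X - fst z\<close>, whose
  excess is integrable, and a constant, whose excess is finite for a large multiplier.\<close>

lemma finite_excess_at: "\<exists>l\<ge>0. (\<integral>\<^sup>+ w. excess A l (X w - \<mu>) \<partial>M) < \<infinity>"
proof -
  obtain b where b: "\<And>a. a \<in> flat A \<Longrightarrow> \<bar>fst a\<bar> \<le> b" using flat_bounded by blast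
  obtain z where z: "(\<integral>\<^sup>+ w. excess A (snd z) (X w - fst z) \<partial>M) < \<infinity>" using finite_excess by blast
  obtain l' where l': "0 \<le> l'" "excess A l' (fst z - \<mu>) \<le> excess (flat A) 0 (fst z - \<mu>) + ennreal (1 * \<bar>fst z - \<mu>\<bar>)"
    using excess_le_flat[OF perturbation_set_axioms b zero_less_one, of "fst z - \<mu>"] by auto
  define l where "l = max 0 (snd z)"
  have "(\<integral>\<^sup>+ w. excess A (l + l') (X w - \<mu>) \<partial>M) \<le> (\<integral>\<^sup>+ w. excess A (snd z) (X w - fst z) + excess A l' (fst z - \<mu>) \<partial>M)"
  proof (rule nn_integral_mono)
    fix w
    have "excess A (l + l') (X w - \<mu>) \<le> excess A l (X w - fst z) + excess A l' (fst z - \<mu>)"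
      using excess_subadditive[of A l l' "X w - fst z" "fst z - \<mu>"] by simp
    also have "\<dots> \<le> excess A (snd z) (X w - fst z) + excess A l' (fst z - \<mu>)"
      by (intro add_right_mono excess_antimono) (simp add: l_def)
    finally show "excess A (l + l') (X w - \<mu>) \<le> excess A (snd z) (X w - fst z) + excess A l' (fst z - \<mu>)" .
  qed
  also have "\<dots> = (\<integral>\<^sup>+ w. excess A (snd z) (X w - fst z) \<partial>M) + excess A l' (fst z - \<mu>)"
    by (subst nn_integral_add) (auto simp: emeasure_space_1)
  also have "\<dots> < \<infinity>"
  proof -
    have "excess A l' (fst z - \<mu>) \<le> ennreal (b * \<bar>fst z - \<mu>\<bar>) + ennreal (1 * \<bar>fst z - \<mu>\<bar>)"
      using l'(2) excess_flat_finite[of A b "fst z - \<mu>", OF b] by (meson add_right_mono order_trans)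
    also have "\<dots> < \<infinity>" by simp
    finally show ?thesis using z by simp
  qed
  finally show ?thesis using l'(1) by (intro exI[of _ "l + l'"]) (simp add: l_def)
qed

text \<open>Monotone convergence for a decreasing sequence; it needs one finite integral, supplied
  by \<open>finite_excess_at\<close>.\<close>

lemma INF_dual_objective:
  "(INF n. \<integral>\<^sup>+ w. excess A (real n) (X w - \<mu>) \<partial>M) = (\<integral>\<^sup>+ w. excess (flat A) 0 (X w - \<mu>) \<partial>M)"
proof -
  obtain b where b: "\<And>a. a \<in> flat A \<Longrightarrow> \<bar>fst a\<bar> \<le> b" using flat_bounded by blast
  obtain l where l: "(\<integral>\<^sup>+ w. excess A l (X w - \<mu>) \<partial>M) < \<infinity>" using finite_excess_at by blast
  obtain i where "l \<le> real i" using real_arch_simple by blast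
  then have "(\<integral>\<^sup>+ w. excess A (real i) (X w - \<mu>) \<partial>M) \<le> (\<integral>\<^sup>+ w. excess A l (X w - \<mu>) \<partial>M)"
    by (intro nn_integral_mono excess_antimono)
  also note l
  finally have "(\<integral>\<^sup>+ w. excess A (real i) (X w - \<mu>) \<partial>M) < \<infinity>" .
  then have "(\<integral>\<^sup>+ w. (INF n. excess A (real n) (X w - \<mu>)) \<partial>M) = (INF n. \<integral>\<^sup>+ w. excess A (real n) (X w - \<mu>) \<partial>M)"
    by (intro nn_integral_monotone_convergence_INF_decseq[where i = i])
      (auto intro!: decseq_SucI le_funI excess_antimono)
  then show ?thesis by (simp add: INF_excess[OF perturbation_set_axioms b])
qed

lemma flat_finite: "(\<integral>\<^sup>+ w. excess (flat A) 0 (X w - \<mu>) \<partial>M) < \<infinity>"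
proof -
  obtain l where l: "(\<integral>\<^sup>+ w. excess A l (X w - \<mu>) \<partial>M) < \<infinity>" using finite_excess_at by blast
  have "(\<integral>\<^sup>+ w. excess (flat A) 0 (X w - \<mu>) \<partial>M) \<le> (\<integral>\<^sup>+ w. excess A l (X w - \<mu>) \<partial>M)"
    by (intro nn_integral_mono excess_flat_le)
  with l show ?thesis by simp
qed

lemma dual_objective_less_of_flat_less:
  assumes "dual_objective M X (flat A) 1 (\<mu>, 0) < c"
  shows "\<exists>z\<in>multipliers. dual_objective M X A 0 z < c"
proof (rule ccontr)
  assume "\<not> ?thesis"
  then have c: "c \<le> dual_objective M X A 0 (\<mu>, real n)" for n
    by (auto simp: not_less multipliers_iff)
  let ?I = "\<lambda>n. \<integral>\<^sup>+ w. excess A (real n) (X w - \<mu>) \<partial>M"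
  have "decseq ?I" by (intro decseq_SucI nn_integral_mono excess_antimono) simp
  then have "?I \<longlonglongrightarrow> (\<integral>\<^sup>+ w. excess (flat A) 0 (X w - \<mu>) \<partial>M)"
    using LIMSEQ_INF INF_dual_objective[of \<mu>] by metis
  then have "(\<lambda>n. ereal (expectation X + 0) + enn2ereal (?I n))
      \<longlonglongrightarrow> ereal (expectation X + 0) + enn2ereal (\<integral>\<^sup>+ w. excess (flat A) 0 (X w - \<mu>) \<partial>M)"
    by (intro tendsto_add_ereal_general2 tendsto_enn2erealI tendsto_const) auto
  then have "(\<lambda>n. dual_objective M X A 0 (\<mu>, real n)) \<longlonglongrightarrow> dual_objective M X (flat A) 1 (\<mu>, 0)"
    by (simp add: dual_objective_def)
  then have "c \<le> dual_objective M X (flat A) 1 (\<mu>, 0)"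
    by (rule LIMSEQ_le_const) (use c in auto)
  with assms show False by simp
qed

text \<open>The flat objective bounds the true one from below at each location and is its limit for
  large multipliers. A minimizer must therefore attain this limit, and equality of two finite
  integrals of ordered functions is equality almost everywhere.\<close>

lemma minimizer_radius_zero_iff:
  "z \<in> dual_minimizers M X A 0 \<longleftrightarrow>
    z \<in> multipliers \<and> (fst z, 0) \<in> dual_minimizers M X (flat A) 1 \<and> (AE w in M. X w - fst z \<in> exact A (snd z))"
proof (intro iffI conjI)
  assume z: "z \<in> dual_minimizers M X A 0"
  then show "z \<in> multipliers" by (simp add: dual_minimizers_iff)
  have le: "dual_objective M X A 0 z \<le> dual_objective M X (flat A) 1 (\<mu>, 0)" for \<mu>
  proof (rule ccontr)
    assume "\<not> ?thesis"
    then have "\<exists>z'\<in>multipliers. dual_objective M X A 0 z' < dual_objective M X A 0 z"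
      by (intro dual_objective_less_of_flat_less[of \<mu>]) simp
    with z show False by (auto simp: dual_minimizers_iff not_le[symmetric])
  qed
  then show "(fst z, 0) \<in> dual_minimizers M X (flat A) 1"
    unfolding flat_minimizer_iff using flat_le_dual_objective[of M X A z] by (auto intro: order_trans)
  have "dual_objective M X A 0 z = dual_objective M X (flat A) 0 (fst z, 0)"
    using le[of "fst z"] flat_le_dual_objective[of M X A z] unfolding flat_radius_zero by (rule antisym)
  then have "(\<integral>\<^sup>+ w. excess A (snd z) (X w - fst z) \<partial>M) = (\<integral>\<^sup>+ w. excess (flat A) 0 (X w - fst z) \<partial>M)"
    unfolding dual_objective_eq_iff by simp
  then show "AE w in M. X w - fst z \<in> exact A (snd z)"
    unfolding exact_def mem_Collect_eq
    by (intro AE_eq_of_nn_integral_eq flat_finite) (auto intro: excess_flat_le)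
next
  assume z: "z \<in> multipliers \<and> (fst z, 0) \<in> dual_minimizers M X (flat A) 1 \<and> (AE w in M. X w - fst z \<in> exact A (snd z))"
  then have "(\<integral>\<^sup>+ w. excess A (snd z) (X w - fst z) \<partial>M) = (\<integral>\<^sup>+ w. excess (flat A) 0 (X w - fst z) \<partial>M)"
    by (intro nn_integral_cong_AE) (auto simp: exact_def)
  then have eq: "dual_objective M X A 0 z = dual_objective M X (flat A) 1 (fst z, 0)"
    unfolding flat_radius_zero dual_objective_eq_iff by simp
  show "z \<in> dual_minimizers M X A 0"
    unfolding dual_minimizers_iff eq
  proof (intro conjI ballI)
    fix z' :: "real \<times> real"
    show "dual_objective M X (flat A) 1 (fst z, 0) \<le> dual_objective M X A 0 z'"
      using z flat_le_dual_objective[of M X A z'] unfolding flat_minimizer_iff by (auto intro: order_trans)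
  qed (use z in simp)
qed

text \<open>All arguments \<open>X - c\<close> are nonpositive, and raising the location shifts them
  further to the left; by additivity on the half-line this adds the excess of
  \<open>c - \<mu>\<close>, at least \<open>s * (c - \<mu>) > 0\<close>.\<close>

lemma flat_objective_less_of_AE_le:
  assumes sl: "slater (flat A) 1" and ae: "AE w in M. X w \<le> c" and "c < \<mu>"
  shows "dual_objective M X (flat A) 1 (c, 0) < dual_objective M X (flat A) 1 (\<mu>, 0)"
proof -
  obtain s where s: "s < 0" "(s, 0) \<in> flat A"
    using sl by (auto simp: slater_def flat_def)
  define \<kappa> where "\<kappa> = s * (c - \<mu>)"
  have \<kappa>: "0 < \<kappa>" using s(1) \<open>c < \<mu>\<close> by (simp add: \<kappa>_def mult_neg_neg)
  let ?I = "\<lambda>m. \<integral>\<^sup>+ w. excess (flat A) 0 (X w - m) \<partial>M"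
  have "?I c + ennreal \<kappa> = (\<integral>\<^sup>+ w. excess (flat A) 0 (X w - c) + ennreal \<kappa> \<partial>M)"
    by (subst nn_integral_add) (auto simp: emeasure_space_1)
  also have "\<dots> \<le> ?I \<mu>"
  proof (rule nn_integral_mono_AE)
    show "AE w in M. excess (flat A) 0 (X w - c) + ennreal \<kappa> \<le> excess (flat A) 0 (X w - \<mu>)"
      using ae
    proof eventually_elim
      case (elim w)
      have "0 \<le> (X w - c) * (c - \<mu>)" using elim \<open>c < \<mu>\<close> by (simp add: zero_le_mult_iff)
      from excess_flat_add[OF this]
      have "excess (flat A) 0 (X w - \<mu>) = excess (flat A) 0 (X w - c) + excess (flat A) 0 (c - \<mu>)" by simp
      moreover have "ennreal \<kappa> \<le> excess (flat A) 0 (c - \<mu>)"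
        using excess_upper[OF s(2), of "c - \<mu>" 0] by (simp add: \<kappa>_def)
      ultimately show ?case by (simp add: add_left_mono)
    qed
  qed
  finally have "?I c + ennreal \<kappa> \<le> ?I \<mu>" .
  moreover have "?I c < ?I c + ennreal \<kappa>"
    using flat_finite[of c] \<kappa> by (cases "?I c") (auto simp: ennreal_plus[symmetric] ennreal_less_iff simp del: ennreal_plus)
  ultimately have "?I c < ?I \<mu>" using less_le_trans by blast
  then have "\<not> dual_objective M X (flat A) 0 (\<mu>, 0) \<le> dual_objective M X (flat A) 0 (c, 0)"
    unfolding dual_objective_le_iff by simp
  then show ?thesis unfolding flat_radius_zero by simp
qed

lemma tame_mirror: "tame_problem M (\<lambda>w. - X w) (mirror A)"
proof -
  interpret m: perturbation_set "mirror A" by (rule perturbation_set_mirror) unfold_locales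
  obtain b where b: "\<And>a. a \<in> flat A \<Longrightarrow> \<bar>fst a\<bar> \<le> b" using flat_bounded by blast
  obtain z where z: "(\<integral>\<^sup>+ w. excess A (snd z) (X w - fst z) \<partial>M) < \<infinity>" using finite_excess by blast
  show ?thesis
  proof
    show "integrable M (\<lambda>w. - X w)" using integrable_payoff by simp
    have "\<bar>fst a\<bar> \<le> b" if "a \<in> flat (mirror A)" for a
      using b[of "(- fst a, snd a)"] that by (auto simp: flat_def mirror_def)
    then show "\<exists>b. \<forall>a\<in>flat (mirror A). \<bar>fst a\<bar> \<le> b" by blast
    show "\<exists>z. (\<integral>\<^sup>+ w. excess (mirror A) (snd z) (- X w - fst z) \<partial>M) < \<infinity>"
      using z by (intro exI[of _ "(- fst z, snd z)"]) (simp add: excess_mirror add.commute)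
  qed
qed

end

lemma dual_minimizers_mirror:
  "z \<in> dual_minimizers M (\<lambda>w. - X w) (mirror A) 0 \<longleftrightarrow> (- fst z, snd z) \<in> dual_minimizers M X A 0"
proof -
  have eq: "(\<integral>\<^sup>+ w. excess (mirror A) (snd z) (- X w - fst z) \<partial>M)
      = (\<integral>\<^sup>+ w. excess A (snd (- fst z, snd z)) (X w - fst (- fst z, snd z)) \<partial>M)" for z
    by (simp add: excess_mirror add.commute)
  have bij: "(\<forall>z\<in>multipliers. Pr (- fst z, snd z)) \<longleftrightarrow> (\<forall>z\<in>multipliers. Pr z)" for Pr :: "real \<times> real \<Rightarrow> bool"
  proof
    assume *: "\<forall>z\<in>multipliers. Pr (- fst z, snd z)"
    show "\<forall>z\<in>multipliers. Pr z"
    proof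
      fix z :: "real \<times> real" assume "z \<in> multipliers"
      then have "(- fst z, snd z) \<in> multipliers" by (simp add: multipliers_iff)
      with * have "Pr (- fst (- fst z, snd z), snd (- fst z, snd z))" by blast
      then show "Pr z" by simp
    qed
  qed (auto simp: multipliers_iff)
  show ?thesis
    unfolding dual_minimizers_iff dual_objective_le_iff eq
    unfolding bij[of "\<lambda>z'. (\<integral>\<^sup>+ w. excess A (snd (- fst z, snd z)) (X w - fst (- fst z, snd z)) \<partial>M) \<le> (\<integral>\<^sup>+ w. excess A (snd z') (X w - fst z') \<partial>M)"]
    by (simp add: multipliers_iff)
qed

text \<open>If no positive argument is exact, a minimizer is located at an upper bound of the
  payoff, and by \<open>flat_objective_less_of_AE_le\<close> at the least one. For the samples,
  \<open>S2\<close> keeps this bound from exceeding \<open>fst zs\<close>, and \<open>S1\<close>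
  makes it eventually exceed any given rational below \<open>fst zs\<close>.\<close>

lemma minimizers_near_upper_edge:
  assumes M: "tame_problem M X A" and Q: "\<And>k. tame_problem (Q k) Y A"
    and sl: "slater (flat A) 1" and edge: "\<And>y. y \<in> exact A 1 \<Longrightarrow> y \<le> 0"
    and zs: "zs \<in> dual_minimizers M X A 0"
    and S1: "\<And>c. c \<in> \<rat> \<Longrightarrow> \<not> (AE w in M. X w \<le> c) \<Longrightarrow> \<forall>\<^sub>F k in sequentially. \<not> (AE w in Q k. Y w \<le> c)"
    and S2: "\<And>k. AE w in M. X w \<le> fst zs \<Longrightarrow> AE w in Q k. Y w \<le> fst zs"
    and "0 < \<eta>"
  shows "\<forall>\<^sub>F k in sequentially. \<forall>z\<in>dual_minimizers (Q k) Y A 0. \<bar>fst z - fst zs\<bar> < \<eta>"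
proof -
  interpret M: tame_problem M X A by fact
  have nonpos: "y \<le> 0" if y: "y \<in> exact A l" and "0 \<le> l" for y l
  proof (cases "l = 0")
    case True
    then show ?thesis using M.exact_mono[of l 1] y edge by auto
  next
    case False
    then have "1 / l * y \<in> exact A (1 / l * l)" using y \<open>0 \<le> l\<close> by (intro M.exact_scale) auto
    then show ?thesis using edge[of "1 / l * y"] False \<open>0 \<le> l\<close> by (simp add: divide_le_0_iff)
  qed
  have Xle: "AE w in M. X w \<le> fst zs"
    using zs unfolding M.minimizer_radius_zero_iff multipliers_iff
    by (auto elim!: eventually_mono dest: nonpos)
  obtain c where c: "c \<in> \<rat>" "fst zs - \<eta> < c" "c < fst zs"
    using Rats_dense_in_real[of "fst zs - \<eta>" "fst zs"] \<open>0 < \<eta>\<close> by auto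
  have "\<not> (AE w in M. X w \<le> c)"
  proof
    assume "AE w in M. X w \<le> c"
    then have "dual_objective M X (flat A) 1 (c, 0) < dual_objective M X (flat A) 1 (fst zs, 0)"
      by (intro M.flat_objective_less_of_AE_le sl c)
    moreover have "(fst zs, 0) \<in> dual_minimizers M X (flat A) 1"
      using zs by (simp add: M.minimizer_radius_zero_iff)
    ultimately show False unfolding flat_minimizer_iff by (auto simp: not_le[symmetric])
  qed
  from S1[OF c(1) this] show ?thesis
  proof eventually_elim
    case (elim k)
    interpret Q: tame_problem "Q k" Y A by (rule Q)
    show ?case
    proof
      fix z assume z: "z \<in> dual_minimizers (Q k) Y A 0"
      have Yle: "AE w in Q k. Y w \<le> fst z"
        using z unfolding Q.minimizer_radius_zero_iff multipliers_iff
        by (auto elim!: eventually_mono dest: nonpos)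
      have "c < fst z"
      proof (rule ccontr)
        assume "\<not> c < fst z"
        with Yle have "AE w in Q k. Y w \<le> c" by (auto elim!: eventually_mono)
        with elim show False by simp
      qed
      moreover have "fst z \<le> fst zs"
      proof (rule ccontr)
        assume "\<not> fst z \<le> fst zs"
        then have "dual_objective (Q k) Y (flat A) 1 (fst zs, 0) < dual_objective (Q k) Y (flat A) 1 (fst z, 0)"
          by (intro Q.flat_objective_less_of_AE_le sl S2 Xle) auto
        moreover have "(fst z, 0) \<in> dual_minimizers (Q k) Y (flat A) 1"
          using z by (simp add: Q.minimizer_radius_zero_iff)
        ultimately show False unfolding flat_minimizer_iff by (auto simp: not_le[symmetric])
      qed
      ultimately show "\<bar>fst z - fst zs\<bar> < \<eta>" using c by linarith
    qed
  qed
qed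

lemma slater_mirror: "slater A \<epsilon> \<Longrightarrow> slater (mirror A) \<epsilon>"
  unfolding slater_def mirror_def by (auto; metis add.inverse_inverse neg_less_0_iff_less neg_0_less_iff_less)

lemma exact_mirror: "y \<in> exact (mirror A) l \<longleftrightarrow> - y \<in> exact A l"
  by (simp add: exact_def excess_mirror flat_mirror)

lemma minimizers_near_lower_edge:
  assumes M: "tame_problem M X A" and Q: "\<And>k. tame_problem (Q k) Y A"
    and sl: "slater (flat A) 1" and edge: "\<And>y. y \<in> exact A 1 \<Longrightarrow> 0 \<le> y"
    and zs: "zs \<in> dual_minimizers M X A 0"
    and S1: "\<And>c. c \<in> \<rat> \<Longrightarrow> \<not> (AE w in M. c \<le> X w) \<Longrightarrow> \<forall>\<^sub>F k in sequentially. \<not> (AE w in Q k. c \<le> Y w)"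
    and S2: "\<And>k. AE w in M. fst zs \<le> X w \<Longrightarrow> AE w in Q k. fst zs \<le> Y w"
    and "0 < \<eta>"
  shows "\<forall>\<^sub>F k in sequentially. \<forall>z\<in>dual_minimizers (Q k) Y A 0. \<bar>fst z - fst zs\<bar> < \<eta>"
proof -
  define zs' where "zs' = (- fst zs, snd zs)"
  have neg: "- x \<le> - y \<longleftrightarrow> y \<le> x" "- x \<le> y \<longleftrightarrow> - y \<le> x" for x y :: real by linarith+
  have "\<forall>\<^sub>F k in sequentially. \<forall>z\<in>dual_minimizers (Q k) (\<lambda>w. - Y w) (mirror A) 0. \<bar>fst z - fst zs'\<bar> < \<eta>"
  proof (rule minimizers_near_upper_edge)
    show "tame_problem M (\<lambda>w. - X w) (mirror A)" by (rule tame_problem.tame_mirror[OF M])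
    show "tame_problem (Q k) (\<lambda>w. - Y w) (mirror A)" for k by (rule tame_problem.tame_mirror[OF Q])
    show "slater (flat (mirror A)) 1" unfolding flat_mirror by (rule slater_mirror[OF sl])
    show "y \<le> 0" if "y \<in> exact (mirror A) 1" for y using edge[of "- y"] that by (simp add: exact_mirror)
    show "zs' \<in> dual_minimizers M (\<lambda>w. - X w) (mirror A) 0" using zs by (simp add: dual_minimizers_mirror zs'_def)
    show "\<forall>\<^sub>F k in sequentially. \<not> (AE w in Q k. - Y w \<le> c)" if "c \<in> \<rat>" "\<not> (AE w in M. - X w \<le> c)" for c
      using S1[of "- c"] that by (simp add: neg)
    show "AE w in Q k. - Y w \<le> fst zs'" if "AE w in M. - X w \<le> fst zs'" for k
      using S2[of k] that by (simp add: zs'_def)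
  qed fact
  then show ?thesis
  proof eventually_elim
    case (elim k)
    show ?case
    proof
      fix z assume "z \<in> dual_minimizers (Q k) Y A 0"
      then have "(- fst z, snd z) \<in> dual_minimizers (Q k) (\<lambda>w. - Y w) (mirror A) 0"
        by (simp add: dual_minimizers_mirror)
      from bspec[OF elim this] show "\<bar>fst z - fst zs\<bar> < \<eta>" by (simp add: zs'_def abs_minus_commute)
    qed
  qed
qed

lemma (in dual_problem) bounded_fst_minimizers:
  assumes "slater A \<epsilon>" "z0 \<in> dual_minimizers M X A \<epsilon>" "\<bar>dual_objective M X A \<epsilon> z0\<bar> \<noteq> \<infinity>"
  shows "\<exists>D. \<forall>z\<in>dual_minimizers M X A \<epsilon>. \<bar>fst z\<bar> \<le> D"
proof -
  obtain s1 c1 s2 c2 where sl: "(s1, c1) \<in> A" "(s2, c2) \<in> A" "s1 < 0" "0 < s2" "c1 < \<epsilon>" "c2 < \<epsilon>"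
    using assms by (auto simp: slater_def)
  define \<kappa> where "\<kappa> = Min {- s1, s2, \<epsilon> - c1, \<epsilon> - c2}"
  have \<kappa>: "0 < \<kappa>" "\<kappa> \<le> - s1" "\<kappa> \<le> s2" "\<kappa> \<le> \<epsilon> - c1" "\<kappa> \<le> \<epsilon> - c2"
    using sl by (auto simp: \<kappa>_def)
  obtain R where R: "dual_objective M X A \<epsilon> z0 = ereal R" using assms(3) by auto
  have "\<bar>fst z\<bar> \<le> (R - expectation X) / \<kappa> + \<bar>expectation X\<bar>" if z: "z \<in> dual_minimizers M X A \<epsilon>" for z
  proof -
    have zm: "z \<in> multipliers" using z by (simp add: dual_minimizers_iff)
    have "payoff M X" ..
    then have "ereal (expectation X + \<kappa> * (\<bar>fst z - expectation X\<bar> + snd z)) \<le> dual_objective M X A \<epsilon> z"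
      by (rule dual_objective_coercive[OF _ zm sl(1,2) \<kappa>(2-)])
    also have "\<dots> \<le> ereal R" using z assms(2) R by (metis dual_minimizers_iff)
    finally have "expectation X + \<kappa> * (\<bar>fst z - expectation X\<bar> + snd z) \<le> R" by simp
    moreover have "\<kappa> * \<bar>fst z - expectation X\<bar> \<le> \<kappa> * (\<bar>fst z - expectation X\<bar> + snd z)"
      using \<kappa>(1) zm by (intro mult_left_mono) (auto simp: multipliers_iff)
    ultimately have "\<kappa> * \<bar>fst z - expectation X\<bar> \<le> R - expectation X" by linarith
    then have "\<bar>fst z - expectation X\<bar> \<le> (R - expectation X) / \<kappa>"
      using \<kappa>(1) by (simp add: pos_le_divide_eq mult.commute)
    then show ?thesis by linarith
  qed
  then show ?thesis by blast
qed

text \<open>At radius \<open>0\<close> the minimizers need not be bounded in the multiplier \<open>l\<close>.  Large multipliers are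
  harmless once every near-optimal location can be completed to a minimizer by all large \<open>l\<close>.\<close>

lemma minimizers_near_radius_zero:
  assumes apx: "approximated_payoff M X A Q Y" and apx0: "approximated_payoff M X (flat A) Q Y"
    and M: "tame_problem M X A" and Q: "\<And>k. tame_problem (Q k) Y A"
    and sl: "slater (flat A) 1"
    and zs: "zs \<in> dual_minimizers M X A 0"
    and lim: "(\<lambda>k. dual_objective (Q k) Y A 0 zs) \<longlonglongrightarrow> dual_objective M X A 0 zs"
    and lim0: "(\<lambda>k. dual_objective (Q k) Y (flat A) 1 (fst zs, 0)) \<longlonglongrightarrow> dual_objective M X (flat A) 1 (fst zs, 0)"
    and up: "\<And>c. c \<in> \<rat> \<Longrightarrow> \<not> (AE w in M. X w \<le> c) \<Longrightarrow> \<forall>\<^sub>F k in sequentially. \<not> (AE w in Q k. Y w \<le> c)"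
      "\<And>k. AE w in M. X w \<le> fst zs \<Longrightarrow> AE w in Q k. Y w \<le> fst zs"
    and low: "\<And>c. c \<in> \<rat> \<Longrightarrow> \<not> (AE w in M. c \<le> X w) \<Longrightarrow> \<forall>\<^sub>F k in sequentially. \<not> (AE w in Q k. c \<le> Y w)"
      "\<And>k. AE w in M. fst zs \<le> X w \<Longrightarrow> AE w in Q k. fst zs \<le> Y w"
    and "0 < \<eta>"
  shows "\<forall>\<^sub>F k in sequentially. \<forall>z\<in>dual_minimizers (Q k) Y A 0. \<exists>z'\<in>dual_minimizers M X A 0. dist z z' < \<eta>"
proof -
  interpret M: tame_problem M X A by fact
  interpret apx: approximated_payoff M X A Q Y by fact
  interpret apx0: approximated_payoff M X "flat A" Q Y by fact
  interpret flat: dual_problem M X "flat A" ..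
  have zs_l: "0 \<le> snd zs" and zs_exact: "AE w in M. X w - fst zs \<in> exact A (snd zs)"
    and zs0: "(fst zs, 0) \<in> dual_minimizers M X (flat A) 1"
    using zs by (auto simp: M.minimizer_radius_zero_iff multipliers_iff)
  have fin0: "\<bar>dual_objective M X (flat A) 1 (fst zs, 0)\<bar> \<noteq> \<infinity>"
    unfolding dual_objective_finite_iff using M.flat_finite[of "fst zs"] by simp
  have min_flat: "(fst z, 0) \<in> dual_minimizers (Q k) Y (flat A) 1" if "z \<in> dual_minimizers (Q k) Y A 0" for z k
    using that by (simp add: tame_problem.minimizer_radius_zero_iff[OF Q])
  have fin: "\<bar>dual_objective M X A 0 zs\<bar> \<noteq> \<infinity>"
  proof -
    have "(\<integral>\<^sup>+ w. excess A (snd zs) (X w - fst zs) \<partial>M) = (\<integral>\<^sup>+ w. excess (flat A) 0 (X w - fst zs) \<partial>M)"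
      using zs_exact by (intro nn_integral_cong_AE) (auto simp: exact_def)
    then show ?thesis unfolding dual_objective_finite_iff using M.flat_finite[of "fst zs"] by simp
  qed
  \<comment> \<open>Empirical minimizers with multiplier at most \<open>L\<close> lie in a fixed
    box, because their locations are bounded by coercivity of the flat problem. For larger
    multipliers the pair \<open>(\<mu>, snd z)\<close> is a minimizer at distance
    \<open>\<bar>fst z - \<mu>\<bar>\<close>.\<close>
  have reduce: ?thesis
    if ev: "\<forall>\<^sub>F k in sequentially. \<forall>z\<in>dual_minimizers (Q k) Y A 0. \<exists>\<mu>. \<bar>fst z - \<mu>\<bar> < \<eta> \<and> (\<forall>l\<ge>L. (\<mu>, l) \<in> dual_minimizers M X A 0)" for L
  proof -
    obtain R where R: "dual_objective M X (flat A) 1 (fst zs, 0) = ereal R" using fin0 by auto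
    obtain \<rho> where \<rho>: "\<forall>\<^sub>F k in sequentially. \<forall>z\<in>multipliers. \<rho> < norm z \<longrightarrow> ereal (R + 1) < dual_objective (Q k) Y (flat A) 1 z"
      by (rule apx0.eventually_coercive[OF sl])
    have "\<forall>\<^sub>F k in sequentially. dual_objective (Q k) Y (flat A) 1 (fst zs, 0) < ereal (R + 1)"
      using lim0 by (rule order_tendstoD) (use R in simp)
    then show ?thesis
      using ev \<rho> apx.eventually_minimizers_near_bounded[OF zs fin lim bounded_cbox[of "(- \<rho>, 0)" "(\<rho>, L)"] \<open>0 < \<eta>\<close>]
    proof eventually_elim
      case (elim k)
      show ?case
      proof
        fix z assume z: "z \<in> dual_minimizers (Q k) Y A 0"
        show "\<exists>z'\<in>dual_minimizers M X A 0. dist z z' < \<eta>"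
        proof (cases "snd z \<le> L")
          case True
          have "dual_objective (Q k) Y (flat A) 1 (fst z, 0) \<le> dual_objective (Q k) Y (flat A) 1 (fst zs, 0)"
            using min_flat[OF z] by (simp add: flat_minimizer_iff)
          then have "\<not> ereal (R + 1) < dual_objective (Q k) Y (flat A) 1 (fst z, 0)"
            using elim(1) by (meson le_less_trans less_asym)
          then have "\<not> \<rho> < norm (fst z, 0 :: real)" using elim(3) by (auto simp: multipliers_iff)
          then have "\<bar>fst z\<bar> \<le> \<rho>" by (simp add: norm_Pair)
          moreover have "0 \<le> snd z" using z by (simp add: dual_minimizers_iff multipliers_iff)
          ultimately have "z \<in> cbox (- \<rho>, 0) (\<rho>, L)"
            using True by (cases z) (auto simp: cbox_Pair_eq)
          with elim(4) z show ?thesis by blast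
        next
          case False
          obtain \<mu> where \<mu>: "\<bar>fst z - \<mu>\<bar> < \<eta>" "\<forall>l\<ge>L. (\<mu>, l) \<in> dual_minimizers M X A 0"
            using elim(2) z by blast
          have "dist z (\<mu>, snd z) < \<eta>" using \<mu>(1) by (cases z) (simp add: dist_Pair_Pair dist_real_def)
          moreover have "(\<mu>, snd z) \<in> dual_minimizers M X A 0" using \<mu>(2) False by simp
          ultimately show ?thesis by blast
        qed
      qed
    qed
  qed
  have zs_up: "(fst zs, l) \<in> dual_minimizers M X A 0" if "snd zs \<le> l" for l
    using zs_exact zs0 zs_l that M.exact_mono[OF that]
    by (auto simp: M.minimizer_radius_zero_iff multipliers_iff elim!: eventually_mono)
  have edge: ?thesis
    if "\<forall>\<^sub>F k in sequentially. \<forall>z\<in>dual_minimizers (Q k) Y A 0. \<bar>fst z - fst zs\<bar> < \<eta>"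
    using that by (intro reduce[of "snd zs"]) (auto elim!: eventually_mono intro: zs_up)
  show ?thesis
  proof (cases "\<exists>y1\<in>exact A 1. \<exists>y2\<in>exact A 1. 0 < y1 \<and> y2 < 0")
    case False
    then consider "\<And>y. y \<in> exact A 1 \<Longrightarrow> y \<le> 0" | "\<And>y. y \<in> exact A 1 \<Longrightarrow> 0 \<le> y"
      by (meson not_le)
    then show ?thesis
    proof cases
      case 1
      show ?thesis by (rule edge, rule minimizers_near_upper_edge[OF M Q sl 1 zs up \<open>0 < \<eta>\<close>])
    next
      case 2
      show ?thesis by (rule edge, rule minimizers_near_lower_edge[OF M Q sl 2 zs low \<open>0 < \<eta>\<close>])
    qed
  next
    case True
    then obtain y1 y2 where y: "y1 \<in> exact A 1" "y2 \<in> exact A 1" "0 < y1" "y2 < 0" by blast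
    define d where "d = min y1 (- y2)"
    have d: "0 < d" "d \<in> exact A 1" "- d \<in> exact A 1"
      using y M.exact_between[of 1 y1 d] M.exact_between[of 1 y2 "- d"]
      by (auto simp: d_def min_def mult_le_0_iff zero_le_mult_iff)
    obtain D where D: "\<And>z. z \<in> dual_minimizers M X (flat A) 1 \<Longrightarrow> \<bar>fst z\<bar> \<le> D"
      using flat.bounded_fst_minimizers[OF sl zs0 fin0] by blast
    \<comment> \<open>Optimal flat locations differ by at most \<open>2 * D\<close>, and each unit
      of multiplier pays for a shift by \<open>d\<close>.\<close>
    define L where "L = snd zs + 2 * D / d"
    have D0: "\<bar>fst zs\<bar> \<le> D" using D[OF zs0] by simp
    have large: "(\<mu>, l) \<in> dual_minimizers M X A 0"
      if \<mu>: "(\<mu>, 0) \<in> dual_minimizers M X (flat A) 1" and l: "L \<le> l" for \<mu> l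
    proof -
      have "AE w in M. X w - \<mu> \<in> exact A L"
        using zs_exact
      proof eventually_elim
        case (elim w)
        show ?case unfolding L_def
        proof (rule M.exact_shift[OF d _ _ elim])
          show "\<bar>X w - \<mu> - (X w - fst zs)\<bar> \<le> 2 * D / d * d"
            using D[OF \<mu>] D0 d(1) by simp
        qed (use D0 d zs_l in auto)
      qed
      then have "AE w in M. X w - \<mu> \<in> exact A l"
        using M.exact_mono[OF l] by (auto elim!: eventually_mono)
      moreover have "0 \<le> l" using l zs_l D0 d(1) unfolding L_def
        by (meson abs_ge_zero add_nonneg_nonneg divide_nonneg_pos order_trans mult_nonneg_nonneg zero_le_numeral)
      ultimately show ?thesis using \<mu> by (simp add: M.minimizer_radius_zero_iff multipliers_iff)
    qed
    show ?thesis
    proof (rule reduce[of L])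
      show "\<forall>\<^sub>F k in sequentially. \<forall>z\<in>dual_minimizers (Q k) Y A 0.
        \<exists>\<mu>. \<bar>fst z - \<mu>\<bar> < \<eta> \<and> (\<forall>l\<ge>L. (\<mu>, l) \<in> dual_minimizers M X A 0)"
        using apx0.eventually_minimizers_near_slater[OF sl zs0 fin0 lim0 \<open>0 < \<eta>\<close>]
      proof eventually_elim
        case (elim k)
        show ?case
        proof
          fix z assume "z \<in> dual_minimizers (Q k) Y A 0"
          from bspec[OF elim min_flat[OF this]] obtain z' where z': "z' \<in> dual_minimizers M X (flat A) 1"
            "dist (fst z, 0) z' < \<eta>" by blast
          have "\<bar>fst z - fst z'\<bar> < \<eta>"
            using z'(2) dist_fst_le[of "(fst z, 0)" z'] by (simp add: dist_real_def)
          then show "\<exists>\<mu>. \<bar>fst z - \<mu>\<bar> < \<eta> \<and> (\<forall>l\<ge>L. (\<mu>, l) \<in> dual_minimizers M X A 0)"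
            using large flat_minimizer_fst[OF z'(1)] by blast
        qed
      qed
    qed
  qed
qed

section \<open>Values at radius 0\<close>

lemma dual_objective_constant:
  assumes "prob_space M" and [measurable]: "X \<in> borel_measurable M" and c: "AE w in M. X w = c"
  shows "dual_objective M X A \<epsilon> z = ereal (c + snd z * \<epsilon>) + enn2ereal (excess A (snd z) (c - fst z))"
proof -
  interpret prob_space M by fact
  have "(\<integral>\<^sup>+ w. excess A (snd z) (X w - fst z) \<partial>M) = (\<integral>\<^sup>+ w. excess A (snd z) (c - fst z) \<partial>M)"
    using c by (intro nn_integral_cong_AE) auto
  moreover have "(\<integral>w. X w \<partial>M) = (\<integral>w. c \<partial>M)"
    using c by (intro integral_cong_AE) auto
  ultimately show ?thesis by (simp add: dual_objective_def emeasure_space_1 prob_space)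
qed

text \<open>A flat part in \<open>[0, b]\<close> has excess at most \<open>b\<close> times the
  positive part of \<open>X - \<mu>\<close>, which is sent to 0 in the mean by moving the location
  to infinity.\<close>

lemma (in payoff) flat_one_sided_small:
  assumes b: "\<And>a. a \<in> flat A \<Longrightarrow> 0 \<le> fst a \<and> fst a \<le> b" and "0 < e"
  shows "\<exists>\<mu>. (\<integral>\<^sup>+ w. excess (flat A) 0 (X w - \<mu>) \<partial>M) < ennreal e"
proof -
  have "(\<lambda>n. expectation (\<lambda>w. \<bar>b\<bar> * max 0 (X w - real n))) \<longlonglongrightarrow> expectation (\<lambda>w. 0)"
  proof (rule integral_dominated_convergence[where w = "\<lambda>w. \<bar>b\<bar> * \<bar>X w\<bar>"])
    show "AE w in M. (\<lambda>n. \<bar>b\<bar> * max 0 (X w - real n)) \<longlonglongrightarrow> 0"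
    proof (rule AE_I2)
      fix w
      obtain n where "X w < real n" using reals_Archimedean2 by blast
      then have "\<forall>\<^sub>F k in sequentially. \<bar>b\<bar> * max 0 (X w - real k) = 0"
        by (intro eventually_sequentiallyI[of n]) (auto simp: max_def)
      then show "(\<lambda>n. \<bar>b\<bar> * max 0 (X w - real n)) \<longlonglongrightarrow> 0" by (rule tendsto_eventually)
    qed
    show "AE w in M. norm (\<bar>b\<bar> * max 0 (X w - real n)) \<le> \<bar>b\<bar> * \<bar>X w\<bar>" for n
      by (intro AE_I2) (auto simp: abs_mult intro!: mult_left_mono)
  qed (use integrable_payoff in auto)
  then have "\<forall>\<^sub>F n in sequentially. expectation (\<lambda>w. \<bar>b\<bar> * max 0 (X w - real n)) < e"
    by (rule order_tendstoD) (use \<open>0 < e\<close> in simp)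
  then obtain n where n: "expectation (\<lambda>w. \<bar>b\<bar> * max 0 (X w - real n)) < e"
    by (auto simp: eventually_sequentially)
  have "(\<integral>\<^sup>+ w. excess (flat A) 0 (X w - real n) \<partial>M) \<le> (\<integral>\<^sup>+ w. ennreal (\<bar>b\<bar> * max 0 (X w - real n)) \<partial>M)"
  proof (intro nn_integral_mono excess_least)
    fix w a assume "a \<in> flat A"
    from b[OF this] have a: "0 \<le> fst a" "fst a \<le> \<bar>b\<bar>" by linarith+
    have "fst a * (X w - real n) \<le> fst a * max 0 (X w - real n)" using a by (intro mult_left_mono) auto
    also have "\<dots> \<le> \<bar>b\<bar> * max 0 (X w - real n)" using a by (intro mult_right_mono) auto
    finally show "ennreal (fst a * (X w - real n) - 0 * snd a) \<le> ennreal (\<bar>b\<bar> * max 0 (X w - real n))"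
      by (intro ennreal_leI) simp
  qed
  also have "\<dots> = ennreal (expectation (\<lambda>w. \<bar>b\<bar> * max 0 (X w - real n)))"
    using integrable_payoff by (intro nn_integral_eq_integral) auto
  also have "\<dots> < ennreal e" using n \<open>0 < e\<close> by (simp add: ennreal_less_iff integral_nonneg_AE)
  finally show ?thesis by blast
qed

text \<open>Without Slater points the flat part lies on one side of 0, so a remote location makes
  its excess negligible; a large multiplier then brings the true objective close to it.\<close>

lemma (in tame_problem) dual_objective_near_mean:
  assumes "\<not> slater (flat A) 1" and c: "ereal (expectation X) < c"
  shows "\<exists>z\<in>multipliers. dual_objective M X A 0 z < c"
proof -
  obtain b where b: "\<And>a. a \<in> flat A \<Longrightarrow> \<bar>fst a\<bar> \<le> b" using flat_bounded by blast
  obtain d where d: "expectation X < d" "ereal d < c" using ereal_dense2[OF c] by auto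
  define e where "e = d - expectation X"
  have e: "0 < e" using d by (simp add: e_def)
  consider "\<And>a. a \<in> flat A \<Longrightarrow> 0 \<le> fst a" | "\<And>a. a \<in> flat A \<Longrightarrow> fst a \<le> 0"
    using assms(1) unfolding slater_def flat_def by (fastforce simp: not_less)
  then have "\<exists>\<mu>. (\<integral>\<^sup>+ w. excess (flat A) 0 (X w - \<mu>) \<partial>M) < ennreal e"
  proof cases
    case 1
    show ?thesis by (rule flat_one_sided_small[OF _ e, of _ b]) (use 1 b in force)
  next
    case 2
    interpret m: payoff M "\<lambda>w. - X w" by unfold_locales (use integrable_payoff in simp)
    have "0 \<le> fst a \<and> fst a \<le> b" if "a \<in> flat (mirror A)" for a
      using 2[of "(- fst a, snd a)"] b[of "(- fst a, snd a)"] that by (auto simp: flat_def mirror_def)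
    from m.flat_one_sided_small[OF this e] obtain \<mu>
      where "(\<integral>\<^sup>+ w. excess (flat (mirror A)) 0 (- X w - \<mu>) \<partial>M) < ennreal e" by blast
    then show ?thesis by (intro exI[of _ "- \<mu>"]) (simp add: flat_mirror excess_mirror add.commute)
  qed
  then obtain \<mu> where \<mu>: "(\<integral>\<^sup>+ w. excess (flat A) 0 (X w - \<mu>) \<partial>M) < ennreal e" by blast
  have "dual_objective M X (flat A) 1 (\<mu>, 0) \<le> ereal (expectation X) + ereal e"
    using \<mu> e unfolding dual_objective_def
    by (intro add_mono) (auto simp: less_ennreal.rep_eq enn2ereal_ennreal intro: less_imp_le)
  also have "\<dots> < c" using d by (simp add: e_def)
  finally show ?thesis by (rule dual_objective_less_of_flat_less)
qed

text \<open>With Slater's condition the flat problem has the same infimum, is a lower bound and is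
  coercive in the location. Without it the infimum is the mean, a lower bound that the empirical
  objectives have with the sample mean.\<close>

lemma eventually_greater_radius_zero:
  fixes R :: real
  assumes apx: "approximated_payoff M X A Q Y" and apx0: "approximated_payoff M X (flat A) Q Y"
    and M: "tame_problem M X A"
    and R: "ereal R < (INF z\<in>multipliers. dual_objective M X A 0 z)"
  shows "\<forall>\<^sub>F k in sequentially. \<forall>z\<in>multipliers. ereal R < dual_objective (Q k) Y A 0 z"
proof -
  interpret M: tame_problem M X A by fact
  interpret apx: approximated_payoff M X A Q Y by fact
  interpret apx0: approximated_payoff M X "flat A" Q Y by fact
  have notless: "\<not> c < (INF z\<in>multipliers. dual_objective M X A 0 z)"
    if "\<exists>z\<in>multipliers. dual_objective M X A 0 z < c" for c
    using that by (meson INF_lower less_asym less_le_trans le_less_trans)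
  show ?thesis
  proof (cases "slater (flat A) 1")
    case True
    have "ereal R < dual_objective M X (flat A) 1 z" if z: "z \<in> multipliers" for z
    proof -
      have "ereal R < dual_objective M X (flat A) 1 (fst z, 0)"
      proof (rule ccontr)
        assume "\<not> ?thesis"
        then have "dual_objective M X (flat A) 1 (fst z, 0) < (INF z\<in>multipliers. dual_objective M X A 0 z)"
          using R by (simp add: le_less_trans)
        from M.dual_objective_less_of_flat_less[OF this] show False
          by (meson INF_lower not_le)
      qed
      then show ?thesis using z unfolding flat_radius_one[of M X A z]
        by (cases "dual_objective M X (flat A) 1 (fst z, 0)") (auto simp: multipliers_iff)
    qed
    then have "\<forall>\<^sub>F k in sequentially. \<forall>z\<in>multipliers. ereal R < dual_objective (Q k) Y (flat A) 1 z"
      by (rule apx0.eventually_greater_slater[OF True])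
    then show ?thesis
    proof eventually_elim
      case (elim k)
      show ?case
      proof
        fix z :: "real \<times> real" assume "z \<in> multipliers"
        have "ereal R < dual_objective (Q k) Y (flat A) 1 (fst z, 0)"
          using elim by (auto simp: multipliers_iff)
        also have "\<dots> \<le> dual_objective (Q k) Y A 0 z" by (rule flat_le_dual_objective)
        finally show "ereal R < dual_objective (Q k) Y A 0 z" .
      qed
    qed
  next
    case False
    have "R < M.expectation X"
    proof (rule ccontr)
      assume "\<not> ?thesis"
      then have "ereal (M.expectation X) < (INF z\<in>multipliers. dual_objective M X A 0 z)"
        using R by (meson ereal_less_eq(3) le_less_trans not_less)
      from M.dual_objective_near_mean[OF False this] show False by (meson INF_lower not_le)
    qed
    with apx.mean_Q have "\<forall>\<^sub>F k in sequentially. R < (\<integral>w. Y w \<partial>Q k)"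
      by (rule order_tendstoD)
    then show ?thesis
    proof eventually_elim
      case (elim k)
      show ?case
      proof
        fix z :: "real \<times> real"
        show "ereal R < dual_objective (Q k) Y A 0 z"
          using elim payoff.dual_objective_ge_mean[OF apx.payoff_Q, of k z 0 A]
          by (simp add: less_le_trans[of "ereal R" "ereal (\<integral>w. Y w \<partial>Q k)"])
      qed
    qed
  qed
qed

text \<open>The two halves are asymmetric: the lower one is uniform over \<open>Z\<close>, while the
  upper one uses a single near-optimal point for each \<open>\<beta>\<close>.\<close>

lemma INF_tendsto:
  fixes F :: "nat \<Rightarrow> 'z \<Rightarrow> ereal"
  assumes low: "\<And>\<alpha>. ereal \<alpha> < V \<Longrightarrow> \<forall>\<^sub>F k in sequentially. \<forall>z\<in>Z. ereal \<alpha> < F k z"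
    and up: "\<And>\<beta>. V < \<beta> \<Longrightarrow> \<exists>z\<in>Z. \<exists>v<\<beta>. (\<lambda>k. F k z) \<longlonglongrightarrow> v"
  shows "(\<lambda>k. INF z\<in>Z. F k z) \<longlonglongrightarrow> V"
proof (rule order_tendstoI)
  fix a assume "a < V"
  then obtain \<alpha> where \<alpha>: "a < ereal \<alpha>" "ereal \<alpha> < V" using ereal_dense2 by blast
  from low[OF \<alpha>(2)] show "\<forall>\<^sub>F k in sequentially. a < (INF z\<in>Z. F k z)"
  proof eventually_elim
    case (elim k)
    have "ereal \<alpha> \<le> (INF z\<in>Z. F k z)" using elim by (intro INF_greatest) (auto intro: less_imp_le)
    with \<alpha>(1) show ?case by (rule less_le_trans)
  qed
next
  fix a assume "V < a"
  then obtain z v where z: "z \<in> Z" "v < a" "(\<lambda>k. F k z) \<longlonglongrightarrow> v" using up by blast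
  from order_tendstoD(2)[OF z(3,2)] show "\<forall>\<^sub>F k in sequentially. (INF z\<in>Z. F k z) < a"
    by eventually_elim (use z(1) in \<open>auto intro: INF_lower le_less_trans\<close>)
qed

lemma deviation_tendsto_0:
  assumes "\<And>\<eta>. 0 < \<eta> \<Longrightarrow> \<forall>\<^sub>F k in sequentially. \<forall>z\<in>A k. \<exists>z'\<in>B. dist z z' < \<eta>"
  shows "(\<lambda>k. deviation (A k) B) \<longlonglongrightarrow> 0"
proof (rule order_tendstoI)
  fix a :: ennreal assume "0 < a"
  then obtain \<eta> where \<eta>: "0 < \<eta>" "ennreal \<eta> < a"
    by (metis dense ennreal_cases ennreal_less_zero_iff less_top_ennreal infinity_ennreal_def order_less_trans top_greatest not_less)
  from assms[OF \<eta>(1)] show "\<forall>\<^sub>F k in sequentially. deviation (A k) B < a"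
  proof eventually_elim
    case (elim k)
    have "deviation (A k) B \<le> ennreal \<eta>"
      unfolding deviation_def
    proof (rule SUP_least)
      fix z assume "z \<in> A k"
      then obtain z' where "z' \<in> B" "dist z z' < \<eta>" using elim by blast
      then show "(INF z'\<in>B. ennreal (norm (z - z'))) \<le> ennreal \<eta>"
        by (intro INF_lower2[of z'] ennreal_leI) (auto simp: dist_norm)
    qed
    with \<eta>(2) show ?case by simp
  qed
qed simp

section \<open>Divergence functions\<close>

definition perturbations :: "(real \<Rightarrow> ereal) \<Rightarrow> (real \<times> real) set" where
  "perturbations \<phi> = {(s, r). \<phi> (1 + s) \<le> ereal r}"

locale divergence =
  fixes \<phi> :: "real \<Rightarrow> ereal"
  assumes divergence: "divergence_fun \<phi>" and disutility: "risk_averse_disutility (fenchel \<phi>)"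
    and finite_disutility: "\<exists>t>0. fenchel \<phi> t < \<infinity>"
begin

abbreviation "A \<equiv> perturbations \<phi>"

lemma phi_nonneg: "0 \<le> \<phi> t" and phi_one: "\<phi> 1 = 0" and phi_neg: "t < 0 \<Longrightarrow> \<phi> t = \<infinity>"
  using divergence by (auto simp: divergence_fun_def)

lemma perturbations_ge: "(s, r) \<in> A \<Longrightarrow> - 1 \<le> s"
  using phi_neg[of "1 + s"] by (force simp: perturbations_def)

sublocale perturbation_set A
proof
  have eq: "A = (\<lambda>a. (1, 0) + a) -` epi \<phi>"
    by (auto simp: perturbations_def epi_def)
  have "closed (epi \<phi>)" using divergence by (auto simp: divergence_fun_def closed_fun_def)
  then have "closed ((\<lambda>a. (1, 0) + a) -` epi \<phi>)"
    by (intro closed_vimage continuous_intros)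
  then show "closed A" by (simp add: eq)
  have "convex (epi \<phi>)" using divergence by (auto simp: divergence_fun_def convex_fun_def)
  moreover have "A = (\<lambda>x. (-1, 0) + x) ` epi \<phi>"
  proof (intro equalityI subsetI)
    fix a assume "a \<in> A"
    then have "(1, 0) + a \<in> epi \<phi>" "a = (-1, 0) + ((1, 0) + a)" by (auto simp: eq prod_eq_iff)
    then show "a \<in> (\<lambda>x. (-1, 0) + x) ` epi \<phi>" by blast
  qed (auto simp: perturbations_def epi_def)
  ultimately show "convex A" by (simp add: convex_translation)
  show "(0, 0) \<in> A" by (simp add: perturbations_def phi_one)
  show "0 \<le> snd a" if "a \<in> A" for a
    using that phi_nonneg[of "1 + fst a"] order_trans[of 0 "\<phi> (1 + fst a)" "ereal (snd a)"]
    by (auto simp: perturbations_def split: prod.splits)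
qed

text \<open>Substituting \<open>t = 1 + s\<close> splits off \<open>y\<close>. Passing from the
  graph to the epigraph changes nothing because \<open>l\<close> is nonnegative, and points with
  infinite \<open>\<phi>\<close> drop out even at \<open>l = 0\<close> by the convention in
  \<open>scale_fun\<close>.\<close>

lemma fenchel_scale_eq:
  assumes "0 \<le> l"
  shows "fenchel (scale_fun l \<phi>) y = ereal y + enn2ereal (excess A l y)"
proof (rule antisym)
  show "fenchel (scale_fun l \<phi>) y \<le> ereal y + enn2ereal (excess A l y)"
    unfolding fenchel_def
  proof (rule SUP_least)
    fix t
    show "ereal (t * y) - scale_fun l \<phi> t \<le> ereal y + enn2ereal (excess A l y)"
    proof (cases "\<phi> t")
      case (real q)
      then have "(t - 1, q) \<in> A" by (simp add: perturbations_def)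
      from excess_upper[OF this, of y l]
      have "enn2ereal (ennreal ((t - 1) * y - l * q)) \<le> enn2ereal (excess A l y)"
        by (simp add: less_eq_ennreal.rep_eq)
      moreover have "ereal ((t - 1) * y - l * q) \<le> enn2ereal (ennreal ((t - 1) * y - l * q))"
        by (cases "0 \<le> (t - 1) * y - l * q") (auto simp: enn2ereal_ennreal ennreal_neg zero_ennreal.rep_eq)
      ultimately have "ereal ((t - 1) * y - l * q) \<le> enn2ereal (excess A l y)" by (rule order_trans[rotated])
      then have "ereal y + ereal ((t - 1) * y - l * q) \<le> ereal y + enn2ereal (excess A l y)"
        by (rule add_left_mono)
      then show ?thesis using real by (simp add: scale_fun_def algebra_simps)
    next
      case PInf
      then show ?thesis by (simp add: scale_fun_def)
    next
      case MInf
      then show ?thesis using phi_nonneg[of t] by simp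
    qed
  qed
  have mem: "ereal ((1 + s) * y - l * r) \<le> fenchel (scale_fun l \<phi>) y" if sr: "(s, r) \<in> A" for s r
  proof -
    obtain q where q: "\<phi> (1 + s) = ereal q" "q \<le> r"
      using sr phi_nonneg[of "1 + s"] by (cases "\<phi> (1 + s)") (auto simp: perturbations_def)
    have "ereal ((1 + s) * y - l * r) \<le> ereal ((1 + s) * y) - scale_fun l \<phi> (1 + s)"
      using q assms by (simp add: scale_fun_def mult_left_mono)
    also have "\<dots> \<le> fenchel (scale_fun l \<phi>) y" unfolding fenchel_def by (rule SUP_upper) simp
    finally show ?thesis .
  qed
  \<comment> \<open>The choice \<open>t = 1\<close> makes the conjugate at least \<open>y\<close>,
    which is why the cut at 0 in \<open>excess\<close> is harmless.\<close>
  have "ereal y \<le> fenchel (scale_fun l \<phi>) y" using mem[OF zero] by simp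
  then consider F where "fenchel (scale_fun l \<phi>) y = ereal F" "y \<le> F" | "fenchel (scale_fun l \<phi>) y = \<infinity>"
    by (cases "fenchel (scale_fun l \<phi>) y") auto
  then show "ereal y + enn2ereal (excess A l y) \<le> fenchel (scale_fun l \<phi>) y"
  proof cases
    case 1
    have "excess A l y \<le> ennreal (F - y)"
    proof (rule excess_least)
      fix a assume "a \<in> A"
      then show "ennreal (fst a * y - l * snd a) \<le> ennreal (F - y)"
        using mem[of "fst a" "snd a"] 1 by (intro ennreal_leI) (auto simp: algebra_simps)
    qed
    then have "enn2ereal (excess A l y) \<le> ereal (F - y)"
      using 1(2) by (simp add: less_eq_ennreal.rep_eq enn2ereal_ennreal)
    from add_left_mono[OF this, of "ereal y"] show ?thesis using 1 by simp
  qed simp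
qed

lemma fenchel_eq: "fenchel \<phi> y = ereal y + enn2ereal (excess A 1 y)"
proof -
  have "scale_fun 1 \<phi> = \<phi>" by (auto simp: scale_fun_def one_ereal_def[symmetric])
  then show ?thesis using fenchel_scale_eq[of 1 y] by simp
qed

text \<open>Raising the multiplier to \<open>m \<ge> 1\<close> keeps the excess 0, and homogeneity
  rescales \<open>m\<close> to 1. There the excess is \<open>v(x) - x\<close>, which by risk
  aversion vanishes only at 0.\<close>

lemma excess_eq_0:
  assumes "excess A l y = 0"
  shows "y = 0"
proof -
  define m where "m = max l 1"
  have m: "0 < m" "l \<le> m" by (auto simp: m_def)
  have "excess A (m * 1) (m * (y / m)) = 0"
    using excess_antimono[OF m(2), of y] assms m(1) by simp
  then have "excess A 1 (y / m) = 0"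
    using m(1) by (subst (asm) excess_scale) (auto simp: ennreal_eq_0_iff)
  then have "fenchel \<phi> (y / m) = ereal (y / m)"
    by (simp add: fenchel_eq zero_ennreal.rep_eq)
  then show "y = 0" using disutility m(1) by (auto simp: risk_averse_disutility_def)
qed

text \<open>If every \<open>s * y\<close> were nonpositive on \<open>A\<close>, the excess at
  \<open>y\<close> would vanish, contrary to \<open>excess_eq_0\<close>; hence both signs of
  \<open>s\<close> occur. Contracting towards the origin keeps the sign and makes the cost smaller
  than \<open>\<epsilon>\<close>.\<close>

lemma slater_perturbations:
  assumes "0 < \<epsilon>"
  shows "slater A \<epsilon>"
proof -
  have shrink: "\<exists>c>0. (c * s, c * r) \<in> A \<and> c * r < \<epsilon>" if "(s, r) \<in> A" for s r
  proof -
    have r: "0 \<le> r" using nonneg[OF that] by simp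
    \<comment> \<open>Gives \<open>c * r \<le> \<epsilon> / 2\<close>; the summand 1 covers
      \<open>r = 0\<close>.\<close>
    define c where "c = min 1 (\<epsilon> / (2 * (r + 1)))"
    have c: "0 < c" "c \<le> 1" using assms r by (auto simp: c_def)
    have "c *\<^sub>R (s, r) + (1 - c) *\<^sub>R (0, 0) \<in> A"
      using c by (intro convexD[OF convex that zero]) auto
    moreover have "c * r < \<epsilon>"
    proof -
      have "c * r \<le> \<epsilon> / (2 * (r + 1)) * (r + 1)"
        using r assms by (intro mult_mono) (auto simp: c_def)
      also have "\<dots> = \<epsilon> / 2" using r by (simp add: field_simps)
      also have "\<dots> < \<epsilon>" using assms by simp
      finally show ?thesis .
    qed
    ultimately show ?thesis using c(1) by auto
  qed
  have "\<exists>s r. (s, r) \<in> A \<and> 0 < s * y" if "y \<noteq> 0" for y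
  proof (rule ccontr)
    assume *: "\<not> ?thesis"
    have "excess A 1 y \<le> 0"
    proof (rule excess_least)
      fix a assume "a \<in> A"
      then have "(fst a, snd a) \<in> A" by simp
      then have "fst a * y \<le> 0" "0 \<le> snd a" using * nonneg[OF \<open>a \<in> A\<close>] not_less by blast+
      then show "ennreal (fst a * y - 1 * snd a) \<le> 0" by (simp add: ennreal_neg)
    qed
    then have "excess A 1 y = 0" by simp
    from excess_eq_0[OF this] that show False by simp
  qed
  from this[of 1] this[of "-1"] obtain s1 r1 s2 r2 where
    s: "(s1, r1) \<in> A" "s1 < 0" "(s2, r2) \<in> A" "0 < s2" by auto
  obtain c1 c2 where "0 < c1" "(c1 * s1, c1 * r1) \<in> A" "c1 * r1 < \<epsilon>" "0 < c2" "(c2 * s2, c2 * r2) \<in> A" "c2 * r2 < \<epsilon>"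
    using shrink[OF s(1)] shrink[OF s(3)] by blast
  then show ?thesis unfolding slater_def using s
    by (intro exI[of _ "c1 * s1"] exI[of _ "c1 * r1"] exI[of _ "c2 * s2"] exI[of _ "c2 * r2"])
      (auto simp: mult_pos_neg)
qed

text \<open>At zero cost the Fenchel-Young inequality reads \<open>s * t \<le> v(t) - t\<close>,
  which bounds \<open>s\<close> above when \<open>v(t)\<close> is finite; below,
  \<open>s \<ge> - 1\<close> because densities are nonnegative.\<close>

lemma flat_perturbations_bounded: "\<exists>b. \<forall>a\<in>flat A. \<bar>fst a\<bar> \<le> b"
proof -
  obtain t where t: "0 < t" "fenchel \<phi> t < \<infinity>" using finite_disutility by blast
  obtain F where F: "excess A 1 t = ennreal F" "0 \<le> F"
    using t(2) by (cases "excess A 1 t") (auto simp: fenchel_eq top_ennreal.rep_eq top_ereal_def)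
  have "\<bar>fst a\<bar> \<le> max 1 (F / t)" if a: "a \<in> flat A" for a
  proof -
    have "ennreal (fst a * t) \<le> ennreal F"
      using excess_upper[of a A t 1] a F by (auto simp: flat_def)
    then have "fst a * t \<le> F" using F(2) by (simp add: ennreal_le_iff)
    then have "fst a \<le> F / t" using t(1) by (simp add: pos_le_divide_eq)
    moreover have "- 1 \<le> fst a" using perturbations_ge[of "fst a" "snd a"] a by (simp add: flat_def)
    ultimately show ?thesis by linarith
  qed
  then show ?thesis by blast
qed

lemma phi_measurable[measurable]: "\<phi> \<in> borel_measurable borel"
  unfolding borel_measurable_iff_Iic_ereal
proof
  fix a :: ereal
  show "\<phi> -` {..a} \<inter> space borel \<in> sets borel"
  proof (cases a)
    case (real r)
    have "closed ((\<lambda>t. (t - 1, r)) -` A)"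
      by (intro closed_vimage closed continuous_intros)
    moreover have "(\<lambda>t. (t - 1, r)) -` A = \<phi> -` {..a}" using real by (auto simp: perturbations_def)
    ultimately show ?thesis by simp
  next
    case PInf
    then have "\<phi> -` {..a} = UNIV" by auto
    then show ?thesis by simp
  next
    case MInf
    then have "\<phi> -` {..a} = {}" using phi_nonneg by (auto simp: ereal_infty_less_eq)
    then show ?thesis by simp
  qed
qed

text \<open>The half conjugate of \<open>v\<close> is at most \<open>\<phi>\<close> on the
  nonnegative half-line, by Fenchel-Young, and outside it \<open>\<phi>\<close> is infinite and
  contributes nothing. Conjugating again reverses the inequality.\<close>

lemma fenchel_le_half_conj: "fenchel \<phi> x \<le> half_conj (half_conj (fenchel \<phi>)) x"
  unfolding fenchel_def[of \<phi> x]
proof (rule SUP_least)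
  fix t
  show "ereal (t * x) - \<phi> t \<le> half_conj (half_conj (fenchel \<phi>)) x"
  proof (cases "0 \<le> t")
    case True
    have "half_conj (fenchel \<phi>) t \<le> \<phi> t"
      unfolding half_conj_def
    proof (rule SUP_least)
      fix u
      have "ereal (t * u) - \<phi> t \<le> fenchel \<phi> u"
        unfolding fenchel_def by (rule SUP_upper) simp
      then show "ereal (u * t) - fenchel \<phi> u \<le> \<phi> t"
        using phi_nonneg[of t] by (cases "\<phi> t"; cases "fenchel \<phi> u") (auto simp: mult.commute)
    qed
    then have "ereal (t * x) - \<phi> t \<le> ereal (t * x) - half_conj (fenchel \<phi>) t"
      by (rule ereal_minus_mono[OF order_refl])
    also have "\<dots> \<le> half_conj (half_conj (fenchel \<phi>)) x"
      unfolding half_conj_def[of "half_conj (fenchel \<phi>)"] using True by (intro SUP_upper) simp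
    finally show ?thesis .
  qed (simp add: phi_neg)
qed

text \<open>The Orlicz function dominates \<open>v(y) = y + excess A 1 y\<close> for nonnegative
  \<open>y\<close>, so one finite integral controls the absolute moment and the excess. By
  homogeneity the Orlicz scale \<open>a\<close> becomes the multiplier.\<close>

lemma orlicz_payoff:
  assumes "prob_space M" and X: "X \<in> orlicz M (half_conj (half_conj (fenchel \<phi>)))"
  shows "integrable M X" "\<exists>a. (\<integral>\<^sup>+ w. excess A a (X w) \<partial>M) < \<infinity>"
proof -
  interpret prob_space M by fact
  let ?g = "half_conj (half_conj (fenchel \<phi>))"
  obtain a where a: "0 < a" "expect M (\<lambda>w. ?g \<bar>X w / a\<bar>) < \<infinity>" and [measurable]: "X \<in> borel_measurable M"
    using X by (auto simp: orlicz_def)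
  let ?Y = "\<lambda>w. \<bar>X w / a\<bar>"
  have le: "ennreal y + excess A 1 y \<le> e2ennreal (?g y)" "0 \<le> ?g y" if "0 \<le> y" for y
  proof -
    have "ereal y + enn2ereal (excess A 1 y) \<le> ?g y"
      using fenchel_le_half_conj[of y] by (simp add: fenchel_eq)
    moreover have "ereal y + enn2ereal (excess A 1 y) = enn2ereal (ennreal y + excess A 1 y)"
      using that by (simp add: plus_ennreal.rep_eq enn2ereal_ennreal)
    ultimately have *: "enn2ereal (ennreal y + excess A 1 y) \<le> ?g y" by simp
    from e2ennreal_mono[OF this] show "ennreal y + excess A 1 y \<le> e2ennreal (?g y)" by simp
    from * show "0 \<le> ?g y" using enn2ereal_nonneg order_trans by blast
  qed
  have "(\<integral>\<^sup>+ w. e2ennreal (- ?g (?Y w)) \<partial>M) = (\<integral>\<^sup>+ w. 0 \<partial>M)"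
    using le(2) by (intro nn_integral_cong e2ennreal_neg) simp
  then have "(\<integral>\<^sup>+ w. e2ennreal (?g (?Y w)) \<partial>M) \<noteq> \<infinity>"
    using a(2) by (auto simp: expect_def zero_ennreal.rep_eq top_ennreal.rep_eq top_ereal_def)
  then have I: "(\<integral>\<^sup>+ w. e2ennreal (?g (?Y w)) \<partial>M) < \<infinity>" by (simp only: less_top infinity_ennreal_def)
  have "(\<integral>\<^sup>+ w. ennreal (?Y w) \<partial>M) + (\<integral>\<^sup>+ w. excess A 1 (?Y w) \<partial>M) = (\<integral>\<^sup>+ w. ennreal (?Y w) + excess A 1 (?Y w) \<partial>M)"
    by (intro nn_integral_add[symmetric]) measurable
  also have "\<dots> \<le> (\<integral>\<^sup>+ w. e2ennreal (?g (?Y w)) \<partial>M)"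
    using le(1) by (intro nn_integral_mono) simp
  also note I
  finally have "(\<integral>\<^sup>+ w. ennreal (?Y w) \<partial>M) + (\<integral>\<^sup>+ w. excess A 1 (?Y w) \<partial>M) < \<infinity>" .
  then have fin: "(\<integral>\<^sup>+ w. ennreal (?Y w) \<partial>M) < \<infinity>" "(\<integral>\<^sup>+ w. excess A 1 (?Y w) \<partial>M) < \<infinity>"
    by (simp_all only: infinity_ennreal_def ennreal_add_less_top)
  have "integrable M (\<lambda>w. X w / a)"
    using fin(1) by (intro integrableI_bounded) auto
  then have "integrable M (\<lambda>w. a * (X w / a))" by (rule integrable_mult_right)
  then show "integrable M X" using a(1) by simp
  \<comment> \<open>The Orlicz condition only sees absolute values; for negative \<open>y\<close>
    the constraint \<open>s \<ge> - 1\<close> gives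
    \<open>s * y \<le> \<bar>y\<bar>\<close>.\<close>
  have abs: "excess A 1 y \<le> excess A 1 \<bar>y\<bar> + ennreal \<bar>y\<bar>" for y
  proof (rule excess_least)
    fix p assume p: "p \<in> A"
    have "- 1 \<le> fst p" using perturbations_ge[of "fst p" "snd p"] p by simp
    then have "(1 + fst p) * y \<le> (1 + fst p) * \<bar>y\<bar>" by (intro mult_left_mono) auto
    moreover have "- y \<le> \<bar>y\<bar>" by simp
    ultimately have "fst p * y - 1 * snd p \<le> (fst p * \<bar>y\<bar> - 1 * snd p) + 2 * \<bar>y\<bar>"
      by (simp add: algebra_simps)
    show "ennreal (fst p * y - 1 * snd p) \<le> excess A 1 \<bar>y\<bar> + ennreal \<bar>y\<bar>"
    proof (cases "0 \<le> y")
      case True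
      then show ?thesis using excess_upper[OF p, of y 1] by (simp add: add_increasing2)
    next
      case False
      have "fst p * y - 1 * snd p \<le> \<bar>y\<bar>"
        using mult_right_mono_neg[OF \<open>- 1 \<le> fst p\<close>, of y] False nonneg[OF p] by simp
      then show ?thesis by (intro add_increasing ennreal_leI) auto
    qed
  qed
  have "(\<integral>\<^sup>+ w. excess A a (X w) \<partial>M) = (\<integral>\<^sup>+ w. ennreal a * excess A 1 (X w / a) \<partial>M)"
    using excess_scale[of a A 1] a(1) by (intro nn_integral_cong) (metis less_imp_le less_irrefl mult.right_neutral nonzero_mult_div_cancel_left times_divide_eq_right)
  also have "\<dots> = ennreal a * (\<integral>\<^sup>+ w. excess A 1 (X w / a) \<partial>M)"
    by (intro nn_integral_cmult) measurable
  also have "\<dots> \<le> ennreal a * (\<integral>\<^sup>+ w. excess A 1 (?Y w) + ennreal (?Y w) \<partial>M)"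
    by (intro mult_left_mono nn_integral_mono abs) auto
  also have "(\<integral>\<^sup>+ w. excess A 1 (?Y w) + ennreal (?Y w) \<partial>M) = (\<integral>\<^sup>+ w. excess A 1 (?Y w) \<partial>M) + (\<integral>\<^sup>+ w. ennreal (?Y w) \<partial>M)"
    by (intro nn_integral_add) measurable
  also have "ennreal a * \<dots> < \<infinity>" using fin by (simp add: ennreal_mult_less_top)
  finally show "\<exists>a. (\<integral>\<^sup>+ w. excess A a (X w) \<partial>M) < \<infinity>" by blast
qed

lemma cgvi_objective_eq:
  assumes "payoff M X" and z: "z \<in> multipliers"
  shows "cgvi_objective M \<phi> \<epsilon> X z = dual_objective M X A \<epsilon> z"
proof -
  interpret payoff M X by fact
  obtain \<mu> l where [simp]: "z = (\<mu>, l)" by (cases z)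
  have l: "0 \<le> l" using z by (simp add: multipliers_def)
  have "expect M (\<lambda>w. fenchel (scale_fun l \<phi>) (X w - \<mu>)) = ereal (expectation (\<lambda>w. X w - \<mu>)) + enn2ereal (\<integral>\<^sup>+ w. excess A l (X w - \<mu>) \<partial>M)"
    unfolding fenchel_scale_eq[OF l] using integrable_payoff
    by (intro expect_ereal_plus_ennreal) auto
  moreover have "expectation (\<lambda>w. X w - \<mu>) = expectation X - \<mu>"
    using integrable_payoff by (simp add: prob_space)
  ultimately show ?thesis
    by (simp add: cgvi_objective_def dual_objective_def add.assoc[symmetric] algebra_simps)
qed

end

section \<open>Densities and the primal value\<close>

lemma expect_nonneg:
  assumes "\<And>w. w \<in> space M \<Longrightarrow> 0 \<le> f w"
  shows "expect M f = enn2ereal (\<integral>\<^sup>+ w. e2ennreal (f w) \<partial>M)"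
proof -
  have "(\<integral>\<^sup>+ w. e2ennreal (- f w) \<partial>M) = (\<integral>\<^sup>+ w. 0 \<partial>M)"
    using assms by (intro nn_integral_cong e2ennreal_neg) simp
  then show ?thesis by (simp add: expect_def zero_ennreal.rep_eq)
qed

lemma expect_cong_AE:
  assumes "AE w in M. f w = g w"
  shows "expect M f = expect M g"
proof -
  have "(\<integral>\<^sup>+ w. e2ennreal (f w) \<partial>M) = (\<integral>\<^sup>+ w. e2ennreal (g w) \<partial>M)"
    "(\<integral>\<^sup>+ w. e2ennreal (- f w) \<partial>M) = (\<integral>\<^sup>+ w. e2ennreal (- g w) \<partial>M)"
    using assms by (auto intro!: nn_integral_cong_AE elim!: eventually_mono)
  then show ?thesis by (simp add: expect_def)
qed

lemma real_of_finite_expect: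
  assumes [measurable]: "f \<in> borel_measurable M" and "\<And>w. w \<in> space M \<Longrightarrow> 0 \<le> f w"
    and "expect M f \<le> ereal c"
  shows "AE w in M. f w = ereal (real_of_ereal (f w))" "integrable M (\<lambda>w. real_of_ereal (f w))"
    "ereal (\<integral>w. real_of_ereal (f w) \<partial>M) = expect M f"
proof -
  have e: "expect M f = enn2ereal (\<integral>\<^sup>+ w. e2ennreal (f w) \<partial>M)" by (rule expect_nonneg) fact
  then have fin: "(\<integral>\<^sup>+ w. e2ennreal (f w) \<partial>M) \<noteq> \<infinity>"
    using assms(3) by (auto simp: top_ennreal.rep_eq top_ereal_def)
  then have "AE w in M. e2ennreal (f w) \<noteq> \<infinity>" by (intro nn_integral_PInf_AE) auto
  with AE_space show ae: "AE w in M. f w = ereal (real_of_ereal (f w))"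
  proof eventually_elim
    case (elim w)
    then show ?case using assms(2)[of w] by (cases "f w") (auto simp: e2ennreal_infty)
  qed
  have eq: "(\<integral>\<^sup>+ w. ennreal (real_of_ereal (f w)) \<partial>M) = (\<integral>\<^sup>+ w. e2ennreal (f w) \<partial>M)"
  proof (rule nn_integral_cong_AE)
    show "AE w in M. ennreal (real_of_ereal (f w)) = e2ennreal (f w)"
      using ae by eventually_elim (metis e2ennreal_ereal(1))
  qed
  obtain v where v: "0 \<le> v" "(\<integral>\<^sup>+ w. e2ennreal (f w) \<partial>M) = ennreal v" using fin by (cases "\<integral>\<^sup>+ w. e2ennreal (f w) \<partial>M") auto
  have nn: "AE w in M. 0 \<le> real_of_ereal (f w)"
    using assms(2) by (intro AE_I2) (simp add: real_of_ereal_pos)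
  show int: "integrable M (\<lambda>w. real_of_ereal (f w))"
    by (rule integrableI_nn_integral_finite[OF _ nn]) (use eq v in auto)
  have "(\<integral>w. real_of_ereal (f w) \<partial>M) = v"
    using eq v nn by (intro integral_eq_nn_integral[THEN trans]) auto
  then show "ereal (\<integral>w. real_of_ereal (f w) \<partial>M) = expect M f" using e v by (simp add: enn2ereal_ennreal)
qed

context divergence
begin

lemma cgvi_value_le:
  assumes "payoff M X" and z: "z \<in> multipliers"
  shows "cgvi_value M \<phi> \<epsilon> X \<le> dual_objective M X A \<epsilon> z"
  unfolding cgvi_value_def
proof (rule SUP_least)
  interpret dual_problem M X A using assms(1) by (simp add: dual_problem_def perturbation_set_axioms)
  fix p assume "p \<in> {p \<in> densities M. expect M (\<lambda>w. \<phi> (real_of_ereal (p w))) \<le> ereal \<epsilon>}"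
  then have p[measurable]: "p \<in> borel_measurable M" and pos: "\<And>w. w \<in> space M \<Longrightarrow> 0 \<le> p w"
    and one: "expect M p = 1" and le: "expect M (\<lambda>w. \<phi> (real_of_ereal (p w))) \<le> ereal \<epsilon>"
    by (auto simp: densities_def)
  have one': "expect M p \<le> ereal 1" using one by (simp add: one_ereal_def)
  have p': "AE w in M. p w = ereal (real_of_ereal (p w))" "integrable M (\<lambda>w. real_of_ereal (p w))"
    "ereal (\<integral>w. real_of_ereal (p w) \<partial>M) = expect M p"
    using real_of_finite_expect[OF p _ one'] pos by blast+
  have phi: "(\<lambda>w. \<phi> (real_of_ereal (p w))) \<in> borel_measurable M" by measurable
  note r' = real_of_finite_expect[OF phi phi_nonneg le]
  \<comment> \<open>A density enters weak duality through \<open>s = p - 1\<close> and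
    \<open>r = \<phi>(p)\<close>, both finite almost everywhere.\<close>
  have "expect M (\<lambda>w. ereal ((1 + (real_of_ereal (p w) - 1)) * X w)) \<le> dual_objective M X A \<epsilon> z"
  proof (rule weak_duality)
    show "integrable M (\<lambda>w. real_of_ereal (p w) - 1)" using p'(2) by simp
    show "expectation (\<lambda>w. real_of_ereal (p w) - 1) = 0"
      using p'(2,3) one by (simp add: prob_space one_ereal_def)
    show "integrable M (\<lambda>w. real_of_ereal (\<phi> (real_of_ereal (p w))))" by (rule r'(2))
    show "expectation (\<lambda>w. real_of_ereal (\<phi> (real_of_ereal (p w)))) \<le> \<epsilon>"
      using r'(3) le by (metis ereal_less_eq(3))
    show "AE w in M. (real_of_ereal (p w) - 1, real_of_ereal (\<phi> (real_of_ereal (p w)))) \<in> A"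
      using r'(1)
    proof eventually_elim
      case (elim w)
      show ?case by (simp add: perturbations_def elim[symmetric])
    qed
  qed fact
  moreover have "expect M (\<lambda>w. p w * ereal (X w)) = expect M (\<lambda>w. ereal ((1 + (real_of_ereal (p w) - 1)) * X w))"
  proof (rule expect_cong_AE)
    show "AE w in M. p w * ereal (X w) = ereal ((1 + (real_of_ereal (p w) - 1)) * X w)"
      using p'(1)
    proof eventually_elim
      case (elim w)
      show ?case by (subst elim) simp
    qed
  qed
  ultimately show "expect M (\<lambda>w. p w * ereal (X w)) \<le> dual_objective M X A \<epsilon> z" by simp
qed

text \<open>A simple function into \<open>A\<close> yields the density \<open>1 + s\<close> with
  \<open>\<phi>(1 + s) \<le> r\<close>; these are the competitors in
  \<open>strong_duality\<close>.\<close>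

lemma cgvi_value_ge_simple:
  assumes "payoff M X" and f: "simple_function M f" "\<And>w. w \<in> space M \<Longrightarrow> f w \<in> A"
    and E: "(\<integral>w. fst (f w) \<partial>M) = 0" "(\<integral>w. snd (f w) \<partial>M) \<le> \<epsilon>"
  shows "ereal (\<integral>w. X w + fst (f w) * X w \<partial>M) \<le> cgvi_value M \<phi> \<epsilon> X"
proof -
  interpret payoff M X by fact
  have sf: "simple_function M (\<lambda>w. fst (f w))" "simple_function M (\<lambda>w. snd (f w))"
    using f(1) by (auto intro: simple_function_compose1)
  have [measurable]: "(\<lambda>w. fst (f w)) \<in> borel_measurable M" "(\<lambda>w. snd (f w)) \<in> borel_measurable M"
    using sf by (auto intro: borel_measurable_simple_function)
  define p where "p w = ereal (1 + fst (f w))" for w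
  have "p \<in> densities M"
    unfolding densities_def
  proof (intro CollectI conjI ballI)
    show "p \<in> borel_measurable M" unfolding p_def[abs_def] by measurable
    show "0 \<le> p w" if "w \<in> space M" for w
      using perturbations_ge[of "fst (f w)" "snd (f w)"] f(2)[OF that] by (simp add: p_def)
    show "expect M p = 1"
      unfolding p_def[abs_def] using simple_function_integrable(1)[OF sf(1)] E(1)
      by (subst expect_ereal) (auto simp: prob_space one_ereal_def)
  qed
  moreover have "expect M (\<lambda>w. \<phi> (real_of_ereal (p w))) \<le> ereal \<epsilon>"
  proof -
    have "expect M (\<lambda>w. \<phi> (real_of_ereal (p w))) = enn2ereal (\<integral>\<^sup>+ w. e2ennreal (\<phi> (1 + fst (f w))) \<partial>M)"
      by (subst expect_nonneg) (auto simp: phi_nonneg p_def)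
    also have "\<dots> \<le> enn2ereal (\<integral>\<^sup>+ w. ennreal (snd (f w)) \<partial>M)"
      unfolding less_eq_ennreal.rep_eq[symmetric]
    proof (rule nn_integral_mono)
      fix w assume "w \<in> space M"
      then have "\<phi> (1 + fst (f w)) \<le> ereal (snd (f w))"
        using f(2)[of w] by (auto simp: perturbations_def split: prod.splits)
      from e2ennreal_mono[OF this] show "e2ennreal (\<phi> (1 + fst (f w))) \<le> ennreal (snd (f w))"
        by (simp add: e2ennreal_ereal)
    qed
    also have "(\<integral>\<^sup>+ w. ennreal (snd (f w)) \<partial>M) = ennreal (expectation (\<lambda>w. snd (f w)))"
      using f(2) nonneg by (intro nn_integral_eq_integral simple_function_integrable(1)[OF sf(2)] AE_I2) auto
    also have "enn2ereal \<dots> = ereal (expectation (\<lambda>w. snd (f w)))"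
      using f(2) nonneg by (intro enn2ereal_ennreal integral_nonneg_AE AE_I2) auto
    also have "\<dots> \<le> ereal \<epsilon>" using E(2) by simp
    finally show ?thesis .
  qed
  ultimately have "expect M (\<lambda>w. p w * ereal (X w)) \<le> cgvi_value M \<phi> \<epsilon> X"
    unfolding cgvi_value_def by (intro SUP_upper) simp
  moreover have "expect M (\<lambda>w. p w * ereal (X w)) = ereal (expectation (\<lambda>w. X w + fst (f w) * X w))"
    using simple_function_integrable(2)[OF sf(1)] integrable_payoff
    unfolding p_def times_ereal.simps by (subst expect_ereal) (auto simp: distrib_right)
  ultimately show ?thesis by simp
qed

end

section \<open>Duality at every radius\<close>

locale cgvi_problem = divergence \<phi> + tame_problem M X "perturbations \<phi>"
  for \<phi> and M :: "'a measure" and X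
begin

lemma payoff_MX: "payoff M X" ..

lemma mean_le_cgvi_value:
  assumes "0 \<le> \<epsilon>"
  shows "ereal (expectation X) \<le> cgvi_value M \<phi> \<epsilon> X"
  using cgvi_value_ge_simple[OF payoff_MX, of "\<lambda>_. (0, 0)" \<epsilon>] zero assms by simp

lemma cgvi_value_finite:
  assumes "0 \<le> \<epsilon>"
  obtains V where "cgvi_value M \<phi> \<epsilon> X = ereal V"
proof -
  obtain l where l: "0 \<le> l" "(\<integral>\<^sup>+ w. excess A l (X w - 0) \<partial>M) < \<infinity>" using finite_excess_at by blast
  then have "\<bar>dual_objective M X A \<epsilon> (0, l)\<bar> \<noteq> \<infinity>" unfolding dual_objective_finite_iff by simp
  moreover have "cgvi_value M \<phi> \<epsilon> X \<le> dual_objective M X A \<epsilon> (0, l)"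
    using l by (intro cgvi_value_le payoff_MX) (simp add: multipliers_iff)
  ultimately show ?thesis
    using mean_le_cgvi_value[OF assms] that by (cases "cgvi_value M \<phi> \<epsilon> X") auto
qed

lemma strong_duality_attained:
  assumes "0 < \<epsilon>"
  shows "\<exists>z\<in>multipliers. dual_objective M X A \<epsilon> z = cgvi_value M \<phi> \<epsilon> X"
proof -
  obtain V where V: "cgvi_value M \<phi> \<epsilon> X = ereal V" using assms by (auto intro: cgvi_value_finite[of \<epsilon>])
  have "\<exists>z\<in>multipliers. dual_objective M X A \<epsilon> z \<le> ereal V"
  proof (rule strong_duality[OF slater_perturbations[OF assms]])
    fix f :: "'a \<Rightarrow> real \<times> real"
    assume "simple_function M f" "\<And>w. w \<in> space M \<Longrightarrow> f w \<in> A" "expectation (\<lambda>w. fst (f w)) = 0"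
      "expectation (\<lambda>w. snd (f w)) \<le> \<epsilon>"
    from cgvi_value_ge_simple[OF payoff_MX this] show "expectation (\<lambda>w. X w + fst (f w) * X w) \<le> V"
      by (simp add: V)
  qed
  then show ?thesis using cgvi_value_le[OF payoff_MX] V by (metis antisym)
qed

text \<open>At radius 0 the set \<open>A\<close> has no Slater points. If its flat part has them at
  radius 1, strong duality is applied there: competitors in the flat part cost nothing, hence are
  feasible at radius 0, and large multipliers approach the flat value. Otherwise both sides are
  squeezed to the mean.\<close>

lemma cgvi_value_eq_INF:
  assumes "0 \<le> \<epsilon>"
  shows "cgvi_value M \<phi> \<epsilon> X = (INF z\<in>multipliers. dual_objective M X A \<epsilon> z)"
proof (rule antisym)
  show "cgvi_value M \<phi> \<epsilon> X \<le> (INF z\<in>multipliers. dual_objective M X A \<epsilon> z)"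
    by (intro INF_greatest cgvi_value_le payoff_MX)
  show "(INF z\<in>multipliers. dual_objective M X A \<epsilon> z) \<le> cgvi_value M \<phi> \<epsilon> X"
  proof (cases "\<epsilon> = 0")
    case False
    then show ?thesis using strong_duality_attained[of \<epsilon>] assms by (metis INF_lower less_eq_real_def)
  next
    case [simp]: True
    show ?thesis
    proof (rule dense_ge)
      fix c assume c: "cgvi_value M \<phi> \<epsilon> X < c"
      have "\<exists>z\<in>multipliers. dual_objective M X A 0 z < c"
      proof (cases "slater (flat A) 1")
        case False
        show ?thesis
          by (rule dual_objective_near_mean[OF False])
            (use c mean_le_cgvi_value[OF assms] in \<open>auto intro: le_less_trans\<close>)
      next
        case True
        interpret flat: dual_problem M X "flat A"
          using payoff_MX flat_pert by (simp add: dual_problem_def)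
        obtain V where V: "cgvi_value M \<phi> 0 X = ereal V" by (auto intro: cgvi_value_finite[of 0])
        have "\<exists>z\<in>multipliers. dual_objective M X (flat A) 1 z \<le> ereal V"
        proof (rule flat.strong_duality[OF True])
          fix f :: "'a \<Rightarrow> real \<times> real"
          assume f: "simple_function M f" "\<And>w. w \<in> space M \<Longrightarrow> f w \<in> flat A" "expectation (\<lambda>w. fst (f w)) = 0"
          have "expectation (\<lambda>w. snd (f w)) = expectation (\<lambda>w. 0)"
            using f(2) by (intro Bochner_Integration.integral_cong) (auto simp: flat_def)
          then show "expectation (\<lambda>w. X w + fst (f w) * X w) \<le> V"
            using cgvi_value_ge_simple[OF payoff_MX f(1) _ f(3), of 0] f(2) by (simp add: V flat_def)
        qed
        then obtain z where z: "z \<in> multipliers" "dual_objective M X (flat A) 1 z \<le> ereal V" by blast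
        have "dual_objective M X (flat A) 1 (fst z, 0) \<le> dual_objective M X (flat A) 1 z"
          using z(1) add_left_mono[of 0 "ereal (snd z)" "dual_objective M X (flat A) 1 (fst z, 0)"]
          unfolding flat_radius_one[of M X A z] by (simp add: multipliers_iff)
        with z(2) c V have "dual_objective M X (flat A) 1 (fst z, 0) < c" by simp
        then show ?thesis by (rule dual_objective_less_of_flat_less)
      qed
      then show "(INF z\<in>multipliers. dual_objective M X A \<epsilon> z) \<le> c"
        by (auto intro: INF_lower2 less_imp_le)
    qed
  qed
qed

end

section \<open>Empirical measures\<close>

text \<open>The sample size is \<open>Suc n\<close> because there is no uniform distribution on the empty sample.\<close>

definition empirical :: "nat \<Rightarrow> nat measure" where
  "empirical n = measure_pmf (pmf_of_set {1..Suc n})"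

lemma integral_empirical: "(\<integral>s. f s \<partial>empirical n) = (\<Sum>k<Suc n. f (Suc k)) / real (Suc n)"
  for f :: "nat \<Rightarrow> real"
proof -
  have "(\<Sum>s\<in>{1..Suc n}. f s) = (\<Sum>k<Suc n. f (Suc k))"
    by (rule sum.reindex_bij_witness[of _ Suc "\<lambda>s. s - 1"]) auto
  then show ?thesis unfolding empirical_def by (subst integral_pmf_of_set) auto
qed

lemma nn_integral_empirical: "(\<integral>\<^sup>+ s. f s \<partial>empirical n) = ennreal (1 / real (Suc n)) * (\<Sum>s=1..Suc n. f s)"
proof -
  have "(\<integral>\<^sup>+ s. f s \<partial>empirical n) = (\<Sum>s=1..Suc n. f s) / ennreal (real (Suc n))"
    unfolding empirical_def by (subst nn_integral_pmf_of_set) (auto simp: ennreal_of_nat_eq_real_of_nat)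
  then show ?thesis
    unfolding divide_ennreal_def by (subst (asm) inverse_ennreal) (auto simp: inverse_eq_divide mult.commute)
qed

lemma AE_empirical: "(AE s in empirical n. Pr s) \<longleftrightarrow> (\<forall>s\<in>{1..Suc n}. Pr s)"
  unfolding empirical_def by (subst AE_measure_pmf_iff) simp

lemma payoff_empirical: "payoff (empirical n) x"
proof -
  interpret prob_space "empirical n"
    unfolding empirical_def by (rule measure_pmf.prob_space_axioms)
  show ?thesis
    by unfold_locales (auto simp: empirical_def intro!: integrable_measure_pmf_finite)
qed

text \<open>This identifies the sample average problem as the dual problem of a uniform measure on
  indices, so that all preceding results apply to it.\<close>

lemma (in divergence) saa_objective_eq:
  assumes z: "z \<in> multipliers"
  shows "saa_objective \<phi> \<epsilon> x (Suc n) z = dual_objective (empirical n) x A \<epsilon> z"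
proof -
  obtain \<mu> l where zl: "z = (\<mu>, l)" by (cases z)
  have l: "0 \<le> l" using z zl by (simp add: multipliers_def)
  define I where "I = {1..Suc n}"
  define S where "S = real (Suc n)"
  have S: "0 < S" "card I = Suc n" "finite I" "I \<noteq> {}" by (auto simp: S_def I_def)
  let ?k = "\<lambda>s. excess A l (x s - \<mu>)"
  have "(\<Sum>s\<in>I. fenchel (scale_fun l \<phi>) (x s - \<mu>)) = (\<Sum>s\<in>I. ereal (x s - \<mu>)) + (\<Sum>s\<in>I. enn2ereal (?k s))"
    unfolding fenchel_scale_eq[OF l] by (rule sum.distrib)
  also have "\<dots> = ereal (\<Sum>s\<in>I. x s - \<mu>) + enn2ereal (\<Sum>s\<in>I. ?k s)"
    by simp
  finally have "ereal (1 / S) * (\<Sum>s\<in>I. fenchel (scale_fun l \<phi>) (x s - \<mu>))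
      = ereal (1 / S) * (ereal (\<Sum>s\<in>I. x s - \<mu>) + enn2ereal (\<Sum>s\<in>I. ?k s))"
    by simp
  \<comment> \<open>Multiplication distributes here because the first summand is finite and the
    second nonnegative.\<close>
  also have "\<dots> = ereal (1 / S) * ereal (\<Sum>s\<in>I. x s - \<mu>) + ereal (1 / S) * enn2ereal (\<Sum>s\<in>I. ?k s)"
    by (cases "\<Sum>s\<in>I. ?k s") (use S(1) in \<open>auto simp: enn2ereal_ennreal top_ennreal.rep_eq top_ereal_def add_divide_distrib\<close>)
  also have "ereal (1 / S) * enn2ereal (\<Sum>s\<in>I. ?k s) = enn2ereal (\<integral>\<^sup>+ s. ?k s \<partial>empirical n)"
  proof -
    have "(\<integral>\<^sup>+ s. ?k s \<partial>empirical n) = ennreal (1 / S) * (\<Sum>s\<in>I. ?k s)"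
      unfolding I_def S_def by (rule nn_integral_empirical)
    then show ?thesis using S(1) by (simp add: times_ennreal.rep_eq enn2ereal_ennreal)
  qed
  also have "ereal (1 / S) * ereal (\<Sum>s\<in>I. x s - \<mu>) = ereal ((\<integral>s. x s \<partial>empirical n) - \<mu>)"
  proof -
    have "(\<integral>s. x s \<partial>empirical n) = (\<Sum>s\<in>I. x s) / S"
      unfolding empirical_def I_def[symmetric] using S by (subst integral_pmf_of_set) (auto simp: S_def)
    moreover have "(\<Sum>s\<in>I. x s - \<mu>) = (\<Sum>s\<in>I. x s) - S * \<mu>"
      by (simp add: sum_subtractf S(2) S_def)
    ultimately show ?thesis using S(1) by (simp add: diff_divide_distrib)
  qed
  finally show ?thesis
    unfolding I_def S_def
    by (simp only: saa_objective_def dual_objective_def zl prod.case fst_conv snd_conv add.assoc[symmetric] plus_ereal.simps(1))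
      (simp add: algebra_simps)
qed

section \<open>Almost sure properties of iid samples\<close>

locale iid_samples = payoff M X for M :: "'a measure" and X +
  fixes W :: "'w measure" and \<theta> :: "nat \<Rightarrow> 'w \<Rightarrow> 'a"
  assumes prob_W: "prob_space W"
    and indep: "prob_space.indep_vars W (\<lambda>_. M) \<theta> {1..}"
    and distr_sample: "1 \<le> s \<Longrightarrow> distr W M (\<theta> s) = M"
begin

lemma sample_measurable: "1 \<le> s \<Longrightarrow> \<theta> s \<in> measurable W M"
  using indep by (auto simp: prob_space.indep_vars_def[OF prob_W])

lemma AE_average:
  fixes g :: "real \<Rightarrow> real"
  assumes g[measurable]: "g \<in> borel_measurable borel" and int: "integrable M (\<lambda>w. g (X w))"
  shows "AE \<omega> in W. (\<lambda>n. \<integral>s. g (X (\<theta> s \<omega>)) \<partial>empirical n) \<longlonglongrightarrow> expectation (\<lambda>w. g (X w))"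
proof -
  interpret W: prob_space W by (rule prob_W)
  have gX[measurable]: "(\<lambda>w. g (X w)) \<in> borel_measurable M" by measurable
  have \<theta>[measurable]: "\<theta> (Suc k) \<in> measurable W M" for k by (rule sample_measurable) simp
  define G where "G k \<omega> = g (X (\<theta> (Suc k) \<omega>))" for k \<omega>
  \<comment> \<open>Restriction to the singletons \<open>{Suc j}\<close> reindexes the family from
    \<open>{1..}\<close> to all naturals, as the strong law requires.\<close>
  have "W.indep_vars (\<lambda>j. PiM {Suc j} (\<lambda>_. M)) (\<lambda>j \<omega>. restrict (\<lambda>i. \<theta> i \<omega>) {Suc j}) UNIV"
    by (rule W.indep_vars_restrict[OF indep]) (auto simp: disjoint_family_on_def)
  then have "W.indep_vars (\<lambda>_. borel) (\<lambda>j \<omega>. (\<lambda>f. g (X (f (Suc j)))) (restrict (\<lambda>i. \<theta> i \<omega>) {Suc j})) UNIV"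
    by (rule W.indep_vars_compose2) measurable
  then have indepG: "W.indep_vars (\<lambda>_. borel) G UNIV" by (simp add: G_def[abs_def])
  have dist: "distr W borel (G k) = distr M borel (\<lambda>w. g (X w))" for k
    using distr_distr[OF gX \<theta>[of k]] distr_sample[of "Suc k"] by (simp add: G_def[abs_def] comp_def)
  have intG: "integrable W (G 0)" "W.expectation (G 0) = expectation (\<lambda>w. g (X w))"
    using integrable_distr_eq[OF \<theta>[of 0] gX] integral_distr[OF \<theta>[of 0] gX] int distr_sample[of "Suc 0"]
    by (simp_all add: G_def[abs_def])
  have "AE \<omega> in W. (\<lambda>n. (\<Sum>k<n. G k \<omega>) / real n) \<longlonglongrightarrow> W.expectation (G 0)"
    by (rule W.strong_law_of_large_numbers[OF indepG _ intG(1)]) (simp add: dist)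
  then show ?thesis
  proof eventually_elim
    case (elim \<omega>)
    \<comment> \<open>\<open>empirical n\<close> averages \<open>Suc n\<close> samples.\<close>
    from LIMSEQ_Suc[OF this] show ?case
      unfolding integral_empirical by (simp add: G_def intG(2))
  qed
qed

lemma AE_samples:
  assumes [measurable]: "Measurable.pred borel Pr" and ae: "AE w in M. Pr (X w)"
  shows "AE \<omega> in W. \<forall>s\<ge>1. Pr (X (\<theta> s \<omega>))"
proof -
  have "AE \<omega> in W. Pr (X (\<theta> s \<omega>))" if s: "1 \<le> s" for s
  proof -
    have "AE w in distr W M (\<theta> s). Pr (X w)" by (subst distr_sample[OF s]) (rule ae)
    then show ?thesis
      by (subst (asm) AE_distr_iff[OF sample_measurable[OF s]]) auto
  qed
  then show ?thesis unfolding AE_all_countable by (intro allI) auto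
qed

lemma AE_approximated:
  assumes "perturbation_set A"
  shows "AE \<omega> in W. approximated_payoff M X A empirical (\<lambda>s. X (\<theta> s \<omega>))"
proof -
  interpret perturbation_set A by fact
  have pay: "payoff M X" ..
  have "AE \<omega> in W. (\<lambda>n. \<integral>s. X (\<theta> s \<omega>) \<partial>empirical n) \<longlonglongrightarrow> expectation X"
    using AE_average[of "\<lambda>y. y"] integrable_payoff by simp
  moreover have "AE \<omega> in W. \<forall>n. \<forall>p\<in>\<rat>. \<forall>q\<in>\<rat>. (\<lambda>k. \<integral>s. excess_max n q (X (\<theta> s \<omega>) - p) \<partial>empirical k)
      \<longlonglongrightarrow> expectation (\<lambda>w. excess_max n q (X w - p))"
    unfolding AE_all_countable
  proof (intro allI)
    fix n
    have "AE \<omega> in W. (\<lambda>k. \<integral>s. excess_max n q (X (\<theta> s \<omega>) - p) \<partial>empirical k)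
        \<longlonglongrightarrow> expectation (\<lambda>w. excess_max n q (X w - p))" for p q
      by (rule AE_average[of "\<lambda>y. excess_max n q (y - p)"]) (auto intro: integrable_excess_max[OF pay])
    then show "AE \<omega> in W. \<forall>p\<in>\<rat>. \<forall>q\<in>\<rat>. (\<lambda>k. \<integral>s. excess_max n q (X (\<theta> s \<omega>) - p) \<partial>empirical k)
        \<longlonglongrightarrow> expectation (\<lambda>w. excess_max n q (X w - p))"
      unfolding AE_ball_countable[OF countable_rat] by blast
  qed
  ultimately show ?thesis
  proof eventually_elim
    case (elim \<omega>)
    show ?case
    proof (intro approximated_payoff.intro approximated_payoff_axioms.intro)
      show "payoff M X" by (rule pay)
      show "perturbation_set A" by (rule assms)
      show "payoff (empirical k) (\<lambda>s. X (\<theta> s \<omega>))" for k by (rule payoff_empirical)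
      show "(\<lambda>n. \<integral>s. X (\<theta> s \<omega>) \<partial>empirical n) \<longlonglongrightarrow> expectation X" by (rule elim(1))
      show "(\<lambda>k. \<integral>s. excess_max n q (X (\<theta> s \<omega>) - p) \<partial>empirical k)
          \<longlonglongrightarrow> expectation (\<lambda>w. excess_max n q (X w - p))" if "p \<in> \<rat>" "q \<in> \<rat>" for n p q
        using elim(2) that by blast
    qed
  qed
qed

text \<open>A finite integral makes the excess finite almost everywhere, so the strong law applies
  to its real version, and almost surely no sample meets an infinite value.\<close>

lemma AE_dual_objective:
  assumes "perturbation_set A" and fin: "(\<integral>\<^sup>+ w. excess A (snd z) (X w - fst z) \<partial>M) < \<infinity>"
  shows "AE \<omega> in W. (\<lambda>n. dual_objective (empirical n) (\<lambda>s. X (\<theta> s \<omega>)) A \<epsilon> z) \<longlonglongrightarrow> dual_objective M X A \<epsilon> z"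
proof -
  interpret perturbation_set A by fact
  let ?e = "\<lambda>y. excess A (snd z) (y - fst z)"
  have ae: "AE w in M. ?e (X w) \<noteq> \<infinity>" using fin by (intro nn_integral_PInf_AE) auto
  have nn: "(\<integral>\<^sup>+ w. ennreal (enn2real (?e (X w))) \<partial>M) = (\<integral>\<^sup>+ w. ?e (X w) \<partial>M)"
    using ae by (intro nn_integral_cong_AE) (auto elim!: eventually_mono simp: less_top)
  have int: "integrable M (\<lambda>w. enn2real (?e (X w)))"
    using nn fin by (intro integrableI_bounded) auto
  have E: "(\<integral>\<^sup>+ w. ?e (X w) \<partial>M) = ennreal (expectation (\<lambda>w. enn2real (?e (X w))))"
    using nn_integral_eq_integral[OF int] nn by simp
  have "AE \<omega> in W. \<forall>s\<ge>1. ?e (X (\<theta> s \<omega>)) \<noteq> \<infinity>"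
    using ae by (intro AE_samples[of "\<lambda>y. ?e y \<noteq> \<infinity>"]) measurable
  moreover have "AE \<omega> in W. (\<lambda>n. \<integral>s. enn2real (?e (X (\<theta> s \<omega>))) \<partial>empirical n) \<longlonglongrightarrow> expectation (\<lambda>w. enn2real (?e (X w)))"
    using int by (intro AE_average[of "\<lambda>y. enn2real (?e y)"]) measurable
  moreover have "AE \<omega> in W. (\<lambda>n. \<integral>s. X (\<theta> s \<omega>) \<partial>empirical n) \<longlonglongrightarrow> expectation X"
    using AE_average[of "\<lambda>y. y"] integrable_payoff by simp
  ultimately show ?thesis
  proof eventually_elim
    case (elim \<omega>)
    have emp: "(\<integral>\<^sup>+ s. ?e (X (\<theta> s \<omega>)) \<partial>empirical n) = ennreal (\<integral>s. enn2real (?e (X (\<theta> s \<omega>))) \<partial>empirical n)" for n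
    proof -
      have "(\<integral>\<^sup>+ s. ?e (X (\<theta> s \<omega>)) \<partial>empirical n) = (\<integral>\<^sup>+ s. ennreal (enn2real (?e (X (\<theta> s \<omega>)))) \<partial>empirical n)"
        using elim(1) by (intro nn_integral_cong_AE) (auto simp: AE_empirical less_top)
      also have "\<dots> = ennreal (\<integral>s. enn2real (?e (X (\<theta> s \<omega>))) \<partial>empirical n)"
        by (intro nn_integral_eq_integral) (auto intro: payoff.integrable_payoff[OF payoff_empirical])
      finally show ?thesis .
    qed
    have "(\<lambda>n. ereal ((\<integral>s. X (\<theta> s \<omega>) \<partial>empirical n) + snd z * \<epsilon>) + ereal (\<integral>s. enn2real (?e (X (\<theta> s \<omega>))) \<partial>empirical n))
        \<longlonglongrightarrow> ereal (expectation X + snd z * \<epsilon>) + ereal (expectation (\<lambda>w. enn2real (?e (X w))))"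
      unfolding plus_ereal.simps(1) using elim by (intro tendsto_intros)
    then show ?case
      by (simp add: dual_objective_def emp E enn2ereal_ennreal integral_nonneg_AE)
  qed
qed

lemma AE_tame:
  assumes "tame_problem M X A"
  shows "AE \<omega> in W. \<forall>n. tame_problem (empirical n) (\<lambda>s. X (\<theta> s \<omega>)) A"
proof -
  interpret t: tame_problem M X A by fact
  obtain z where z: "(\<integral>\<^sup>+ w. excess A (snd z) (X w - fst z) \<partial>M) < \<infinity>" using t.finite_excess by blast
  have "AE w in M. excess A (snd z) (X w - fst z) \<noteq> \<infinity>" using z by (intro nn_integral_PInf_AE) auto
  then have "AE \<omega> in W. \<forall>s\<ge>1. excess A (snd z) (X (\<theta> s \<omega>) - fst z) \<noteq> \<infinity>"
    by (intro AE_samples[of "\<lambda>y. excess A (snd z) (y - fst z) \<noteq> \<infinity>"]) measurable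
  then show ?thesis
  proof eventually_elim
    case (elim \<omega>)
    show ?case
    proof
      fix n
      have "(\<integral>\<^sup>+ s. excess A (snd z) (X (\<theta> s \<omega>) - fst z) \<partial>empirical n) < \<infinity>"
        unfolding nn_integral_empirical using elim
        by (auto simp: ennreal_mult_less_top less_top simp del: sum.cl_ivl_Suc)
      then show "tame_problem (empirical n) (\<lambda>s. X (\<theta> s \<omega>)) A"
        using t.flat_bounded t.perturbation_set_axioms payoff_empirical
        by (auto intro!: tame_problem.intro dual_problem.intro tame_problem_axioms.intro)
    qed
  qed
qed

text \<open>The frequency of violations converges to their probability, which is positive, so
  violations eventually occur in the sample.\<close>

lemma AE_eventually_sample:
  assumes [measurable]: "Measurable.pred borel Pr" and not: "\<not> (AE w in M. Pr (X w))"
  shows "AE \<omega> in W. \<forall>\<^sub>F n in sequentially. \<not> (AE s in empirical n. Pr (X (\<theta> s \<omega>)))"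
proof -
  let ?g = "\<lambda>y. of_bool (\<not> Pr y) :: real"
  have [measurable]: "?g \<in> borel_measurable borel" by measurable
  have int: "integrable M (\<lambda>w. ?g (X w))" by (rule integrable_const_bound[of _ 1]) auto
  have "expectation (\<lambda>w. ?g (X w)) \<noteq> 0"
  proof
    assume "expectation (\<lambda>w. ?g (X w)) = 0"
    then have "AE w in M. ?g (X w) = 0"
      using int by (subst (asm) integral_nonneg_eq_0_iff_AE) auto
    then show False using not by (auto elim!: eventually_mono)
  qed
  then have pos: "0 < expectation (\<lambda>w. ?g (X w))"
    by (simp add: less_le integral_nonneg_AE)
  have "AE \<omega> in W. (\<lambda>n. \<integral>s. ?g (X (\<theta> s \<omega>)) \<partial>empirical n) \<longlonglongrightarrow> expectation (\<lambda>w. ?g (X w))"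
    using int by (intro AE_average) auto
  then show ?thesis
  proof eventually_elim
    case (elim \<omega>)
    from order_tendstoD(1)[OF elim pos] show ?case
    proof eventually_elim
      case (elim n)
      show ?case
      proof
        assume "AE s in empirical n. Pr (X (\<theta> s \<omega>))"
        then have "(\<integral>s. ?g (X (\<theta> s \<omega>)) \<partial>empirical n) = (\<integral>s. 0 \<partial>empirical n)"
          by (intro integral_cong_AE) (auto simp: empirical_def)
        with elim show False by simp
      qed
    qed
  qed
qed

lemma AE_rational_bounds:
  "AE \<omega> in W. \<forall>c\<in>\<rat>. (\<not> (AE w in M. X w \<le> c) \<longrightarrow> (\<forall>\<^sub>F n in sequentially. \<not> (AE s in empirical n. X (\<theta> s \<omega>) \<le> c)))
    \<and> (\<not> (AE w in M. c \<le> X w) \<longrightarrow> (\<forall>\<^sub>F n in sequentially. \<not> (AE s in empirical n. c \<le> X (\<theta> s \<omega>))))"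
proof -
  have up: "AE \<omega> in W. \<not> (AE w in M. X w \<le> c) \<longrightarrow> (\<forall>\<^sub>F n in sequentially. \<not> (AE s in empirical n. X (\<theta> s \<omega>) \<le> c))" for c
  proof (cases "AE w in M. X w \<le> c")
    case False
    then show ?thesis using AE_eventually_sample[of "\<lambda>y. y \<le> c"] by auto
  qed simp
  have low: "AE \<omega> in W. \<not> (AE w in M. c \<le> X w) \<longrightarrow> (\<forall>\<^sub>F n in sequentially. \<not> (AE s in empirical n. c \<le> X (\<theta> s \<omega>)))" for c
  proof (cases "AE w in M. c \<le> X w")
    case False
    then show ?thesis using AE_eventually_sample[of "\<lambda>y. c \<le> y"] by auto
  qed simp
  show ?thesis
    unfolding AE_ball_countable[OF countable_rat] by (intro ballI AE_conjI up low)
qed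

end

section \<open>Convergence of optimal values and minimizers\<close>

locale sampled_cgvi = cgvi_problem \<phi> M X + iid_samples M X W \<theta>
  for \<phi> and M :: "'a measure" and X and W :: "'w measure" and \<theta>
begin

lemma saa_value_eq:
  "saa_value \<phi> \<epsilon> x (Suc n) = (INF z\<in>multipliers. dual_objective (empirical n) x A \<epsilon> z)"
  unfolding saa_value_def by (intro INF_cong) (auto simp: saa_objective_eq)

lemma saa_minimizers_eq: "saa_minimizers \<phi> \<epsilon> x (Suc n) = dual_minimizers (empirical n) x A \<epsilon>"
  by (auto simp: saa_minimizers_def dual_minimizers_def is_arg_min_def saa_objective_eq)

lemma cgvi_minimizers_eq: "cgvi_minimizers M \<phi> \<epsilon> X = dual_minimizers M X A \<epsilon>"
  by (auto simp: cgvi_minimizers_def dual_minimizers_def is_arg_min_def cgvi_objective_eq[OF payoff_MX])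

lemma AE_approximated_flat:
  "AE \<omega> in W. approximated_payoff M X (flat A) empirical (\<lambda>s. X (\<theta> s \<omega>))"
  by (rule AE_approximated[OF flat_pert])

lemma AE_approximated_payoff:
  "AE \<omega> in W. approximated_payoff M X A empirical (\<lambda>s. X (\<theta> s \<omega>))"
  by (rule AE_approximated) unfold_locales

lemma saa_value_tendsto:
  assumes "0 \<le> \<epsilon>"
  shows "AE \<omega> in W. (\<lambda>S. saa_value \<phi> \<epsilon> (\<lambda>s. X (\<theta> s \<omega>)) S) \<longlonglongrightarrow> cgvi_value M \<phi> \<epsilon> X"
proof -
  obtain V where V: "cgvi_value M \<phi> \<epsilon> X = ereal V" by (rule cgvi_value_finite[OF assms])
  have inf: "(INF z\<in>multipliers. dual_objective M X A \<epsilon> z) = ereal V"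
    using cgvi_value_eq_INF[OF assms] V by simp
  \<comment> \<open>A minimizer need not exist at radius 0. A minimizing sequence fixed in advance
    replaces it, and countability leaves one null set.\<close>
  have "\<exists>z\<in>multipliers. dual_objective M X A \<epsilon> z < ereal (V + 1 / real (Suc j))" for j
    using inf INF_less_iff[of "dual_objective M X A \<epsilon>" multipliers "ereal (V + 1 / real (Suc j))"] by simp
  then have "\<forall>j. \<exists>z. z \<in> multipliers \<and> dual_objective M X A \<epsilon> z < ereal (V + 1 / real (Suc j))" by blast
  from choice[OF this] obtain z where
    z: "\<And>j. z j \<in> multipliers" "\<And>j. dual_objective M X A \<epsilon> (z j) < ereal (V + 1 / real (Suc j))" by blast
  have fin: "(\<integral>\<^sup>+ w. excess A (snd (z j)) (X w - fst (z j)) \<partial>M) < \<infinity>" for j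
  proof -
    have "dual_objective M X A \<epsilon> (z j) \<noteq> \<infinity>" using z(2)[of j] by auto
    moreover have "dual_objective M X A \<epsilon> (z j) \<noteq> - \<infinity>"
      using dual_objective_ge_mean[where z = "z j" and \<epsilon> = \<epsilon> and A = A] by auto
    ultimately show ?thesis using dual_objective_finite_iff[where M = M and X = X and A = A and \<epsilon> = \<epsilon> and z = "z j"] by auto
  qed
  have "AE \<omega> in W. \<forall>j. (\<lambda>n. dual_objective (empirical n) (\<lambda>s. X (\<theta> s \<omega>)) A \<epsilon> (z j)) \<longlonglongrightarrow> dual_objective M X A \<epsilon> (z j)"
    unfolding AE_all_countable by (intro allI AE_dual_objective fin perturbation_set_axioms)
  with AE_approximated_payoff AE_approximated_flat show ?thesis
  proof eventually_elim
    case (elim \<omega>)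
    interpret apx: approximated_payoff M X A empirical "\<lambda>s. X (\<theta> s \<omega>)" by (rule elim)
    have "(\<lambda>n. INF z\<in>multipliers. dual_objective (empirical n) (\<lambda>s. X (\<theta> s \<omega>)) A \<epsilon> z) \<longlonglongrightarrow> ereal V"
    proof (rule INF_tendsto)
      fix \<alpha> assume \<alpha>: "ereal \<alpha> < ereal V"
      show "\<forall>\<^sub>F n in sequentially. \<forall>z\<in>multipliers. ereal \<alpha> < dual_objective (empirical n) (\<lambda>s. X (\<theta> s \<omega>)) A \<epsilon> z"
      proof (cases "\<epsilon> = 0")
        case True
        then show ?thesis
          using eventually_greater_radius_zero[OF elim(1,2) tame_problem_axioms, of \<alpha>] \<alpha> inf by simp
      next
        case False
        show ?thesis
        proof (rule apx.eventually_greater_slater)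
          show "slater A \<epsilon>" using False assms by (intro slater_perturbations) simp
          show "ereal \<alpha> < dual_objective M X A \<epsilon> z" if "z \<in> multipliers" for z
            using INF_lower[OF that, of "dual_objective M X A \<epsilon>"] unfolding inf
            by (rule less_le_trans[OF \<alpha>])
        qed
      qed
    next
      fix \<beta> assume "ereal V < \<beta>"
      then obtain b where b: "V < b" "ereal b < \<beta>" using ereal_dense2 by fastforce
      obtain j where j: "1 / real (Suc j) < b - V"
        using b(1) reals_Archimedean[of "b - V"] by (auto simp: inverse_eq_divide)
      have "dual_objective M X A \<epsilon> (z j) < ereal b"
        by (rule less_trans[OF z(2)]) (use j in simp)
      with b(2) have "dual_objective M X A \<epsilon> (z j) < \<beta>" by (rule less_trans[rotated])
      with elim(3) z(1) show "\<exists>z\<in>multipliers. \<exists>v<\<beta>. (\<lambda>n. dual_objective (empirical n) (\<lambda>s. X (\<theta> s \<omega>)) A \<epsilon> z) \<longlonglongrightarrow> v"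
        by blast
    qed
    \<comment> \<open>The claim was shown for \<open>S = Suc n\<close>; the value at
      \<open>S = 0\<close> does not affect the limit.\<close>
    then show ?case
      unfolding V saa_value_eq[symmetric] by (rule LIMSEQ_imp_Suc)
  qed
qed

lemma minimizers_near:
  assumes "0 \<le> \<epsilon>" and zs: "zs \<in> dual_minimizers M X A \<epsilon>"
  shows "AE \<omega> in W. \<forall>\<eta>>0. \<forall>\<^sub>F n in sequentially. \<forall>z\<in>dual_minimizers (empirical n) (\<lambda>s. X (\<theta> s \<omega>)) A \<epsilon>.
    \<exists>z'\<in>dual_minimizers M X A \<epsilon>. dist z z' < \<eta>"
proof -
  obtain V where V: "cgvi_value M \<phi> \<epsilon> X = ereal V" by (rule cgvi_value_finite[OF assms(1)])
  have "dual_objective M X A \<epsilon> zs = (INF z\<in>multipliers. dual_objective M X A \<epsilon> z)"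
    using zs by (intro antisym INF_greatest INF_lower) (auto simp: dual_minimizers_iff)
  then have val: "dual_objective M X A \<epsilon> zs = ereal V"
    using cgvi_value_eq_INF[OF assms(1)] V by simp
  then have fin: "\<bar>dual_objective M X A \<epsilon> zs\<bar> \<noteq> \<infinity>" by simp
  have lim: "AE \<omega> in W. (\<lambda>n. dual_objective (empirical n) (\<lambda>s. X (\<theta> s \<omega>)) A \<epsilon> zs) \<longlonglongrightarrow> dual_objective M X A \<epsilon> zs"
    using fin unfolding dual_objective_finite_iff by (intro AE_dual_objective perturbation_set_axioms)
  show ?thesis
  proof (cases "\<epsilon> = 0")
    case False
    from lim AE_approximated_payoff show ?thesis
    proof eventually_elim
      case (elim \<omega>)
      interpret apx: approximated_payoff M X A empirical "\<lambda>s. X (\<theta> s \<omega>)" by (rule elim)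
      show ?case
        using False assms(1) by (intro allI impI apx.eventually_minimizers_near_slater[OF _ zs fin elim(1)] slater_perturbations) auto
    qed
  next
    case [simp]: True
    show ?thesis
    proof (cases "slater (flat A) 1")
      case sl: True
      have lim0: "AE \<omega> in W. (\<lambda>n. dual_objective (empirical n) (\<lambda>s. X (\<theta> s \<omega>)) (flat A) 1 (fst zs, 0)) \<longlonglongrightarrow> dual_objective M X (flat A) 1 (fst zs, 0)"
        using flat_finite[of "fst zs"] by (intro AE_dual_objective flat_pert) simp
      have up: "AE \<omega> in W. (AE w in M. X w \<le> fst zs) \<longrightarrow> (\<forall>s\<ge>1. X (\<theta> s \<omega>) \<le> fst zs)"
        using AE_samples[of "\<lambda>y. y \<le> fst zs"] by (cases "AE w in M. X w \<le> fst zs") auto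
      have low: "AE \<omega> in W. (AE w in M. fst zs \<le> X w) \<longrightarrow> (\<forall>s\<ge>1. fst zs \<le> X (\<theta> s \<omega>))"
        using AE_samples[of "\<lambda>y. fst zs \<le> y"] by (cases "AE w in M. fst zs \<le> X w") auto
      from lim lim0 up low AE_approximated_payoff AE_approximated_flat AE_tame[OF tame_problem_axioms] AE_rational_bounds
      show ?thesis
      proof eventually_elim
        case (elim \<omega>)
        show ?case unfolding True
        proof (intro allI impI)
          fix \<eta> :: real assume "0 < \<eta>"
          show "\<forall>\<^sub>F n in sequentially. \<forall>z\<in>dual_minimizers (empirical n) (\<lambda>s. X (\<theta> s \<omega>)) A 0.
            \<exists>z'\<in>dual_minimizers M X A 0. dist z z' < \<eta>"
          proof (rule minimizers_near_radius_zero[OF elim(5,6) tame_problem_axioms _ sl zs[unfolded True] elim(1)[unfolded True] elim(2)])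
            show "tame_problem (empirical k) (\<lambda>s. X (\<theta> s \<omega>)) A" for k using elim(7) by blast
            show "AE s in empirical k. X (\<theta> s \<omega>) \<le> fst zs" if "AE w in M. X w \<le> fst zs" for k
              using elim(3) that by (simp add: AE_empirical)
            show "AE s in empirical k. fst zs \<le> X (\<theta> s \<omega>)" if "AE w in M. fst zs \<le> X w" for k
              using elim(4) that by (simp add: AE_empirical)
            show "\<forall>\<^sub>F k in sequentially. \<not> (AE s in empirical k. X (\<theta> s \<omega>) \<le> c)"
              if "c \<in> \<rat>" "\<not> (AE w in M. X w \<le> c)" for c
              using elim(8) that by blast
            show "\<forall>\<^sub>F k in sequentially. \<not> (AE s in empirical k. c \<le> X (\<theta> s \<omega>))"
              if "c \<in> \<rat>" "\<not> (AE w in M. c \<le> X w)" for c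
              using elim(8) that by blast
          qed fact
        qed
      qed
    next
      case False
      \<comment> \<open>A one-sided flat part makes the mean the optimal value. Attaining it forces
        the excess to vanish almost surely, so the payoff is constant by \<open>excess_eq_0\<close>,
        and the empirical objectives coincide with the true one.\<close>
      have "dual_objective M X A 0 zs \<le> ereal (expectation X)"
      proof (rule ccontr)
        assume "\<not> ?thesis"
        then have "\<exists>z\<in>multipliers. dual_objective M X A 0 z < dual_objective M X A 0 zs"
          by (intro dual_objective_near_mean[OF False]) simp
        then show False using zs by (auto simp: dual_minimizers_iff not_le[symmetric])
      qed
      then have "enn2ereal (\<integral>\<^sup>+ w. excess A (snd zs) (X w - fst zs) \<partial>M) \<le> 0"
        by (cases "\<integral>\<^sup>+ w. excess A (snd zs) (X w - fst zs) \<partial>M")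
          (auto simp: dual_objective_def enn2ereal_ennreal top_ennreal.rep_eq top_ereal_def zero_ennreal.rep_eq)
      then have "enn2ereal (\<integral>\<^sup>+ w. excess A (snd zs) (X w - fst zs) \<partial>M) = enn2ereal 0"
        using enn2ereal_nonneg by (simp add: zero_ennreal.rep_eq antisym)
      then have "(\<integral>\<^sup>+ w. excess A (snd zs) (X w - fst zs) \<partial>M) = 0"
        by (simp only: enn2ereal_inject)
      then have "AE w in M. excess A (snd zs) (X w - fst zs) = 0"
        by (subst (asm) nn_integral_0_iff_AE) auto
      then have c: "AE w in M. X w = fst zs"
        by eventually_elim (use excess_eq_0 in force)
      then have "AE \<omega> in W. \<forall>s\<ge>1. X (\<theta> s \<omega>) = fst zs"
        by (intro AE_samples) auto
      then show ?thesis
      proof eventually_elim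
        case (elim \<omega>)
        have "dual_objective (empirical n) (\<lambda>s. X (\<theta> s \<omega>)) A \<epsilon> = dual_objective M X A \<epsilon>" for n
        proof
          fix z
          interpret E: payoff "empirical n" "\<lambda>s. X (\<theta> s \<omega>)" by (rule payoff_empirical)
          have "AE s in empirical n. X (\<theta> s \<omega>) = fst zs" using elim by (simp add: AE_empirical)
          then show "dual_objective (empirical n) (\<lambda>s. X (\<theta> s \<omega>)) A \<epsilon> z = dual_objective M X A \<epsilon> z"
            using dual_objective_constant[OF E.prob_space_axioms E.payoff_measurable]
              dual_objective_constant[OF prob_space_axioms payoff_measurable c] by simp
        qed
        then have eq: "dual_minimizers (empirical n) (\<lambda>s. X (\<theta> s \<omega>)) A \<epsilon> = dual_minimizers M X A \<epsilon>" for n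
          by (simp add: dual_minimizers_def)
        show ?case
          unfolding eq
        proof (intro allI impI always_eventually ballI)
          fix \<eta> :: real and z assume "0 < \<eta>" "z \<in> dual_minimizers M X A \<epsilon>"
          then show "\<exists>z'\<in>dual_minimizers M X A \<epsilon>. dist z z' < \<eta>" by (intro bexI[of _ z]) simp_all
        qed
      qed
    qed
  qed
qed

lemma deviation_saa_minimizers_tendsto:
  assumes "0 \<le> \<epsilon>" and "cgvi_minimizers M \<phi> \<epsilon> X \<noteq> {}"
  shows "AE \<omega> in W. (\<lambda>S. deviation (saa_minimizers \<phi> \<epsilon> (\<lambda>s. X (\<theta> s \<omega>)) S) (cgvi_minimizers M \<phi> \<epsilon> X)) \<longlonglongrightarrow> 0"
proof -
  obtain zs where "zs \<in> dual_minimizers M X A \<epsilon>" using assms(2) by (auto simp: cgvi_minimizers_eq)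
  from minimizers_near[OF assms(1) this] show ?thesis
  proof eventually_elim
    case (elim \<omega>)
    have "(\<lambda>n. deviation (dual_minimizers (empirical n) (\<lambda>s. X (\<theta> s \<omega>)) A \<epsilon>) (dual_minimizers M X A \<epsilon>)) \<longlonglongrightarrow> 0"
      by (rule deviation_tendsto_0) (use elim in blast)
    then show ?case
      unfolding saa_minimizers_eq[symmetric] cgvi_minimizers_eq[symmetric] by (rule LIMSEQ_imp_Suc)
  qed
qed

end

text \<open>Attainment is asserted for positive radius only: at radius 0 with flat part
  \<open>{(0, 0)}\<close>, a minimizer exists only if the payoff is almost surely constant. The last
  claim concerns a nonempty target set, since any nonempty set has infinite deviation from the empty
  one.\<close>

theorem theorem19:
  fixes P :: "'a measure" and \<phi> :: "real \<Rightarrow> ereal" and \<epsilon> :: real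
    and m :: "'a \<Rightarrow> 'y \<Rightarrow> real" and y :: "nat \<Rightarrow> 'y" and N :: nat
    and W :: "'w measure" and \<theta> :: "nat \<Rightarrow> 'w \<Rightarrow> 'a"
  assumes "prob_space P" and "complete_measure P"
    and "divergence_fun \<phi>"
    and "risk_averse_disutility (fenchel \<phi>)"
    and "\<exists>t>0. fenchel \<phi> t < \<infinity>"
    and "1 \<le> N"
    and "mean_payoff m y N \<in> orlicz P (half_conj (half_conj (fenchel \<phi>)))"
    and "0 \<le> \<epsilon>"
    and "prob_space W"
    and "prob_space.indep_vars W (\<lambda>_. P) \<theta> {1..}"
    and "\<And>s. 1 \<le> s \<Longrightarrow> distr W P (\<theta> s) = P"
  shows "cgvi_value P \<phi> \<epsilon> (mean_payoff m y N)
           = (INF z\<in>multipliers. cgvi_objective P \<phi> \<epsilon> (mean_payoff m y N) z)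
       \<and> (0 < \<epsilon> \<longrightarrow> cgvi_minimizers P \<phi> \<epsilon> (mean_payoff m y N) \<noteq> {})
       \<and> (AE \<omega> in W. (\<lambda>S. saa_value \<phi> \<epsilon> (\<lambda>s. mean_payoff m y N (\<theta> s \<omega>)) S)
            \<longlonglongrightarrow> cgvi_value P \<phi> \<epsilon> (mean_payoff m y N))
       \<and> (cgvi_minimizers P \<phi> \<epsilon> (mean_payoff m y N) \<noteq> {} \<longrightarrow>
          (AE \<omega> in W. (\<lambda>S. deviation (saa_minimizers \<phi> \<epsilon> (\<lambda>s. mean_payoff m y N (\<theta> s \<omega>)) S)
                                (cgvi_minimizers P \<phi> \<epsilon> (mean_payoff m y N))) \<longlonglongrightarrow> 0))"
proof -
  let ?X = "mean_payoff m y N"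
  interpret divergence \<phi> by unfold_locales fact+
  obtain a where a: "(\<integral>\<^sup>+ w. excess A a (?X w) \<partial>P) < \<infinity>"
    using orlicz_payoff(2)[OF assms(1,7)] by blast
  have "payoff P ?X"
    using assms(1) orlicz_payoff(1)[OF assms(1,7)] by (simp add: payoff_def payoff_axioms_def)
  moreover have "\<exists>z. (\<integral>\<^sup>+ w. excess A (snd z) (?X w - fst z) \<partial>P) < \<infinity>"
    using a by (intro exI[of _ "(0, a)"]) simp
  ultimately interpret sampled_cgvi \<phi> P ?X W \<theta>
    by (intro sampled_cgvi.intro cgvi_problem.intro tame_problem.intro tame_problem_axioms.intro
        dual_problem.intro iid_samples.intro iid_samples_axioms.intro
        divergence_axioms perturbation_set_axioms flat_perturbations_bounded assms)
  have duality: "cgvi_value P \<phi> \<epsilon> ?X = (INF z\<in>multipliers. cgvi_objective P \<phi> \<epsilon> ?X z)"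
    unfolding cgvi_value_eq_INF[OF assms(8)] by (intro INF_cong) (auto simp: cgvi_objective_eq[OF payoff_MX])
  have "cgvi_minimizers P \<phi> \<epsilon> ?X \<noteq> {}" if pos: "0 < \<epsilon>"
  proof -
    obtain z where "z \<in> multipliers" "dual_objective P ?X A \<epsilon> z = cgvi_value P \<phi> \<epsilon> ?X"
      using strong_duality_attained[OF pos] by blast
    then have "z \<in> dual_minimizers P ?X A \<epsilon>"
      using cgvi_value_le[OF payoff_MX] by (simp add: dual_minimizers_iff)
    then show ?thesis by (auto simp: cgvi_minimizers_eq)
  qed
  with duality saa_value_tendsto[OF assms(8)] deviation_saa_minimizers_tendsto[OF assms(8)] show ?thesis
    by blast
qed

end
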